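(* Let $\mathbb{F}$ be a field and let $n\geq 2$. Let $A(s)\in \mathbb{F}[s]^{n \times n}$ be a regular matrix pencil and $\phi_1(s,t)\mid \dots\mid \phi_n(s,t)$ be its homogeneous invariant factors. Let $\Psi(s,t)\in \mathbb{F}[s,t]$ be a nonzero homogeneous polynomial, monic with respect to $s$, and such that $\deg (\Psi(s, t))= n$. Assume that $\mathbb{F}\cup \{\infty\}\not\subseteq \Lambda(A(s))\cup \Lambda(\Psi(s,t))$. Let $r$ be a nonnegative integer, $r\leq n$. There exists a matrix pencil $P(s)\in \mathbb{F}[s]^{n \times n}$ with $\operatorname{rank}(P(s))=r$ such that, if $C(s, t)$ is the homogeneous pencil associated to $A(s)+P(s)$, then $\det (C(s,t))=k\Psi(s,t)$ with $0\neq k \in \mathbb{F}$, if and only if $$\phi_1(s,t)\cdots\phi_{n-r}(s,t)\mid \Psi(s,t).$$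
   Context: A matrix pencil is a polynomial matrix $G(s)=G_0+sG_1\in\mathbb{F}[s]^{m\times n}$ of degree at most $1$ ($G_0,G_1\in\mathbb{F}^{m\times n}$). It is regular if $m=n$ and $\det G(s)$ is a nonzero polynomial. $\operatorname{rank}(G(s))$ denotes the normal rank, i.e. the rank of $G(s)$ over the field of fractions of $\mathbb{F}[s]$. The homogeneous pencil associated to $G(s)=G_0+sG_1$ is $G(s,t)=tG_0+sG_1\in\mathbb{F}[s,t]^{m\times n}$. If $G(s)$ has normal rank $\rho$, then for $1\le k\le\rho$ let $\Delta_k(s,t)$ be the greatest common divisor of the $k\times k$ minors of $G(s,t)$, a homogeneous polynomial normalized to be monic with respect to $s$, and $\Delta_0:=1$. The homogeneous invariant factors of $G(s)$ are $\Gamma_k(s,t)=\Delta_k(s,t)/\Delta_{k-1}(s,t)$, $1\le k\le\rho$; they satisfy $\Gamma_1\mid\dots\mid\Gamma_\rho$. A homogeneous polynomial in $s,t$ is monic with respect to $s$ if its monomial of highest degree in $s$ has coefficient $1$. With $\overline{\mathbb{F}}$ the algebraic closure of $\mathbb{F}$, the spectrum of a pencil is $\Lambda(G(s))=\{\lambda\in\overline{\mathbb{F}}\cup\{\infty\} : \operatorname{rank}(G(\lambda))<\operatorname{rank}(G(s))\}$, where $G(\infty):=G_1$. For a homogeneous polynomial $\Gamma(s,t)$, $\Lambda(\Gamma(s,t)):=\{\lambda\in\overline{\mathbb{F}}\cup\{\infty\} : \Gamma(\lambda,1)=0\}$, where $\Gamma(\infty,1):=\Gamma(1,0)$. An empty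 product equals $1$. *)

theory Defs
  imports
    "Jordan_Normal_Form.DL_Rank"
    "Jordan_Normal_Form.DL_Submatrix"
    "HOL-Algebra.Algebraic_Closure_Type"
begin

text \<open>
  Bivariate polynomials in \<open>F[s,t]\<close> are elements of \<^typ>\<open>'a poly poly\<close>: the outer variable is
  \<open>s\<close>, the inner one is \<open>t\<close>, so that \<open>coeff (coeff p i) j\<close> is the coefficient of \<open>s^i t^j\<close>.
  Matrices over \<open>F[s]\<close> are elements of \<^typ>\<open>'a poly mat\<close>.
\<close>

definition homogeneous :: "nat \<Rightarrow> 'a::zero poly poly \<Rightarrow> bool" where
  "homogeneous d p \<longleftrightarrow> (\<forall>i j. Polynomial.coeff (Polynomial.coeff p i) j \<noteq> 0 \<longrightarrow> i + j = d)"

text \<open>For a homogeneous polynomial the leading coefficient with respect to \<open>s\<close> is of the form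
  \<open>c t^j\<close>, and its own leading coefficient is the scalar \<open>c\<close>.\<close>

definition monic_wrt_s :: "'a::{zero,one} poly poly \<Rightarrow> bool" where
  "monic_wrt_s p \<longleftrightarrow> Polynomial.lead_coeff (Polynomial.lead_coeff p) = 1"

definition is_pencil :: "nat \<Rightarrow> nat \<Rightarrow> 'a::zero poly mat \<Rightarrow> bool" where
  "is_pencil m n G \<longleftrightarrow>
     G \<in> carrier_mat m n \<and> (\<forall>i<m. \<forall>j<n. Polynomial.degree (G $$ (i, j)) \<le> 1)"

definition regular_pencil :: "nat \<Rightarrow> 'a::comm_ring_1 poly mat \<Rightarrow> bool" where
  "regular_pencil n G \<longleftrightarrow> is_pencil n n G \<and> det G \<noteq> 0"

definition normal_rank :: "'a::field poly mat \<Rightarrow> nat" where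
  "normal_rank G = vec_space.rank (dim_row G) (map_mat to_fract G)"

text \<open>An entry \<open>a + s b\<close> becomes \<open>t a + s b\<close>.\<close>

definition hom_pencil :: "'a::comm_ring_1 poly mat \<Rightarrow> 'a poly poly mat" where
  "hom_pencil G =
     map_mat (\<lambda>p. [: [:0, Polynomial.coeff p 0:], [:Polynomial.coeff p 1:] :]) G"

definition minors :: "nat \<Rightarrow> 'a::comm_ring_1 mat \<Rightarrow> 'a set" where
  "minors k M = {det (submatrix M I J) | I J.
     I \<subseteq> {..<dim_row M} \<and> J \<subseteq> {..<dim_col M} \<and> card I = k \<and> card J = k}"

definition is_gcd_of :: "'a::comm_semiring_1 \<Rightarrow> 'a set \<Rightarrow> bool" where
  "is_gcd_of d S \<longleftrightarrow> (\<forall>x\<in>S. d dvd x) \<and> (\<forall>c. (\<forall>x\<in>S. c dvd x) \<longrightarrow> c dvd d)"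

text \<open>The determinantal divisor \<open>\<Delta>\<^sub>k\<close>; meaningful for \<open>k \<le> normal_rank G\<close>, where the minors are
  not all zero. The library gcd on \<^typ>\<open>'a poly poly\<close> is not available for an arbitrary field
  \<^typ>\<open>'a\<close>, and its normalization would be a different one.\<close>

definition det_divisor :: "'a::field poly mat \<Rightarrow> nat \<Rightarrow> 'a poly poly" where
  "det_divisor G k = (if k = 0 then 1 else
     (THE d. is_gcd_of d (minors k (hom_pencil G)) \<and> (\<exists>m. homogeneous m d) \<and> monic_wrt_s d))"

definition hom_inv_factor :: "'a::field poly mat \<Rightarrow> nat \<Rightarrow> 'a poly poly" where
  "hom_inv_factor G k = det_divisor G k div det_divisor G (k - 1)"

datatype 'a with_infinity = Fin 'a | Infty

primrec pencil_at :: "'a::field poly mat \<Rightarrow> 'a alg_closure with_infinity \<Rightarrow> 'a alg_closure mat" where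
  "pencil_at G (Fin l) = map_mat (\<lambda>p. poly (map_poly to_ac p) l) G"
| "pencil_at G Infty = map_mat (\<lambda>p. to_ac (Polynomial.coeff p 1)) G"

definition pencil_spectrum :: "'a::field poly mat \<Rightarrow> 'a alg_closure with_infinity set" where
  "pencil_spectrum G = {l. vec_space.rank (dim_row G) (pencil_at G l) < normal_rank G}"

definition eval2 :: "'a::field poly poly \<Rightarrow> 'a alg_closure \<Rightarrow> 'a alg_closure \<Rightarrow> 'a alg_closure" where
  "eval2 p x y = poly (map_poly (\<lambda>q. poly (map_poly to_ac q) y) p) x"

primrec hom_poly_at :: "'a::field poly poly \<Rightarrow> 'a alg_closure with_infinity \<Rightarrow> 'a alg_closure" where
  "hom_poly_at p (Fin l) = eval2 p l 1"
| "hom_poly_at p Infty = eval2 p 1 0"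

definition hom_poly_spectrum :: "'a::field poly poly \<Rightarrow> 'a alg_closure with_infinity set" where
  "hom_poly_spectrum p = {l. hom_poly_at p l = 0}"

text \<open>The copy of \<open>F \<union> {\<infinity>}\<close> inside the algebraic closure extended by \<open>\<infinity>\<close>.\<close>

definition base_points :: "'a::field alg_closure with_infinity set" where
  "base_points = insert Infty (range (\<lambda>x. Fin (to_ac x)))"

end

theory Submission
  imports Defs "Jordan_Normal_Form.Char_Poly" "Jordan_Normal_Form.DL_Rank_Submatrix"
begin

text \<open>
  Expanding \<open>det (A + P)\<close> row by row, every term contains \<open>n - r\<close> rows of \<open>A\<close> or \<open>r + 1\<close> rows of \<open>P\<close>,
  so \<open>\<Delta>\<^sub>n\<^sub>-\<^sub>r = \<phi>\<^sub>1 \<cdots> \<phi>\<^sub>n\<^sub>-\<^sub>r\<close> divides it when \<open>P\<close> has rank \<open>r\<close>.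

  For the converse, a base point outside both spectra is moved to infinity, which turns \<open>A\<close> into
  \<open>N (x - T)\<close> with \<open>N\<close> invertible and \<open>\<Psi>\<close> into a polynomial of degree \<open>n\<close>. The Smith form of \<open>x - T\<close>
  provides \<open>r\<close> polynomial columns which, together with the columns of \<open>x - T\<close>, span a matrix of
  determinant \<open>\<phi>\<^sub>1 \<cdots> \<phi>\<^sub>n\<^sub>-\<^sub>r\<close>; modulo \<open>x - T\<close> they become constant columns \<open>u\<^sub>1, \<dots>, u\<^sub>r\<close>. As in Heymann's
  lemma, rank one changes of \<open>T\<close> in the directions \<open>u\<^sub>2, \<dots>, u\<^sub>r\<close> bring these columns into the module
  spanned by \<open>x - T\<close> and \<open>u\<^sub>1\<close>, and pole assignment with the single input \<open>u\<^sub>1\<close> then yields a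
  perturbation of rank at most \<open>r\<close> with the required determinant.

  To reach rank exactly \<open>r\<close>, the perturbed pencil \<open>B\<close> is replaced by \<open>R B\<close>, where \<open>R\<close> of determinant \<open>1\<close>
  runs through a sequence whose consecutive members differ by rank one: the rank of \<open>R B - A\<close> grows
  by at most one in each step, and it is \<open>n\<close> at the end.
\<close>

section \<open>Minors\<close>

text \<open>The base point has two jobs. If \<open>q\<close> is the linear polynomial belonging to
  the form that vanishes there, a perturbation can be sought as \<open>q K\<close> with
  \<open>K\<close> constant: moving the point to infinity turns that form into \<open>1\<close>, so
  only the constant matrix \<open>T\<close> changes. And passing from \<open>F[s,t]\<close> to
  \<open>F[x]\<close> loses exactly the powers of this form, so divisibility can be pulled back only
  for divisors that do not vanish at the point. Divisors of the homogeneous determinant of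
  \<open>A\<close> and of \<Psi> have this property, which is why determinantal divisors can be
  studied in the principal ideal domain \<open>F[x]\<close>.

  Assigning the determinant controls the rank only from above, since the rank one terms may vanish
  or cancel. Left multiplication by a constant \<open>R\<close> of determinant \<open>1\<close>
  leaves the determinant alone, while at the base point, where \<open>B = A + q K\<close> agrees
  with \<open>A\<close>, the pencil \<open>R B - A\<close> takes the value of
  \<open>(R - 1) A\<close>. So the end of the path is nonsingular as soon as \<open>R - 1\<close>
  is. For \<open>n = 1\<close> the only such \<open>R\<close> is \<open>1\<close>, and there is no
  path.\<close>

lemma pick_strict_mono_image:
  fixes f :: "nat \<Rightarrow> nat"
  assumes "strict_mono_on {..<m} f" and "i < m"
  shows "pick (f ` {..<m}) i = f i"
proof -
  have eq: "{a \<in> f ` {..<m}. a < f i} = f ` {..<i}"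
  proof -
    have "f a < f i \<longleftrightarrow> a < i" if "a < m" for a
      using assms that by (metis lessThan_iff linorder_neqE_nat not_less_iff_gr_or_eq strict_mono_onD)
    then show ?thesis using assms(2) by auto
  qed
  have "inj_on f {..<i}"
    using assms by (meson inj_on_subset lessThan_subset_iff less_imp_le_nat strict_mono_on_imp_inj_on)
  then have "card (f ` {..<i}) = i" by (simp add: card_image)
  then show ?thesis
    using pick_card_in_set[of "f i" "f ` {..<m}"] assms(2) unfolding eq by auto
qed

text \<open>Increasing index functions compose well with the deletion of rows and columns; this
  converts them back to the index sets of \<open>minors\<close>.\<close>

lemma strict_mono_minor_in_minors:
  assumes f: "strict_mono_on {..<k} f" "f ` {..<k} \<subseteq> {..<dim_row A}"
    and g: "strict_mono_on {..<k} g" "g ` {..<k} \<subseteq> {..<dim_col A}"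
    and M: "M \<in> carrier_mat k k" "\<And>i j. i < k \<Longrightarrow> j < k \<Longrightarrow> M $$ (i, j) = A $$ (f i, g j)"
  shows "det M \<in> minors k A"
proof -
  let ?I = "f ` {..<k}" and ?J = "g ` {..<k}"
  have c: "card ?I = k" "card ?J = k"
    using f g by (simp_all add: card_image strict_mono_on_imp_inj_on)
  have "{i. i < dim_row A \<and> i \<in> ?I} = ?I" "{j. j < dim_col A \<and> j \<in> ?J} = ?J"
    using f(2) g(2) by auto
  then have "submatrix A ?I ?J = M"
    using M c unfolding submatrix_def
    by (intro eq_matI) (auto simp: pick_strict_mono_image[OF f(1)] pick_strict_mono_image[OF g(1)])
  then show ?thesis unfolding minors_def using c f(2) g(2) by blast
qed

text \<open>Laplace expansion along rows outside \<open>S\<close>, and along row \<open>0\<close>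
  once all rows are copied but still too many, ends in minors of \<open>A\<close> of order
  \<open>k\<close>. Rows outside \<open>S\<close> are arbitrary, so this serves both for matrices
  that mix rows of \<open>A\<close> and \<open>P\<close> and for larger minors of
  \<open>A\<close>.\<close>

lemma minor_dvd_det:
  fixes A M :: "'a::comm_ring_1 mat"
  assumes "\<And>x. x \<in> minors k A \<Longrightarrow> d dvd x"
    and "M \<in> carrier_mat m m" and "S \<subseteq> {..<m}" and "k \<le> card S"
    and "strict_mono_on S f" and "f ` S \<subseteq> {..<dim_row A}"
    and "strict_mono_on {..<m} g" and "g ` {..<m} \<subseteq> {..<dim_col A}"
    and "\<And>i j. i \<in> S \<Longrightarrow> j < m \<Longrightarrow> M $$ (i, j) = A $$ (f i, g j)"
  shows "d dvd det M"
  using assms(2-)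
proof (induction m arbitrary: M S f g)
  case 0
  then have "S = {}" by auto
  then have "k = 0" using "0.prems" by auto
  then have "det M \<in> minors k A"
    using 0 by (intro strict_mono_minor_in_minors[of _ f _ g]) auto
  then show ?case by (rule assms(1))
next
  case (Suc m)
  show ?case
  proof (cases "k = Suc m")
    case True
    have "card S \<le> card {..<Suc m}" using Suc.prems(2) by (intro card_mono) auto
    then have "card S = card {..<Suc m}" using True Suc.prems(3) by simp
    then have S: "S = {..<Suc m}" using Suc.prems(2) by (simp add: card_subset_eq)
    have "det M \<in> minors k A" unfolding True
      using Suc.prems unfolding S by (intro strict_mono_minor_in_minors[of _ f _ g]) auto
    then show ?thesis by (rule assms(1))
  next
    case False
    have cS: "card S \<le> Suc m" using card_mono[OF _ Suc.prems(2)] by simp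
    \<comment> \<open>A row outside \<open>S\<close> costs nothing. If there is none,
      \<open>card S = Suc m > k\<close>, and one row can be spared.\<close>
    have "\<exists>i0<Suc m. k \<le> card (S - {i0})"
    proof (cases "S = {..<Suc m}")
      case True
      then have "card (S - {0}) = m" by simp
      then show ?thesis using False Suc.prems(3) cS by (intro exI[of _ 0]) auto
    next
      case False
      then obtain i0 where "i0 < Suc m" "i0 \<notin> S" using Suc.prems(2) by blast
      then show ?thesis using Suc.prems(3) by (intro exI[of _ i0]) auto
    qed
    then obtain i0 where i0: "i0 < Suc m" "k \<le> card (S - {i0})" by blast
    \<comment> \<open>\<open>insert_index i0\<close> recovers the old index of a row after the
      deletion of row \<open>i0\<close>, so \<open>S'\<close> is \<open>S - {i0}\<close>
      renumbered.\<close>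
    define S' where "S' = {i. i < m \<and> insert_index i0 i \<in> S}"
    have sm: "strict_mono (insert_index j)" for j
      unfolding strict_mono_def insert_index_def by auto
    have imS: "insert_index i0 ` S' = S - {i0}"
    proof -
      have "x \<in> insert_index i0 ` S'" if "x \<in> S" "x \<noteq> i0" for x
      proof (cases "x < i0")
        case True
        then show ?thesis using that i0 Suc.prems(2) unfolding S'_def
          by (intro image_eqI[of _ _ x]) auto
      next
        case False
        then have "x = insert_index i0 (x - 1)" "x - 1 < m"
          using that Suc.prems(2) by (auto simp: insert_index_def)
        then show ?thesis using that(1) unfolding S'_def
          by (intro image_eqI[of _ _ "x - 1"]) simp_all
      qed
      then show ?thesis unfolding S'_def by (auto simp: insert_index_def)
    qed
    have cS': "card S' = card (S - {i0})"
      unfolding imS[symmetric] using sm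
      by (metis card_image inj_on_subset strict_mono_imp_inj_on subset_UNIV)
    have dd: "d dvd det (mat_delete M i0 j)" if j: "j < Suc m" for j
    proof (rule Suc.IH[of _ S' "f \<circ> insert_index i0" "g \<circ> insert_index j"])
      show "mat_delete M i0 j \<in> carrier_mat m m"
        using mat_delete_carrier[OF Suc.prems(1)] by simp
      show "S' \<subseteq> {..<m}" unfolding S'_def by auto
      show "k \<le> card S'" using cS' i0 by simp
      show "strict_mono_on S' (f \<circ> insert_index i0)"
        using Suc.prems(4) sm[of i0] unfolding S'_def
        by (auto simp: strict_mono_on_def strict_mono_def)
      show "(f \<circ> insert_index i0) ` S' \<subseteq> {..<dim_row A}"
        using Suc.prems(5) imS unfolding image_comp[symmetric] by auto
      have im: "insert_index j ` {..<m} \<subseteq> {..<Suc m}" by (auto simp: insert_index_def)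
      show "strict_mono_on {..<m} (g \<circ> insert_index j)"
        using Suc.prems(6) sm[of j] im
        by (auto simp: strict_mono_on_def strict_mono_def image_subset_iff)
      show "(g \<circ> insert_index j) ` {..<m} \<subseteq> {..<dim_col A}"
        using Suc.prems(7) im unfolding image_comp[symmetric] by blast
      fix i j' assume ij: "i \<in> S'" "j' < m"
      then have "mat_delete M i0 j $$ (i, j') = M $$ (insert_index i0 i, insert_index j j')"
        using mat_delete_index[OF Suc.prems(1) i0(1) j] S'_def by simp
      also have "\<dots> = A $$ (f (insert_index i0 i), g (insert_index j j'))"
        using ij im by (intro Suc.prems(8)) (auto simp: S'_def)
      finally show "mat_delete M i0 j $$ (i, j') =
        A $$ ((f \<circ> insert_index i0) i, (g \<circ> insert_index j) j')" by simp
    qed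
    show ?thesis
      unfolding laplace_expansion_row[OF Suc.prems(1) i0(1)] cofactor_def
      using dd by (intro dvd_sum dvd_mult) auto
  qed
qed

text \<open>The case of \<open>minor_dvd_det\<close> in which every row is copied. It makes each
  determinantal divisor divide the next one, and common divisors of minors divide the full
  determinant.\<close>

lemma minors_dvd_minors:
  fixes A :: "'a::comm_ring_1 mat"
  assumes "\<And>x. x \<in> minors k A \<Longrightarrow> d dvd x" and "k \<le> m" and "y \<in> minors m A"
  shows "d dvd y"
proof -
  obtain I J where IJ: "I \<subseteq> {..<dim_row A}" "J \<subseteq> {..<dim_col A}" "card I = m" "card J = m"
    and y: "y = det (submatrix A I J)"
    using assms(3) unfolding minors_def by blast
  have eq: "{i. i < dim_row A \<and> i \<in> I} = I" "{j. j < dim_col A \<and> j \<in> J} = J" using IJ by auto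
  have fin: "finite I" "finite J" using IJ finite_subset by blast+
  have pk: "strict_mono_on {..<m} (pick K)" "pick K ` {..<m} \<subseteq> K" if "finite K" "card K = m" for K
    using that pick_mono_le[of _ K] pick_in_set_le[of _ K]
    by (auto simp: strict_mono_on_def)
  show ?thesis unfolding y
  proof (rule minor_dvd_det[OF assms(1), where S = "{..<m}" and m = m and f = "pick I" and g = "pick J"])
    show "submatrix A I J \<in> carrier_mat m m"
      by (rule carrier_matI) (simp_all add: dim_submatrix eq IJ(3,4))
    show "submatrix A I J $$ (i, j) = A $$ (pick I i, pick J j)" if "i \<in> {..<m}" "j < m" for i j
      using that by (simp add: submatrix_index eq IJ(3,4))
  qed (use assms(2) IJ pk[OF fin(1)] pk[OF fin(2)] in auto)
qed

lemma minors_full: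
  assumes "A \<in> carrier_mat n n"
  shows "minors n A = {det A}"
proof -
  have *: "I = {..<n}" if "I \<subseteq> {..<n}" "card I = n" for I
    using that by (simp add: card_subset_eq)
  have "submatrix A {..<n} {..<n} = A"
    using assms pick_strict_mono_image[of n id] unfolding submatrix_def
    by (intro eq_matI) (auto simp: strict_mono_on_def)
  then have "x = det A" if "x \<in> minors n A" for x
  proof -
    obtain I J where "I \<subseteq> {..<n}" "J \<subseteq> {..<n}" "card I = n" "card J = n"
      "x = det (submatrix A I J)"
      using \<open>x \<in> minors n A\<close> assms unfolding minors_def by auto
    then show ?thesis using \<open>submatrix A {..<n} {..<n} = A\<close> * by metis
  qed
  moreover have "det A \<in> minors n A"
    using assms by (intro strict_mono_minor_in_minors[of _ id _ id]) (auto simp: strict_mono_on_def)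
  ultimately show ?thesis by blast
qed

lemma det_add_dvd:
  fixes A P :: "'a::comm_ring_1 mat"
  assumes A: "A \<in> carrier_mat n n" and P: "P \<in> carrier_mat n n"
    and dA: "\<And>x. x \<in> minors (n - r) A \<Longrightarrow> d dvd x"
    and zP: "\<And>x. x \<in> minors (Suc r) P \<Longrightarrow> x = 0"
    and r: "r \<le> n"
  shows "d dvd det (A + P)"
proof -
  define a where "a i = vec n (\<lambda>j. A $$ (i, j))" for i
  define p where "p i = vec n (\<lambda>j. P $$ (i, j))" for i
  \<comment> \<open>Rows in \<open>U\<close> are still sums; the others are decided, taken from
    \<open>A\<close> if in \<open>S\<close> and from \<open>P\<close> otherwise. Splitting one row
    of \<open>U\<close> at a time ends at \<open>U = {}\<close>.\<close>
  define M where "M U S = mat\<^sub>r n n (\<lambda>i. if i \<in> U then a i + p i else if i \<in> S then a i else p i)"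
    for U S
  have ap: "a i \<in> carrier_vec n" "p i \<in> carrier_vec n" for i unfolding a_def p_def by auto
  have id: "strict_mono_on T (\<lambda>x::nat. x)" for T by (auto simp: strict_mono_on_def)
  have dM: "d dvd det (M U S)" if "finite U" "U \<subseteq> {..<n}" "S \<subseteq> {..<n}" for U S
    using that
  proof (induction U arbitrary: S rule: finite_induct)
    case empty
    have Mc: "M {} S \<in> carrier_mat n n" unfolding M_def by auto
    show ?case
    proof (cases "n - r \<le> card S")
      case True
      show ?thesis
        by (rule minor_dvd_det[of "n - r" A, OF _ Mc empty(2) True id _ id])
          (use A dA empty in \<open>auto simp: M_def a_def\<close>)
    next
      case False
      have "card ({..<n} - S) = n - card S" using empty by (simp add: card_Diff_subset finite_subset)
      then have c: "Suc r \<le> card ({..<n} - S)" using False r by linarith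
      \<comment> \<open>Vanishing minors are minors divisible by \<open>0\<close>, so the same lemma
        handles the terms with \<open>r + 1\<close> rows of \<open>P\<close>.\<close>
      have "0 dvd det (M {} S)"
        by (rule minor_dvd_det[of "Suc r" P, OF _ Mc _ c id _ id])
          (use P zP in \<open>auto simp: M_def p_def\<close>)
      then show ?thesis by simp
    qed
  next
    case (insert u U)
    have u: "u < n" using insert by auto
    have c: "(\<lambda>i. if i \<in> U then a i + p i else if i \<in> S then a i else p i) \<in> {0..<n} \<rightarrow> carrier_vec n"
      using ap by auto
    have eqs: "M (insert u U) S = mat\<^sub>r n n (\<lambda>i. if i = u then a i + p i
          else if i \<in> U then a i + p i else if i \<in> S then a i else p i)"
      "M U (insert u S) = mat\<^sub>r n n (\<lambda>i. if i = u then a i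
          else if i \<in> U then a i + p i else if i \<in> S then a i else p i)"
      "M U (S - {u}) = mat\<^sub>r n n (\<lambda>i. if i = u then p i
          else if i \<in> U then a i + p i else if i \<in> S then a i else p i)"
      using insert(2) unfolding M_def by (auto intro!: eq_matI)
    have "det (M (insert u U) S) = det (M U (insert u S)) + det (M U (S - {u}))"
      unfolding eqs by (rule det_row_add[OF ap(1) ap(2) c u])
    moreover have "d dvd det (M U (insert u S))" "d dvd det (M U (S - {u}))"
      by (rule insert.IH; use insert.prems u in auto)+
    ultimately show ?case by simp
  qed
  have "M {..<n} {} = A + P" using A P unfolding M_def a_def p_def by (intro eq_matI) auto
  then show ?thesis using dM[of "{..<n}" "{}"] by auto
qed

section \<open>Common divisors of minors under matrix multiplication\<close>

text \<open>The index functions may repeat values and need not increase: expanding a product of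
  matrices chooses a row of the right factor freely for every row of the minor.\<close>

definition fminor :: "nat \<Rightarrow> 'a::comm_ring_1 mat \<Rightarrow> (nat \<Rightarrow> nat) \<Rightarrow> (nat \<Rightarrow> nat) \<Rightarrow> 'a" where
  "fminor k A f g = det (mat k k (\<lambda>(i, j). A $$ (f i, g j)))"

definition dvd_fminors :: "'a::comm_ring_1 \<Rightarrow> nat \<Rightarrow> 'a mat \<Rightarrow> bool" where
  "dvd_fminors d k A \<longleftrightarrow>
     (\<forall>f g. f ` {..<k} \<subseteq> {..<dim_row A} \<longrightarrow> g ` {..<k} \<subseteq> {..<dim_col A} \<longrightarrow> d dvd fminor k A f g)"

lemma dvd_fminors_imp_dvd_minors:
  assumes "dvd_fminors d k A" and "x \<in> minors k A"
  shows "d dvd x"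
proof -
  obtain I J where IJ: "I \<subseteq> {..<dim_row A}" "J \<subseteq> {..<dim_col A}" "card I = k" "card J = k"
    and x: "x = det (submatrix A I J)"
    using assms(2) unfolding minors_def by blast
  have eq: "{i. i < dim_row A \<and> i \<in> I} = I" "{j. j < dim_col A \<and> j \<in> J} = J" using IJ by auto
  have "pick K ` {..<k} \<subseteq> K" if "card K = k" for K
    using that pick_in_set_le[of _ K] by auto
  then have "pick I ` {..<k} \<subseteq> I" "pick J ` {..<k} \<subseteq> J" using IJ(3,4) by blast+
  then have "d dvd fminor k A (pick I) (pick J)"
    using assms(1) IJ(1,2) unfolding dvd_fminors_def by (meson subset_trans)
  then show ?thesis unfolding x fminor_def submatrix_def eq IJ .
qed

lemma dvd_fminors_transpose:
  assumes "dvd_fminors d k A"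
  shows "dvd_fminors d k (transpose_mat A)"
  unfolding dvd_fminors_def
proof (intro allI impI)
  fix f g
  assume fg: "f ` {..<k} \<subseteq> {..<dim_row (transpose_mat A)}" "g ` {..<k} \<subseteq> {..<dim_col (transpose_mat A)}"
  have "fminor k (transpose_mat A) f g = det (transpose_mat (mat k k (\<lambda>(i, j). A $$ (g i, f j))))"
    unfolding fminor_def using fg by (intro arg_cong[of _ _ det] eq_matI) (auto simp: image_subset_iff)
  also have "\<dots> = fminor k A g f" unfolding fminor_def by (rule det_transpose[of _ k]) simp
  finally show "d dvd fminor k (transpose_mat A) f g"
    using assms fg unfolding dvd_fminors_def by simp
qed

text \<open>As for the Cauchy-Binet formula: each row of \<open>Q * A\<close> is a combination of
  rows of \<open>A\<close>, so multilinearity writes a minor of the product as a combination of the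
  \<open>fminor k A h g\<close> over all choices \<open>h\<close> of rows.\<close>

lemma dvd_fminors_mult_left:
  assumes A: "A \<in> carrier_mat n q" and Q: "Q \<in> carrier_mat p n" and d: "dvd_fminors d k A"
  shows "dvd_fminors d k (Q * A)"
  unfolding dvd_fminors_def
proof (intro allI impI)
  fix f g
  assume f: "f ` {..<k} \<subseteq> {..<dim_row (Q * A)}" and g: "g ` {..<k} \<subseteq> {..<dim_col (Q * A)}"
  define a where "a i l = Q $$ (f i, l) \<cdot>\<^sub>v vec k (\<lambda>j. A $$ (l, g j))" for i l
  have a: "a \<in> {0..<k} \<rightarrow> {..<n} \<rightarrow> carrier_vec k" unfolding a_def by auto
  have "mat k k (\<lambda>(i, j). (Q * A) $$ (f i, g j)) =
    mat\<^sub>r k k (\<lambda>i. finsum_vec TYPE('a) k (a i) {..<n})"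
  proof (rule eq_matI)
    fix i j assume "i < dim_row (mat\<^sub>r k k (\<lambda>i. finsum_vec TYPE('a) k (a i) {..<n}))"
      and "j < dim_col (mat\<^sub>r k k (\<lambda>i. finsum_vec TYPE('a) k (a i) {..<n}))"
    then have ij: "i < k" "j < k" by auto
    then have fi: "f i < p" "g j < q" using f g A Q by auto
    have "finsum_vec TYPE('a) k (a i) {..<n} $ j = (\<Sum>l<n. a i l $ j)"
      using ij a by (intro index_finsum_vec) auto
    also have "\<dots> = (\<Sum>l<n. Q $$ (f i, l) * A $$ (l, g j))" unfolding a_def using ij by simp
    also have "\<dots> = (Q * A) $$ (f i, g j)"
      using fi A Q by (simp add: scalar_prod_def lessThan_atLeast0)
    finally show "mat k k (\<lambda>(i, j). (Q * A) $$ (f i, g j)) $$ (i, j) =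
      mat\<^sub>r k k (\<lambda>i. finsum_vec TYPE('a) k (a i) {..<n}) $$ (i, j)" using ij by simp
  qed auto
  then have "fminor k (Q * A) f g = det (mat\<^sub>r k k (\<lambda>i. finsum_vec TYPE('a) k (a i) {..<n}))"
    unfolding fminor_def by simp
  also have "\<dots> = (\<Sum>h | (\<forall>i\<in>{0..<k}. h i \<in> {..<n}) \<and> (\<forall>i. i \<notin> {0..<k} \<longrightarrow> h i = i).
    det (mat\<^sub>r k k (\<lambda>i. a i (h i))))"
    by (rule det_linear_rows_sum[OF _ a]) simp
  finally have eq: "fminor k (Q * A) f g = \<dots>" .
  have "d dvd det (mat\<^sub>r k k (\<lambda>i. a i (h i)))" if h: "\<forall>i\<in>{0..<k}. h i \<in> {..<n}" for h
  proof -
    have "det (mat\<^sub>r k k (\<lambda>i. a i (h i))) =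
      (\<Prod>i = 0..<k. Q $$ (f i, h i)) * det (mat\<^sub>r k k (\<lambda>i. vec k (\<lambda>j. A $$ (h i, g j))))"
      unfolding a_def by (rule det_rows_mul) auto
    also have "mat\<^sub>r k k (\<lambda>i. vec k (\<lambda>j. A $$ (h i, g j))) = mat k k (\<lambda>(i, j). A $$ (h i, g j))"
      by (rule eq_matI) auto
    finally have "det (mat\<^sub>r k k (\<lambda>i. a i (h i))) =
      (\<Prod>i = 0..<k. Q $$ (f i, h i)) * fminor k A h g" unfolding fminor_def .
    moreover have "d dvd fminor k A h g"
    proof -
      have "h ` {..<k} \<subseteq> {..<dim_row A}" "g ` {..<k} \<subseteq> {..<dim_col A}" using h A g by auto
      then show ?thesis using d unfolding dvd_fminors_def by blast
    qed
    ultimately show ?thesis by simp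
  qed
  then show "d dvd fminor k (Q * A) f g" unfolding eq by (intro dvd_sum) auto
qed

lemma dvd_fminors_mult_right:
  assumes A: "A \<in> carrier_mat n q" and Y: "Y \<in> carrier_mat q p" and d: "dvd_fminors d k A"
  shows "dvd_fminors d k (A * Y)"
proof -
  have "dvd_fminors d k (transpose_mat Y * transpose_mat A)"
    by (rule dvd_fminors_mult_left[OF _ _ dvd_fminors_transpose[OF d]]) (use A Y in auto)
  then have "dvd_fminors d k (transpose_mat (transpose_mat Y * transpose_mat A))"
    by (rule dvd_fminors_transpose)
  then show ?thesis using transpose_mult[OF A Y] by (metis transpose_transpose)
qed

text \<open>Peel off the largest index: a set of \<open>Suc k\<close> natural numbers has maximum at
  least \<open>k\<close>, so \<open>\<delta> k\<close> divides the factor removed.\<close>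

lemma prod_divisor_chain_dvd:
  fixes \<delta> :: "nat \<Rightarrow> 'a::comm_monoid_mult"
  assumes "\<And>i j. i \<le> j \<Longrightarrow> j < n \<Longrightarrow> \<delta> i dvd \<delta> j" and "I \<subseteq> {..<n}" and "card I = k"
  shows "(\<Prod>i<k. \<delta> i) dvd (\<Prod>i\<in>I. \<delta> i)"
  using assms(2,3)
proof (induction k arbitrary: I)
  case (Suc k)
  have fin: "finite I" using Suc.prems(1) finite_subset by blast
  moreover have "I \<noteq> {}" using Suc.prems by auto
  ultimately have m: "Max I \<in> I" by simp
  have "I \<subseteq> {..Max I}" using fin by auto
  then have "card I \<le> card {..Max I}" by (intro card_mono) auto
  then have "\<delta> k dvd \<delta> (Max I)" using Suc.prems m by (intro assms(1)) auto
  moreover have "(\<Prod>i<k. \<delta> i) dvd (\<Prod>i\<in>I - {Max I}. \<delta> i)"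
    using Suc.prems m by (intro Suc.IH) (auto simp: card_Diff_singleton)
  ultimately show ?case
    using prod.remove[OF fin m, of \<delta>] by (simp add: mult.commute mult_dvd_mono)
qed simp

text \<open>A repeated row index makes the determinant zero. Otherwise a Leibniz term can be nonzero
  only if the permutation pairs each row \<open>f i\<close> with the column of the same index, and
  then it is a product of \<open>k\<close> distinct diagonal entries.\<close>

lemma dvd_fminors_diagonal:
  fixes D :: "'a::idom mat"
  assumes D: "D \<in> carrier_mat n n" and diag: "\<And>i j. i < n \<Longrightarrow> j < n \<Longrightarrow> i \<noteq> j \<Longrightarrow> D $$ (i, j) = 0"
    and chain: "\<And>i j. i \<le> j \<Longrightarrow> j < n \<Longrightarrow> D $$ (i, i) dvd D $$ (j, j)"
  shows "dvd_fminors (\<Prod>i<k. D $$ (i, i)) k D"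
  unfolding dvd_fminors_def
proof (intro allI impI)
  fix f g
  assume f: "f ` {..<k} \<subseteq> {..<dim_row D}" and g: "g ` {..<k} \<subseteq> {..<dim_col D}"
  let ?M = "mat k k (\<lambda>(i, j). D $$ (f i, g j))"
  show "(\<Prod>i<k. D $$ (i, i)) dvd fminor k D f g"
  proof (cases "inj_on f {..<k}")
    case False
    then obtain i j where ij: "i < k" "j < k" "i \<noteq> j" "f i = f j" unfolding inj_on_def by auto
    then have "det ?M = 0"
      by (intro det_identical_rows[of _ k i j]) auto
    then show ?thesis unfolding fminor_def by simp
  next
    case True
    have "(\<Prod>i<k. D $$ (i, i)) dvd (\<Prod>i = 0..<k. ?M $$ (i, p i))" if p: "p permutes {0..<k}" for p
    proof (cases "\<forall>i<k. f i = g (p i)")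
      case True2: True
      have "(\<Prod>i = 0..<k. ?M $$ (i, p i)) = (\<Prod>i<k. D $$ (f i, f i))"
        using True2 p permutes_in_image[OF p] unfolding lessThan_atLeast0
        by (intro prod.cong) auto
      also have "\<dots> = (\<Prod>i\<in>f ` {..<k}. D $$ (i, i))"
        using True by (simp add: prod.reindex)
      finally show ?thesis
        using prod_divisor_chain_dvd[of n "\<lambda>i. D $$ (i, i)" "f ` {..<k}" k] chain f D True
        by (simp add: card_image)
    next
      case False
      then obtain i where i: "i < k" "f i \<noteq> g (p i)" by blast
      have "p i < k" using i permutes_in_image[OF p, of i] by simp
      then have "?M $$ (i, p i) = 0" using i f g D by (auto intro!: diag)
      then have "(\<Prod>i = 0..<k. ?M $$ (i, p i)) = 0" using i by (intro prod_zero bexI[of _ i]) simp_all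
      then show ?thesis by (simp only: dvd_0_right)
    qed
    then show ?thesis unfolding fminor_def det_def'[OF mat_carrier]
      by (intro dvd_sum dvd_mult) simp
  qed
qed

section \<open>Smith normal form of polynomial matrices\<close>

text \<open>Division with remainder by an element of least degree. It supplies the generator in
  \<open>cyclic_generator\<close> and the gcd of dehomogenized minors.\<close>

lemma poly_ideal_principal:
  fixes J :: "'a::field poly set"
  assumes add: "\<And>p q. p \<in> J \<Longrightarrow> q \<in> J \<Longrightarrow> p + q \<in> J" and mult: "\<And>p q. p \<in> J \<Longrightarrow> q * p \<in> J"
    and "p0 \<in> J" and "p0 \<noteq> 0"
  obtains g where "g \<in> J" and "g \<noteq> 0" and "\<And>p. p \<in> J \<Longrightarrow> g dvd p"
proof -
  obtain g where g: "g \<in> J" "g \<noteq> 0" and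
    min: "\<And>p. p \<in> J \<Longrightarrow> p \<noteq> 0 \<Longrightarrow> Polynomial.degree g \<le> Polynomial.degree p"
    using ex_has_least_nat[of "\<lambda>p. p \<in> J \<and> p \<noteq> 0" p0 Polynomial.degree] assms(3,4) by metis
  have "g dvd p" if p: "p \<in> J" for p
  proof (rule ccontr)
    assume "\<not> g dvd p"
    then have nz: "p mod g \<noteq> 0" by (simp add: dvd_eq_mod_eq_0)
    have "p mod g = p + (- (p div g)) * g" by (simp add: minus_div_mult_eq_mod[symmetric])
    then have "p mod g \<in> J" using add[OF p mult[OF g(1), of "- (p div g)"]] by simp
    then have "Polynomial.degree g \<le> Polynomial.degree (p mod g)" using min nz by blast
    then show False using degree_mod_less[OF g(2), of p] nz by simp
  qed
  then show thesis using that g by blast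
qed

section \<open>Unimodular matrices and equivalence\<close>

definition unimodular :: "nat \<Rightarrow> 'a::comm_ring_1 mat \<Rightarrow> bool" where
  "unimodular n P \<longleftrightarrow> P \<in> carrier_mat n n \<and>
     (\<exists>P'\<in>carrier_mat n n. P * P' = 1\<^sub>m n \<and> P' * P = 1\<^sub>m n)"

lemma unimodularI:
  "P \<in> carrier_mat n n \<Longrightarrow> P' \<in> carrier_mat n n \<Longrightarrow> P * P' = 1\<^sub>m n \<Longrightarrow> P' * P = 1\<^sub>m n \<Longrightarrow>
    unimodular n P"
  unfolding unimodular_def by blast

lemma unimodular_mult:
  assumes "unimodular n P" "unimodular n Q"
  shows "unimodular n (P * Q)"
proof -
  obtain P' Q' where c: "P \<in> carrier_mat n n" "Q \<in> carrier_mat n n" "P' \<in> carrier_mat n n" "Q' \<in> carrier_mat n n"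
    and i: "P * P' = 1\<^sub>m n" "P' * P = 1\<^sub>m n" "Q * Q' = 1\<^sub>m n" "Q' * Q = 1\<^sub>m n"
    using assms unfolding unimodular_def by blast
  have "(P * Q) * (Q' * P') = P * ((Q * Q') * P')" "(Q' * P') * (P * Q) = Q' * ((P' * P) * Q)"
    using c by (simp_all add: assoc_mult_mat[of _ n n _ n _ n] mult_carrier_mat[of _ n n _ n])
  then show ?thesis using c i by (intro unimodularI[of _ _ "Q' * P'"]) auto
qed

lemma unimodular_one: "unimodular n (1\<^sub>m n)"
  by (rule unimodularI[of _ _ "1\<^sub>m n"]) auto

lemma unimodular_addrow_mat:
  assumes "k < n" "l < n" "k \<noteq> l"
  shows "unimodular n (addrow_mat n a k l)"
  using addrow_mat_inv[OF assms, of a] addrow_mat_inv[OF assms, of "- a"]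
  by (intro unimodularI[of _ _ "addrow_mat n (- a) k l"]) auto

lemma unimodular_swaprows_mat:
  assumes "k < n" "l < n"
  shows "unimodular n (swaprows_mat n k l)"
  using swaprows_mat_inv[OF assms] by (intro unimodularI[of _ _ "swaprows_mat n k l"]) auto

lemma four_block_carrier_Suc:
  "A \<in> carrier_mat 1 1 \<Longrightarrow> D \<in> carrier_mat n n \<Longrightarrow> four_block_mat A B C D \<in> carrier_mat (Suc n) (Suc n)"
  using four_block_carrier_mat[of A 1 1 D n n B C] by simp

lemma unimodular_block_diag:
  assumes "unimodular n P"
  shows "unimodular (Suc n) (four_block_mat (1\<^sub>m 1) (0\<^sub>m 1 n) (0\<^sub>m n 1) P)"
proof -
  obtain P' where P: "P \<in> carrier_mat n n" "P' \<in> carrier_mat n n" "P * P' = 1\<^sub>m n" "P' * P = 1\<^sub>m n"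
    using assms unfolding unimodular_def by blast
  have *: "four_block_mat (1\<^sub>m 1) (0\<^sub>m 1 n) (0\<^sub>m n 1) U * four_block_mat (1\<^sub>m 1) (0\<^sub>m 1 n) (0\<^sub>m n 1) V = 1\<^sub>m (Suc n)"
    if "U \<in> carrier_mat n n" "V \<in> carrier_mat n n" "U * V = 1\<^sub>m n" for U V :: "'a mat"
    using that by (subst mult_four_block_mat[of _ 1 1 _ n _ n _ _ 1 _ n]) auto
  show ?thesis
    by (rule unimodularI[OF _ _ *[OF P(1-3)] *[OF P(2,1,4)]]) (use P four_block_carrier_Suc in auto)
qed

lemma unimodular_lower:
  assumes q: "q \<in> carrier_mat n 1"
  shows "unimodular (Suc n) (four_block_mat (1\<^sub>m 1) (0\<^sub>m 1 n) q (1\<^sub>m n))"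
proof -
  have *: "four_block_mat (1\<^sub>m 1) (0\<^sub>m 1 n) u (1\<^sub>m n) * four_block_mat (1\<^sub>m 1) (0\<^sub>m 1 n) (- u) (1\<^sub>m n) = 1\<^sub>m (Suc n)"
    if u: "u \<in> carrier_mat n 1" for u :: "'a mat"
  proof -
    have "u + - u = 0\<^sub>m n 1" "1\<^sub>m 1 + - 0\<^sub>m 1 1 = (1\<^sub>m 1 :: 'a mat)" using u by auto
    then show ?thesis using u by (subst mult_four_block_mat[of _ 1 1 _ n _ n _ _ 1 _ n]) auto
  qed
  show ?thesis
    using *[OF q] *[of "- q"] q
    by (intro unimodularI[of _ _ "four_block_mat (1\<^sub>m 1) (0\<^sub>m 1 n) (- q) (1\<^sub>m n)"] four_block_carrier_Suc) auto
qed

lemma unimodular_transpose: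
  assumes "unimodular n P"
  shows "unimodular n (transpose_mat P)"
proof -
  obtain P' where P: "P \<in> carrier_mat n n" "P' \<in> carrier_mat n n" "P * P' = 1\<^sub>m n" "P' * P = 1\<^sub>m n"
    using assms unfolding unimodular_def by blast
  have "transpose_mat P * transpose_mat P' = 1\<^sub>m n" "transpose_mat P' * transpose_mat P = 1\<^sub>m n"
    unfolding transpose_mult[OF P(2,1), symmetric] transpose_mult[OF P(1,2), symmetric] P(3,4)
    by simp_all
  then show ?thesis using P by (intro unimodularI[of _ _ "transpose_mat P'"]) auto
qed

lemma unimodular_upper:
  assumes q: "q \<in> carrier_mat 1 n"
  shows "unimodular (Suc n) (four_block_mat (1\<^sub>m 1) q (0\<^sub>m n 1) (1\<^sub>m n))"
proof -
  have qT: "transpose_mat q \<in> carrier_mat n 1" using q by simp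
  have eq: "transpose_mat (four_block_mat (1\<^sub>m 1) (0\<^sub>m 1 n) (transpose_mat q) (1\<^sub>m n)) =
    four_block_mat (1\<^sub>m 1) q (0\<^sub>m n 1) (1\<^sub>m n)"
    using q by (intro eq_matI) auto
  show ?thesis using unimodular_transpose[OF unimodular_lower[OF qT]] unfolding eq .
qed

definition mat_equivalent :: "nat \<Rightarrow> 'a::comm_ring_1 mat \<Rightarrow> 'a mat \<Rightarrow> bool" where
  "mat_equivalent n A B \<longleftrightarrow> B \<in> carrier_mat n n \<and> (\<exists>P Q. unimodular n P \<and> unimodular n Q \<and> A = P * B * Q)"

lemma mat_equivalent_refl: "A \<in> carrier_mat n n \<Longrightarrow> mat_equivalent n A A"
  unfolding mat_equivalent_def using unimodular_one by (auto intro!: exI[of _ "1\<^sub>m n"])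

lemma mat_equivalent_trans:
  assumes "mat_equivalent n A B" "mat_equivalent n B C"
  shows "mat_equivalent n A C"
proof -
  obtain P Q P2 Q2 where u: "unimodular n P" "unimodular n Q" "unimodular n P2" "unimodular n Q2"
    and e: "A = P * B * Q" "B = P2 * C * Q2" and C: "C \<in> carrier_mat n n"
    using assms unfolding mat_equivalent_def by blast
  have c: "P \<in> carrier_mat n n" "Q \<in> carrier_mat n n" "P2 \<in> carrier_mat n n" "Q2 \<in> carrier_mat n n"
    using u unfolding unimodular_def by auto
  have "A = (P * P2) * C * (Q2 * Q)" unfolding e
    using c C by (simp add: assoc_mult_mat[of _ n n _ n _ n] mult_carrier_mat[of _ n n _ n])
  then show ?thesis unfolding mat_equivalent_def using unimodular_mult u C by blast
qed

lemma mat_equivalent_sym: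
  assumes "mat_equivalent n A B"
  shows "mat_equivalent n B A"
proof -
  obtain P P' Q Q' where c: "P \<in> carrier_mat n n" "Q \<in> carrier_mat n n" "P' \<in> carrier_mat n n" "Q' \<in> carrier_mat n n"
    and B: "B \<in> carrier_mat n n"
    and i: "P * P' = 1\<^sub>m n" "P' * P = 1\<^sub>m n" "Q * Q' = 1\<^sub>m n" "Q' * Q = 1\<^sub>m n" and A: "A = P * B * Q"
    using assms unfolding mat_equivalent_def unimodular_def by blast
  have "P' * A * Q' = (P' * P) * B * (Q * Q')" unfolding A
    using c B by (simp add: assoc_mult_mat[of _ n n _ n _ n] mult_carrier_mat[of _ n n _ n])
  also have "\<dots> = B" using i B by simp
  finally have "B = P' * A * Q'" by simp
  moreover have "A \<in> carrier_mat n n" unfolding A using c B by auto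
  ultimately show ?thesis unfolding mat_equivalent_def
    using unimodularI[OF c(3,1) i(2,1)] unimodularI[OF c(4,2) i(4,3)] by blast
qed

lemma mat_equivalent_mult_left:
  assumes "unimodular n P" "A \<in> carrier_mat n n"
  shows "mat_equivalent n A (P * A)"
proof -
  have "mat_equivalent n (P * A) A"
    unfolding mat_equivalent_def using assms unimodular_one
    by (intro conjI exI[of _ P] exI[of _ "1\<^sub>m n"]) (auto simp: unimodular_def)
  then show ?thesis by (rule mat_equivalent_sym)
qed

lemma mat_equivalent_mult_right:
  assumes "unimodular n Q" "A \<in> carrier_mat n n"
  shows "mat_equivalent n A (A * Q)"
proof -
  have "mat_equivalent n (A * Q) A"
    unfolding mat_equivalent_def using assms unimodular_one
    by (intro conjI exI[of _ Q] exI[of _ "1\<^sub>m n"]) (auto simp: unimodular_def)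
  then show ?thesis by (rule mat_equivalent_sym)
qed

lemma mat_equivalent_block_diag:
  assumes e: "mat_equivalent n A B" and a: "a \<in> carrier_mat 1 1"
  shows "mat_equivalent (Suc n) (four_block_mat a (0\<^sub>m 1 n) (0\<^sub>m n 1) A) (four_block_mat a (0\<^sub>m 1 n) (0\<^sub>m n 1) B)"
proof -
  obtain P Q where u: "unimodular n P" "unimodular n Q"
    and A: "A = P * B * Q" and B: "B \<in> carrier_mat n n"
    using e unfolding mat_equivalent_def by blast
  have c: "P \<in> carrier_mat n n" "Q \<in> carrier_mat n n" using u unfolding unimodular_def by auto
  let ?P = "four_block_mat (1\<^sub>m 1) (0\<^sub>m 1 n) (0\<^sub>m n 1) P"
  let ?Q = "four_block_mat (1\<^sub>m 1) (0\<^sub>m 1 n) (0\<^sub>m n 1) Q"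
  have 1: "?P * four_block_mat a (0\<^sub>m 1 n) (0\<^sub>m n 1) B = four_block_mat a (0\<^sub>m 1 n) (0\<^sub>m n 1) (P * B)"
    using c a B by (subst mult_four_block_mat[of _ 1 1 _ n _ n _ _ 1 _ n]) auto
  have "?P * four_block_mat a (0\<^sub>m 1 n) (0\<^sub>m n 1) B * ?Q = four_block_mat a (0\<^sub>m 1 n) (0\<^sub>m n 1) (P * B * Q)"
    unfolding 1 using c a B by (subst mult_four_block_mat[of _ 1 1 _ n _ n _ _ 1 _ n]) auto
  moreover have "four_block_mat a (0\<^sub>m 1 n) (0\<^sub>m n 1) B \<in> carrier_mat (Suc n) (Suc n)"
    using a B by (rule four_block_carrier_Suc)
  ultimately show ?thesis unfolding mat_equivalent_def A
    using unimodular_block_diag u by metis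
qed

lemma dvd_entries_mult:
  fixes A B :: "'a::comm_ring_1 mat"
  assumes A: "A \<in> carrier_mat m n" and B: "B \<in> carrier_mat n k"
    and d: "(\<forall>i<m. \<forall>j<n. d dvd A $$ (i, j)) \<or> (\<forall>i<n. \<forall>j<k. d dvd B $$ (i, j))"
    and ij: "i < m" "j < k"
  shows "d dvd (A * B) $$ (i, j)"
proof -
  have "(A * B) $$ (i, j) = (\<Sum>l = 0..<n. A $$ (i, l) * B $$ (l, j))"
    using A B ij by (simp add: scalar_prod_def)
  then show ?thesis using d ij by (auto intro!: dvd_sum)
qed

text \<open>Among all nonzero entries of all matrices equivalent to \<open>A\<close>, one of least
  degree serves as the pivot \<open>p\<close>. Minimality replaces the Euclidean reduction loop:
  every remainder modulo \<open>p\<close> that an elementary operation can produce must vanish, so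
  \<open>p\<close> clears its row and column and divides the rest.\<close>

theorem smith_normal_form:
  fixes A :: "'a::field poly mat"
  assumes "A \<in> carrier_mat n n"
  shows "\<exists>D. mat_equivalent n A D \<and> (\<forall>i<n. \<forall>j<n. i \<noteq> j \<longrightarrow> D $$ (i, j) = 0) \<and>
    (\<forall>i j. i \<le> j \<longrightarrow> j < n \<longrightarrow> D $$ (i, i) dvd D $$ (j, j))"
  using assms
proof (induction n arbitrary: A)
  case 0
  then show ?case using mat_equivalent_refl by auto
next
  case (Suc n)
  let ?N = "Suc n"
  show ?case
  proof (cases "A = 0\<^sub>m ?N ?N")
    case True
    then show ?thesis using mat_equivalent_refl[OF Suc.prems] by (intro exI[of _ A]) auto
  next
    case False
    then have "\<exists>i0<?N. \<exists>j0<?N. A $$ (i0, j0) \<noteq> 0" using Suc.prems by (metis carrier_matD eq_matI index_zero_mat)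
    then have ex: "\<exists>B i j. mat_equivalent ?N A B \<and> i < ?N \<and> j < ?N \<and> B $$ (i, j) \<noteq> 0"
      using mat_equivalent_refl[OF Suc.prems] by blast
    define R where "R d \<longleftrightarrow> (\<exists>B i j. mat_equivalent ?N A B \<and> i < ?N \<and> j < ?N \<and> B $$ (i, j) \<noteq> 0 \<and>
        Polynomial.degree (B $$ (i, j)) = d)" for d
    have "\<exists>d. R d" using ex unfolding R_def by blast
    then have "R (LEAST d. R d)" by (rule LeastI_ex)
    then obtain B0 i0 j0 where B0: "mat_equivalent ?N A B0" "i0 < ?N" "j0 < ?N" "B0 $$ (i0, j0) \<noteq> 0"
      and deg: "Polynomial.degree (B0 $$ (i0, j0)) = (LEAST d. R d)"
      unfolding R_def[of "LEAST d. R d"] by blast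
    have min: "Polynomial.degree (B0 $$ (i0, j0)) \<le> Polynomial.degree (C $$ (i, j))"
      if "mat_equivalent ?N A C" "i < ?N" "j < ?N" "C $$ (i, j) \<noteq> 0" for C i j
      unfolding deg using that by (intro Least_le) (auto simp: R_def)
    define p where "p = B0 $$ (i0, j0)"
    have p0: "p \<noteq> 0" using B0 p_def by simp
    have B0c: "B0 \<in> carrier_mat ?N ?N" using B0(1) unfolding mat_equivalent_def by auto
    define B where "B = swaprows_mat ?N 0 i0 * B0 * swaprows_mat ?N 0 j0"
    have "B = swapcols 0 j0 (swaprows 0 i0 B0)"
      unfolding B_def using B0c B0(2,3)
      by (subst swaprows_mat[of _ _ ?N, symmetric]; (subst swapcols_mat[of _ ?N ?N])?; auto)
    then have B00: "B $$ (0, 0) = p" unfolding p_def using B0c B0 by auto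
    have B: "mat_equivalent ?N A B" unfolding B_def
      using B0c B0(2,3)
      by (intro mat_equivalent_trans[OF B0(1)] mat_equivalent_trans[OF mat_equivalent_mult_left mat_equivalent_mult_right]
          unimodular_swaprows_mat) auto
    \<comment> \<open>One row operation reduces the entry modulo \<open>p\<close>; a nonzero
      remainder would have smaller degree than \<open>p\<close> in an equivalent matrix.\<close>
    have dc: "p dvd C $$ (i, 0)" if C: "mat_equivalent ?N A C" "C $$ (0, 0) = p" "i < ?N" for C i
    proof (cases "i = 0")
      case False
      have Cc: "C \<in> carrier_mat ?N ?N" using C(1) unfolding mat_equivalent_def by auto
      define E where "E = addrow (- (C $$ (i, 0) div p)) i 0 C"
      have "E = addrow_mat ?N (- (C $$ (i, 0) div p)) i 0 * C" unfolding E_def using Cc by (intro addrow_mat) auto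
      then have "mat_equivalent ?N A E"
        using mat_equivalent_trans[OF C(1) mat_equivalent_mult_left[OF unimodular_addrow_mat Cc]] False C(3) by auto
      moreover have "E $$ (i, 0) = C $$ (i, 0) mod p"
        unfolding E_def using Cc C by (auto simp: minus_div_mult_eq_mod[symmetric])
      ultimately have "C $$ (i, 0) mod p = 0"
        using min[of E i 0] C(3) degree_mod_less[OF p0, of "C $$ (i, 0)"] p_def by fastforce
      then show ?thesis by auto
    qed (use that in auto)
    \<comment> \<open>Proved for every equivalent matrix with \<open>p\<close> in the corner, since
      it is applied to \<open>B\<close> and again to \<open>H\<close> in \<open>pF\<close>.\<close>
    have dr: "p dvd C $$ (0, j)" if C: "mat_equivalent ?N A C" "C $$ (0, 0) = p" "j < ?N" for C j
    proof (cases "j = 0")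
      case False
      have Cc: "C \<in> carrier_mat ?N ?N" using C(1) unfolding mat_equivalent_def by auto
      define E where "E = addcol (- (C $$ (0, j) div p)) j 0 C"
      have "E = C * addrow_mat ?N (- (C $$ (0, j) div p)) 0 j" unfolding E_def using Cc by (intro addcol_mat) auto
      then have "mat_equivalent ?N A E"
        using mat_equivalent_trans[OF C(1) mat_equivalent_mult_right[OF unimodular_addrow_mat Cc]] False C(3) by auto
      moreover have "E $$ (0, j) = C $$ (0, j) mod p"
        unfolding E_def using Cc C by (auto simp: minus_div_mult_eq_mod[symmetric])
      ultimately have "C $$ (0, j) mod p = 0"
        using min[of E 0 j] C(3) degree_mod_less[OF p0, of "C $$ (0, j)"] p_def by fastforce
      then show ?thesis by auto
    qed (use that in auto)
    have Bc: "B \<in> carrier_mat ?N ?N" using B unfolding mat_equivalent_def by auto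
    obtain b r c E where sb: "split_block B 1 1 = (b, r, c, E)" by (metis prod_cases4)
    have blk: "b \<in> carrier_mat 1 1" "r \<in> carrier_mat 1 n" "c \<in> carrier_mat n 1" "E \<in> carrier_mat n n"
      and Beq: "B = four_block_mat b r c E"
      using split_block[OF sb, of n n] Bc by auto
    have b00: "b $$ (0, 0) = p" using B00 blk unfolding Beq by simp
    have "p dvd c $$ (i, 0)" if "i < n" for i
      using dc[OF B B00, of "Suc i"] that blk unfolding Beq by simp
    then have "\<forall>i. \<exists>u. i < n \<longrightarrow> c $$ (i, 0) = p * u" unfolding dvd_def by blast
    then obtain u where u: "\<And>i. i < n \<Longrightarrow> c $$ (i, 0) = p * u i" by metis
    have "p dvd r $$ (0, j)" if "j < n" for j
      using dr[OF B B00, of "Suc j"] that blk unfolding Beq by simp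
    then have "\<forall>j. \<exists>v. j < n \<longrightarrow> r $$ (0, j) = p * v" unfolding dvd_def by blast
    then obtain v where v: "\<And>j. j < n \<Longrightarrow> r $$ (0, j) = p * v j" by metis
    define U where "U = mat n 1 (\<lambda>(i, j). - u i)"
    define V where "V = mat 1 n (\<lambda>(i, j). - v j)"
    have UV: "U \<in> carrier_mat n 1" "V \<in> carrier_mat 1 n" unfolding U_def V_def by auto
    have Ub: "U * b + c = 0\<^sub>m n 1" using blk b00 u unfolding U_def
      by (intro eq_matI) (auto simp: scalar_prod_def)
    have bV: "b * V + r = 0\<^sub>m 1 n" using blk b00 v unfolding V_def
      by (intro eq_matI) (auto simp: scalar_prod_def)
    define F where "F = U * r + E"
    have Fc: "F \<in> carrier_mat n n" unfolding F_def using UV blk by auto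
    let ?L = "four_block_mat (1\<^sub>m 1) (0\<^sub>m 1 n) U (1\<^sub>m n)"
    let ?R = "four_block_mat (1\<^sub>m 1) V (0\<^sub>m n 1) (1\<^sub>m n)"
    let ?C = "four_block_mat b (0\<^sub>m 1 n) (0\<^sub>m n 1) F"
    have LB: "?L * B = four_block_mat b r (0\<^sub>m n 1) F"
      unfolding Beq F_def using blk UV Ub
      by (subst mult_four_block_mat[of _ 1 1 _ n _ n _ _ 1 _ n]) auto
    have LBR: "?L * B * ?R = ?C"
      unfolding LB using blk UV bV Fc
      by (subst mult_four_block_mat[of _ 1 1 _ n _ n _ _ 1 _ n]) auto
    have Cc: "?C \<in> carrier_mat ?N ?N" using four_block_carrier_Suc[OF blk(1) Fc] .
    have LBc: "?L * B \<in> carrier_mat ?N ?N"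
      unfolding LB using four_block_carrier_Suc[OF blk(1) Fc] .
    have AC: "mat_equivalent ?N A ?C" unfolding LBR[symmetric]
      using mat_equivalent_trans[OF B mat_equivalent_trans[OF mat_equivalent_mult_left[OF unimodular_lower[OF UV(1)] Bc]
            mat_equivalent_mult_right[OF unimodular_upper[OF UV(2)] LBc]]] .
    \<comment> \<open>Row \<open>Suc i\<close> of \<open>?C\<close> starts with \<open>0\<close>, so
      adding it to row \<open>0\<close> keeps the pivot and exposes row \<open>i\<close> of
      \<open>F\<close> to \<open>dr\<close>.\<close>
    have pF: "p dvd F $$ (i, j)" if ij: "i < n" "j < n" for i j
    proof -
      define H where "H = addrow 1 0 (Suc i) ?C"
      have "H = addrow_mat ?N 1 0 (Suc i) * ?C" unfolding H_def using Cc ij by (intro addrow_mat) auto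
      then have "mat_equivalent ?N A H"
        using mat_equivalent_trans[OF AC mat_equivalent_mult_left[OF unimodular_addrow_mat Cc]] ij by auto
      moreover have "H $$ (0, 0) = p" "H $$ (0, Suc j) = F $$ (i, j)"
        unfolding H_def using blk Fc ij b00 by auto
      ultimately show ?thesis using dr[of H "Suc j"] ij by auto
    qed
    obtain D where D: "mat_equivalent n F D" "\<forall>i<n. \<forall>j<n. i \<noteq> j \<longrightarrow> D $$ (i, j) = 0"
      "\<forall>i j. i \<le> j \<longrightarrow> j < n \<longrightarrow> D $$ (i, i) dvd D $$ (j, j)"
      using Suc.IH[OF Fc] by (elim exE conjE) (rule that; assumption)
    have Dc: "D \<in> carrier_mat n n" using D(1) unfolding mat_equivalent_def by auto
    have pD: "p dvd D $$ (i, j)" if "i < n" "j < n" for i j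
    proof -
      obtain P Q where "D = P * F * Q" "P \<in> carrier_mat n n" "Q \<in> carrier_mat n n"
        using mat_equivalent_sym[OF D(1)] unfolding mat_equivalent_def unimodular_def by blast
      moreover have "p dvd (P * F) $$ (i, j)" if "i < n" "j < n" for i j
        using dvd_entries_mult[OF \<open>P \<in> _\<close> Fc, of p] pF that by blast
      ultimately show ?thesis
        using dvd_entries_mult[of "P * F" n n Q n p] Fc that by auto
    qed
    let ?D = "four_block_mat b (0\<^sub>m 1 n) (0\<^sub>m n 1) D"
    have f1: "mat_equivalent ?N A ?D"
      using mat_equivalent_trans[OF AC mat_equivalent_block_diag[OF D(1) blk(1)]] .
    have f2: "?D $$ (i, j) = 0" if "i < ?N" "j < ?N" "i \<noteq> j" for i j
      using that blk Dc D(2) by auto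
    have f3: "?D $$ (i, i) dvd ?D $$ (j, j)" if "i \<le> j" "j < ?N" for i j
      using that blk Dc D(3) pD b00 by auto
    show ?thesis by (intro exI[of _ ?D] conjI allI impI f1 f2 f3; assumption)
  qed
qed

section \<open>Low rank perturbations of a characteristic matrix\<close>

abbreviation const_mat :: "'a::comm_ring_1 mat \<Rightarrow> 'a poly mat" where
  "const_mat \<equiv> map_mat (\<lambda>c. [:c:])"

interpretation const_poly_hom: comm_ring_hom "\<lambda>c. [:c:]"
  by unfold_locales (auto simp: one_pCons)

lemma const_mat_mult:
  "A \<in> carrier_mat m n \<Longrightarrow> B \<in> carrier_mat n k \<Longrightarrow> const_mat (A * B) = const_mat A * const_mat B"
  by (rule const_poly_hom.mat_hom_mult)

text \<open>The matrix determinant lemma without inverses. The block matrix \<open>?B\<close> has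
  determinant \<open>det (C + x * z)\<close>; multiplying it by \<open>?E3\<close>, of determinant
  \<open>det C\<close>, clears its lower left block. The factor \<open>det C\<close> then cancels by
  \<open>nz\<close>.\<close>

lemma det_add_col_row:
  fixes C :: "'a::idom mat"
  assumes C: "C \<in> carrier_mat n n" and x: "x \<in> carrier_mat n 1" and z: "z \<in> carrier_mat 1 n"
    and nz: "det C \<noteq> 0"
  shows "det (C + x * z) = det C + (z * (adj_mat C * x)) $$ (0, 0)"
proof -
  let ?d = "det C"
  note adj = adj_mat[OF C]
  let ?B = "four_block_mat C x (- z) (1\<^sub>m 1)"
  let ?E1 = "four_block_mat (C + x * z) x (0\<^sub>m 1 n) (1\<^sub>m 1)"
  let ?E2 = "four_block_mat (1\<^sub>m n) (0\<^sub>m n 1) (- z) (1\<^sub>m 1)"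
  let ?E3 = "four_block_mat (1\<^sub>m n) (0\<^sub>m n 1) (z * adj_mat C) (?d \<cdot>\<^sub>m 1\<^sub>m 1)"
  let ?s = "z * adj_mat C * x + ?d \<cdot>\<^sub>m 1\<^sub>m 1"
  have xz: "x * z \<in> carrier_mat n n" using x z by auto
  have za: "z * adj_mat C \<in> carrier_mat 1 n" using z adj by auto
  have "x * (- z) = - (x * z)" using x z by auto
  moreover have "C + x * z + - (x * z) = C"
    using C xz by (intro eq_matI) (auto simp del: assoc_add_mat index_mult_mat)
  ultimately have 1: "?E1 * ?E2 = ?B"
    using C x z xz by (subst mult_four_block_mat[of _ n n _ 1 _ 1 _ _ n _ 1]) auto
  have "det ?B = det (C + x * z)"
    unfolding 1[symmetric] using C x z xz
    by (subst det_mult[of _ "n + 1"])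
      (auto simp: det_four_block_mat_lower_left_zero[of _ n _ 1] det_four_block_mat_upper_right_zero[of _ n _ 1])
  moreover have "z * adj_mat C * C = ?d \<cdot>\<^sub>m z"
    using z adj C by (simp add: assoc_mult_mat[of _ 1 n _ n _ n] mult_smult_distrib[of z 1 n "1\<^sub>m n" n])
  then have "z * adj_mat C * C + (?d \<cdot>\<^sub>m 1\<^sub>m 1) * (- z) = 0\<^sub>m 1 n"
    using z by (intro eq_matI) auto
  then have 3: "?E3 * ?B = four_block_mat C x (0\<^sub>m 1 n) ?s"
    using C x z za by (subst mult_four_block_mat[of _ n n _ 1 _ 1 _ _ n _ 1]) auto
  have "det (?E3 * ?B) = ?d * det ?B"
    using C x z za
    by (subst det_mult[of _ "n + 1"]) (auto simp: det_four_block_mat_upper_right_zero[of _ n _ 1])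
  moreover have "det (?E3 * ?B) = ?d * det ?s"
    unfolding 3 using C x z za by (subst det_four_block_mat_lower_left_zero[of _ n _ 1]) auto
  moreover have "det ?s = ?s $$ (0, 0)"
    using za x by (intro det_single) auto
  moreover have "?s $$ (0, 0) = (z * (adj_mat C * x)) $$ (0, 0) + ?d"
    using z adj x za by (subst assoc_mult_mat[of _ 1 n _ n _ 1]) auto
  ultimately show ?thesis using nz by simp
qed

lemma char_poly_matrix_add:
  assumes "T \<in> carrier_mat n n" "K \<in> carrier_mat n n"
  shows "char_poly_matrix (T + K) = char_poly_matrix T + - const_mat K"
  using assms unfolding char_poly_matrix_def by (intro eq_matI) auto

lemma char_poly_matrix_mult:
  assumes T: "T \<in> carrier_mat n n" and y: "y \<in> carrier_mat n m"
  shows "char_poly_matrix T * y = [:0, 1:] \<cdot>\<^sub>m y + - (const_mat T * y)"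
proof -
  have "char_poly_matrix T = [:0, 1:] \<cdot>\<^sub>m 1\<^sub>m n + - const_mat T"
    using T unfolding char_poly_matrix_def by (intro eq_matI) auto
  then show ?thesis using T y by (simp add: add_mult_distrib_mat[of _ n n] mult_smult_assoc_mat[of "1\<^sub>m n" n n y m])
qed

text \<open>For \<open>M = X - T\<close> and \<open>y = adj(M) x\<close>, the relation \<open>X y = det(M) x + T y\<close> makes the polynomials
  \<open>f y + k det(M)\<close>, with \<open>f\<close> constant, an ideal; \<open>g\<close> is its generator and \<open>w = y / g\<close>.\<close>

lemma cyclic_generator:
  fixes T :: "'a::field mat"
  assumes T: "T \<in> carrier_mat n n" and x: "x \<in> carrier_mat n 1" and x0: "x \<noteq> 0\<^sub>m n 1"
  obtains g c w where "g \<noteq> 0" and "Polynomial.degree g < n" and "det (char_poly_matrix T) = g * c"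
    and "w \<in> carrier_mat n 1" and "adj_mat (char_poly_matrix T) * const_mat x = g \<cdot>\<^sub>m w"
    and "char_poly_matrix T * w = c \<cdot>\<^sub>m const_mat x"
    and "\<And>h. Polynomial.degree (h * g) < n \<Longrightarrow> \<exists>f\<in>carrier_mat 1 n. (const_mat f * w) $$ (0, 0) = h"
proof -
  let ?M = "char_poly_matrix T"
  let ?X = "[:0, 1:] :: 'a poly"
  define \<chi> where "\<chi> = det ?M"
  define y where "y = adj_mat ?M * const_mat x"
  have Mc: "?M \<in> carrier_mat n n" using T by simp
  have deg\<chi>: "Polynomial.degree \<chi> = n" "\<chi> \<noteq> 0"
    using degree_monic_char_poly[OF T] unfolding \<chi>_def char_poly_def by auto
  note adj = adj_mat[OF Mc]
  have cx: "const_mat x \<in> carrier_mat n 1" using x by auto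
  have y: "y \<in> carrier_mat n 1" unfolding y_def using adj cx by auto
  have n0: "0 < n"
  proof (rule ccontr)
    assume "\<not> 0 < n"
    then have "x = 0\<^sub>m n 1" using x by (intro eq_matI) auto
    then show False using x0 by simp
  qed
  have My: "?M * y = \<chi> \<cdot>\<^sub>m const_mat x"
  proof -
    have "?M * y = (?M * adj_mat ?M) * const_mat x"
      unfolding y_def using Mc adj(1) cx by (rule assoc_mult_mat[symmetric])
    then show ?thesis unfolding adj(2) \<chi>_def
      using cx by (simp add: mult_smult_assoc_mat[of "1\<^sub>m n" n n _ 1])
  qed
  \<comment> \<open>Adjugate entries are, up to sign, minors of order \<open>n - 1\<close> of a
    matrix with entries of degree at most \<open>1\<close>.\<close>
  have degy: "Polynomial.degree (y $$ (i, 0)) < n" if i: "i < n" for i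
  proof -
    have "Polynomial.degree (cofactor ?M j i) \<le> n - 1" if j: "j < n" for j
    proof -
      have "Polynomial.degree (?M $$ (a, b)) \<le> 1" if "a < n" "b < n" for a b
        using that T unfolding char_poly_matrix_def by auto
      then have "Polynomial.degree (det (mat_delete ?M j i)) \<le> 1 * (n - 1)"
        using Mc by (intro degree_det_le mat_delete_carrier[OF Mc]) (auto simp: mat_delete_def)
      moreover have "Polynomial.degree ((- 1) ^ (j + i) * p) = Polynomial.degree p" for p :: "'a poly"
        by (cases "even (j + i)") auto
      ultimately show ?thesis unfolding cofactor_def by simp
    qed
    then have d: "Polynomial.degree (cofactor ?M j i * [:x $$ (j, 0):]) < n" if "j < n" for j
      using that n0 degree_mult_le[of "cofactor ?M j i" "[:x $$ (j, 0):]"] by fastforce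
    have eq: "y $$ (i, 0) = (\<Sum>j\<in>{0..<n}. cofactor ?M j i * [:x $$ (j, 0):])"
      unfolding y_def adj_mat_def using Mc x i by (simp add: scalar_prod_def)
    show ?thesis unfolding eq by (intro degree_sum_less d n0) simp
  qed
  define \<phi> where "\<phi> f = (const_mat f * y) $$ (0, 0)" for f :: "'a mat"
  have \<phi>: "\<phi> f = (\<Sum>i\<in>{0..<n}. [:f $$ (0, i):] * y $$ (i, 0))" if "f \<in> carrier_mat 1 n" for f
    unfolding \<phi>_def using that y by (simp add: scalar_prod_def)
  have deg\<phi>: "Polynomial.degree (\<phi> f) < n" if "f \<in> carrier_mat 1 n" for f
    unfolding \<phi>[OF that] using degy n0
    by (intro degree_sum_less) (auto intro: le_less_trans[OF degree_smult_le])
  have \<phi>_add: "\<phi> (f + f') = \<phi> f + \<phi> f'" if f: "f \<in> carrier_mat 1 n" "f' \<in> carrier_mat 1 n" for f f'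
  proof -
    have "\<phi> (f + f') = (\<Sum>i\<in>{0..<n}. ([:f $$ (0, i):] + [:f' $$ (0, i):]) * y $$ (i, 0))"
      using f \<phi>[of "f + f'"] by simp
    then show ?thesis by (simp only: distrib_right sum.distrib \<phi>[OF f(1)] \<phi>[OF f(2)])
  qed
  have \<phi>_smult: "\<phi> (a \<cdot>\<^sub>m f) = [:a:] * \<phi> f" if f: "f \<in> carrier_mat 1 n" for f a
  proof -
    have "\<phi> (a \<cdot>\<^sub>m f) = (\<Sum>i\<in>{0..<n}. [:a:] * ([:f $$ (0, i):] * y $$ (i, 0)))"
      using f \<phi>[of "a \<cdot>\<^sub>m f"] by (simp add: mult.commute)
    then show ?thesis by (simp only: sum_distrib_left \<phi>[OF f])
  qed
  define J where "J = {\<phi> f + k * \<chi> | f k. f \<in> carrier_mat 1 n}"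
  have JI: "\<phi> f + k * \<chi> \<in> J" if "f \<in> carrier_mat 1 n" for f k using that unfolding J_def by auto
  have add: "p + q \<in> J" if pq: "p \<in> J" "q \<in> J" for p q
  proof -
    obtain f k f' k' where f: "f \<in> carrier_mat 1 n" "f' \<in> carrier_mat 1 n"
      and p: "p = \<phi> f + k * \<chi>" and q: "q = \<phi> f' + k' * \<chi>"
      using pq unfolding J_def by auto
    have "p + q = \<phi> (f + f') + (k + k') * \<chi>"
      unfolding p q \<phi>_add[OF f] by (simp only: algebra_simps)
    then show ?thesis using JI[of "f + f'" "k + k'"] f by auto
  qed
  have cmult: "[:a:] * p \<in> J" if p: "p \<in> J" for p a
  proof -
    obtain f k where f: "f \<in> carrier_mat 1 n" and p: "p = \<phi> f + k * \<chi>"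
      using p unfolding J_def by auto
    have "[:a:] * p = \<phi> (a \<cdot>\<^sub>m f) + ([:a:] * k) * \<chi>"
      unfolding p \<phi>_smult[OF f] by (simp only: algebra_simps)
    then show ?thesis using JI[of "a \<cdot>\<^sub>m f" "[:a:] * k"] f by auto
  qed
  have Xy: "?X \<cdot>\<^sub>m y = \<chi> \<cdot>\<^sub>m const_mat x + const_mat T * y"
  proof -
    define t where "t = const_mat T * y"
    have t: "t \<in> carrier_mat n 1" unfolding t_def using T y by auto
    have "?X \<cdot>\<^sub>m y + - t = \<chi> \<cdot>\<^sub>m const_mat x"
      unfolding t_def using char_poly_matrix_mult[OF T y] My by simp
    then have e: "(?X \<cdot>\<^sub>m y + - t) $$ (i, 0) = (\<chi> \<cdot>\<^sub>m const_mat x) $$ (i, 0)" for i by simp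
    have e2: "?X * y $$ (i, 0) + - (t $$ (i, 0)) = \<chi> * [:x $$ (i, 0):]" if "i < n" for i
      using e[of i] that y t x by simp
    then have "?X * y $$ (i, 0) = \<chi> * [:x $$ (i, 0):] + t $$ (i, 0)" if "i < n" for i
      using e2[OF that] by (simp only: add_uminus_conv_diff diff_eq_eq)
    then show ?thesis unfolding t_def[symmetric] using y t x by (intro eq_matI) auto
  qed
  have Xmult: "?X * p \<in> J" if p: "p \<in> J" for p
  proof -
    obtain f k where f: "f \<in> carrier_mat 1 n" and p: "p = \<phi> f + k * \<chi>"
      using p unfolding J_def by auto
    have cf: "const_mat f \<in> carrier_mat 1 n" and cT: "const_mat T \<in> carrier_mat n n" using f T by auto
    have "?X * \<phi> f = (?X \<cdot>\<^sub>m (const_mat f * y)) $$ (0, 0)"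
      unfolding \<phi>_def using cf y by simp
    also have "?X \<cdot>\<^sub>m (const_mat f * y) = const_mat f * (?X \<cdot>\<^sub>m y)"
      by (rule mult_smult_distrib[symmetric, OF cf y])
    also have "\<dots> = const_mat f * (\<chi> \<cdot>\<^sub>m const_mat x) + const_mat f * (const_mat T * y)"
      unfolding Xy using cf cx cT y by (intro mult_add_distrib_mat[of _ 1 n _ 1]) auto
    also have "const_mat f * (const_mat T * y) = const_mat (f * T) * y"
      using f T cf cT y by (simp add: const_mat_mult[of _ 1 n] assoc_mult_mat[of _ 1 n _ n _ 1])
    also have "const_mat f * (\<chi> \<cdot>\<^sub>m const_mat x) = \<chi> \<cdot>\<^sub>m (const_mat f * const_mat x)"
      by (rule mult_smult_distrib[OF cf cx])
    also have "(\<chi> \<cdot>\<^sub>m (const_mat f * const_mat x) + const_mat (f * T) * y) $$ (0, 0) =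
        \<phi> (f * T) + (const_mat f * const_mat x) $$ (0, 0) * \<chi>"
      unfolding \<phi>_def using cf cx f T y by (simp del: index_mult_mat(1))
    finally have "?X * p = \<phi> (f * T) + ((const_mat f * const_mat x) $$ (0, 0) + ?X * k) * \<chi>"
      unfolding p by (simp only: algebra_simps)
    then show ?thesis using JI[of "f * T"] f T by auto
  qed
  have mult: "q * p \<in> J" if p: "p \<in> J" for p q
  proof (induction q)
    case 0
    show ?case using cmult[OF p, of 0] by simp
  next
    case (pCons a q)
    have "pCons a q * p = [:a:] * p + ?X * (q * p)"
      by (simp add: algebra_simps)
    then show ?case using add[OF cmult[OF p] Xmult[OF pCons(2)]] by simp
  qed
  have \<chi>J: "\<chi> \<in> J"
    using JI[of "0\<^sub>m 1 n" 1] \<phi>[of "0\<^sub>m 1 n"] by simp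
  obtain g where g: "g \<in> J" "g \<noteq> 0" "\<And>p. p \<in> J \<Longrightarrow> g dvd p"
    by (rule poly_ideal_principal[OF add mult \<chi>J deg\<chi>(2)]; (assumption | (rule that; assumption)))
  \<comment> \<open>\<open>e\<close> is the \<open>i\<close>-th unit row, so this entry of
    \<open>y\<close> itself lies in the ideal \<open>J\<close>.\<close>
  have gy: "g dvd y $$ (i, 0)" if i: "i < n" for i
  proof -
    define e where "e = mat 1 n (\<lambda>(a, b). if b = i then 1 else (0::'a))"
    have "\<phi> e = (\<Sum>j\<in>{0..<n}. [:e $$ (0, j):] * y $$ (j, 0))"
      by (rule \<phi>) (simp add: e_def)
    also have "\<dots> = (\<Sum>j\<in>{0..<n}. if j = i then y $$ (j, 0) else 0)"
      by (rule sum.cong) (auto simp: e_def)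
    also have "\<dots> = y $$ (i, 0)" using i by simp
    finally show ?thesis using g(3)[OF JI[of e 0]] unfolding e_def by simp
  qed
  obtain c where c: "\<chi> = g * c" using g(3)[OF \<chi>J] by (rule dvdE)
  define w where "w = map_mat (\<lambda>p. p div g) y"
  have w: "w \<in> carrier_mat n 1" unfolding w_def using y by simp
  have yw: "y = g \<cdot>\<^sub>m w" unfolding w_def using y gy by (intro eq_matI) auto
  have Mw: "?M * w = c \<cdot>\<^sub>m const_mat x"
  proof -
    define t where "t = ?M * w"
    have t: "t \<in> carrier_mat n 1" unfolding t_def using Mc w by auto
    have "g \<cdot>\<^sub>m t = ?M * y" unfolding yw t_def by (rule mult_smult_distrib[symmetric, OF Mc w])
    then have e: "(g \<cdot>\<^sub>m t) $$ (i, 0) = ((g * c) \<cdot>\<^sub>m const_mat x) $$ (i, 0)" for i unfolding My c by simp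
    have "g * t $$ (i, 0) = g * (c * [:x $$ (i, 0):])" if "i < n" for i
      using e[of i] that t x by simp
    then have "t $$ (i, 0) = c * [:x $$ (i, 0):]" if "i < n" for i
      using that g(2) mult_left_cancel by blast
    then show ?thesis unfolding t_def[symmetric] using t x by (intro eq_matI) auto
  qed
  have ex: "\<exists>f\<in>carrier_mat 1 n. (const_mat f * w) $$ (0, 0) = h" if h: "Polynomial.degree (h * g) < n" for h
  proof -
    obtain f k where f: "f \<in> carrier_mat 1 n" and hg: "h * g = \<phi> f + k * \<chi>"
      using mult[OF g(1), of h] unfolding J_def by auto
    \<comment> \<open>Both \<open>h * g\<close> and \<open>\<phi> f\<close> have degree below
      \<open>n\<close>, the degree of \<chi>. So \<open>k = 0\<close>, and \<open>h * g\<close> is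
      attained by the constant row \<open>f\<close> alone.\<close>
    have "Polynomial.degree (k * \<chi>) < n"
      using degree_diff_less[OF h deg\<phi>[OF f]] hg by simp
    then have "k = 0" using deg\<chi> by (cases "k = 0") (auto simp: degree_mult_eq)
    then have "h * g = (const_mat f * (g \<cdot>\<^sub>m w)) $$ (0, 0)" using hg unfolding \<phi>_def yw by simp
    also have "const_mat f * (g \<cdot>\<^sub>m w) = g \<cdot>\<^sub>m (const_mat f * w)"
      using f w by (intro mult_smult_distrib[of _ 1 n]) auto
    finally have "h * g = g * (const_mat f * w) $$ (0, 0)" using f w by (simp del: index_mult_mat(1))
    then show ?thesis using f g(2) by (auto intro!: bexI[of _ f])
  qed
  \<comment> \<open>Otherwise \<open>g\<close> could divide the entries of \<open>y\<close> only if
    \<open>w = 0\<close>, which gives \<open>c x = 0\<close> and hence \<open>x = 0\<close>. The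
    bound makes \<open>h = 1\<close> admissible in \<open>ex\<close>: some constant row
    \<open>f\<close> has \<open>f w = 1\<close>.\<close>
  have "Polynomial.degree g < n"
  proof (rule ccontr)
    assume ng: "\<not> Polynomial.degree g < n"
    have "w $$ (i, 0) = 0" if i: "i < n" for i
    proof (rule ccontr)
      assume "w $$ (i, 0) \<noteq> 0"
      then have "Polynomial.degree (g * w $$ (i, 0)) \<ge> n" using ng g(2) by (simp add: degree_mult_eq)
      then show False using degy[OF i] w i unfolding yw by simp
    qed
    then have "w = 0\<^sub>m n 1" using w by (intro eq_matI) auto
    then have "0\<^sub>m n 1 = c \<cdot>\<^sub>m const_mat x" using Mw Mc by simp
    then have e: "(0\<^sub>m n 1 :: 'a poly mat) $$ (i, 0) = (c \<cdot>\<^sub>m const_mat x) $$ (i, 0)" for i by simp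
    have "x $$ (i, 0) = 0" if "i < n" for i using e[of i] that x c deg\<chi>(2) by simp
    then have "x = 0\<^sub>m n 1" using x by (intro eq_matI) auto
    then show False using x0 by simp
  qed
  then show thesis
    by (rule that[OF g(2) _ c[unfolded \<chi>_def] w yw[unfolded y_def] Mw]) (rule ex)
qed

section \<open>Spans of the columns of a characteristic matrix and one vector\<close>

lemma mat_add_cancel_right:
  fixes A B :: "'a::ab_group_add mat"
  assumes "A \<in> carrier_mat m n" "B \<in> carrier_mat m n"
  shows "A + B + - B = A" "A + - B + B = A"
  using assms by (auto intro!: eq_matI simp del: assoc_add_mat)

text \<open>Membership of all \<open>m\<close> columns of \<open>b\<close> in a polynomial module,
  in block form: \<open>m = 1\<close> serves the vectors \<open>u i\<close>, and
  \<open>m = n\<close> the matrix \<open>B\<close> whose determinant has to divide the assigned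
  polynomial.\<close>

definition in_col_span :: "nat \<Rightarrow> 'a::comm_ring_1 mat \<Rightarrow> 'a mat \<Rightarrow> nat \<Rightarrow> 'a mat \<Rightarrow> bool" where
  "in_col_span n M x m b \<longleftrightarrow> (\<exists>Y\<in>carrier_mat n m. \<exists>z\<in>carrier_mat 1 m. b = M * Y + x * z)"

lemma in_col_spanI:
  "Y \<in> carrier_mat n m \<Longrightarrow> z \<in> carrier_mat 1 m \<Longrightarrow> b = M * Y + x * z \<Longrightarrow> in_col_span n M x m b"
  unfolding in_col_span_def by blast

lemma in_col_span_mult:
  assumes "M \<in> carrier_mat n n" "x \<in> carrier_mat n 1" "Y \<in> carrier_mat n m"
  shows "in_col_span n M x m (M * Y)"
  by (rule in_col_spanI[of Y _ _ "0\<^sub>m 1 m"]) (use assms in auto)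

lemma in_col_span_generator:
  assumes "M \<in> carrier_mat n n" "x \<in> carrier_mat n 1"
  shows "in_col_span n M x 1 x"
  by (rule in_col_spanI[of "0\<^sub>m n 1" _ _ "1\<^sub>m 1"]) (use assms in auto)

lemma in_col_span_add:
  assumes M: "M \<in> carrier_mat n n" and x: "x \<in> carrier_mat n 1"
    and "in_col_span n M x m a" "in_col_span n M x m b"
  shows "in_col_span n M x m (a + b)"
proof -
  obtain Y z Y' z' where Y: "Y \<in> carrier_mat n m" "Y' \<in> carrier_mat n m"
    and z: "z \<in> carrier_mat 1 m" "z' \<in> carrier_mat 1 m"
    and ab: "a = M * Y + x * z" "b = M * Y' + x * z'"
    using assms(3,4) unfolding in_col_span_def by auto
  have c: "M * Y \<in> carrier_mat n m" "M * Y' \<in> carrier_mat n m" "x * z \<in> carrier_mat n m" "x * z' \<in> carrier_mat n m"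
    using M x Y z by auto
  have e: "M * (Y + Y') = M * Y + M * Y'" "x * (z + z') = x * z + x * z'"
    using M x Y z by (auto intro: mult_add_distrib_mat)
  have "a + b = M * (Y + Y') + x * (z + z')"
    unfolding ab e using c by (intro eq_matI) (auto simp del: index_mult_mat(1))
  then show ?thesis using Y z by (intro in_col_spanI[of "Y + Y'" _ _ "z + z'"]) auto
qed

lemma in_col_span_columns:
  assumes M: "M \<in> carrier_mat n n" and x: "x \<in> carrier_mat n 1" and b: "b \<in> carrier_mat n m"
    and cols: "\<And>j. j < m \<Longrightarrow> in_col_span n M x 1 (mat n 1 (\<lambda>(i, _). b $$ (i, j)))"
  shows "in_col_span n M x m b"
proof -
  have "\<forall>j. \<exists>Y z. j < m \<longrightarrow> Y \<in> carrier_mat n 1 \<and> z \<in> carrier_mat 1 1 \<and>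
      mat n 1 (\<lambda>(i, _). b $$ (i, j)) = M * Y + x * z"
    using cols unfolding in_col_span_def by blast
  then obtain Y z where Yz: "\<And>j. j < m \<Longrightarrow> Y j \<in> carrier_mat n 1 \<and> z j \<in> carrier_mat 1 1 \<and>
      mat n 1 (\<lambda>(i, _). b $$ (i, j)) = M * Y j + x * z j"
    by metis
  define Y' where "Y' = mat n m (\<lambda>(i, j). Y j $$ (i, 0))"
  define z' where "z' = mat 1 m (\<lambda>(i, j). z j $$ (0, 0))"
  have "b $$ (i, j) = (M * Y' + x * z') $$ (i, j)" if ij: "i < n" "j < m" for i j
  proof -
    have "b $$ (i, j) = (M * Y j + x * z j) $$ (i, 0)"
      using Yz[OF ij(2)] ij by (metis case_prod_conv index_mat(1) less_one)
    also have "\<dots> = (M * Y' + x * z') $$ (i, j)"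
      using conjunct1[OF Yz[OF ij(2)]] conjunct1[OF conjunct2[OF Yz[OF ij(2)]]] ij M x unfolding Y'_def z'_def by (simp add: scalar_prod_def)
    finally show ?thesis .
  qed
  then have "b = M * Y' + x * z'"
    using b M x unfolding Y'_def z'_def by (intro eq_matI) auto
  then show ?thesis by (intro in_col_spanI[of Y' _ _ z']) (auto simp: Y'_def z'_def)
qed

text \<open>If \<open>M w = c x\<close> and \<open>f w = 1\<close>, then \<open>M - (c - 1) x f\<close> maps \<open>w\<close> to \<open>x\<close> and has determinant \<open>g\<close>, so its
  columns form a basis of the module spanned by \<open>x\<close> and the columns of \<open>M\<close>.\<close>

lemma char_poly_assignment:
  fixes T :: "'a::field mat"
  assumes T: "T \<in> carrier_mat n n" and x: "x \<in> carrier_mat n 1" and x0: "x \<noteq> 0\<^sub>m n 1"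
    and B: "in_col_span n (char_poly_matrix T) (const_mat x) n B"
    and p: "Polynomial.degree p = n" "Polynomial.lead_coeff p = 1" and Bp: "det B dvd p"
  shows "\<exists>v\<in>carrier_mat 1 n. det (char_poly_matrix (T + x * v)) = p"
proof -
  let ?M = "char_poly_matrix T" and ?x = "const_mat x"
  obtain g c w where g: "g \<noteq> 0" "Polynomial.degree g < n" and gc: "det ?M = g * c"
    and w: "w \<in> carrier_mat n 1" and adj: "adj_mat ?M * ?x = g \<cdot>\<^sub>m w" and Mw: "?M * w = c \<cdot>\<^sub>m ?x"
    and ex: "\<And>h. Polynomial.degree (h * g) < n \<Longrightarrow> \<exists>f\<in>carrier_mat 1 n. (const_mat f * w) $$ (0, 0) = h"
    by (rule cyclic_generator[OF T x x0]) (rule that; assumption)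
  have Mc: "?M \<in> carrier_mat n n" and xc: "?x \<in> carrier_mat n 1" using T x by auto
  have monic: "Polynomial.degree (det ?M) = n" "Polynomial.lead_coeff (det ?M) = 1" "det ?M \<noteq> 0"
    using degree_monic_char_poly[OF T] unfolding char_poly_def by auto
  have det_add: "det (?M + ?x * z) = det ?M + (z * w) $$ (0, 0) * g" if z: "z \<in> carrier_mat 1 n" for z
  proof -
    have "z * (adj_mat ?M * ?x) = g \<cdot>\<^sub>m (z * w)" unfolding adj by (rule mult_smult_distrib[OF z w])
    then show ?thesis using det_add_col_row[OF Mc xc z monic(3)] z w by (simp del: index_mult_mat(1) add: mult.commute)
  qed
  obtain f where f: "f \<in> carrier_mat 1 n" and fw: "(const_mat f * w) $$ (0, 0) = 1"
    using ex[of 1] g by auto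
  define F where "F = const_mat f"
  have Fc: "F \<in> carrier_mat 1 n" unfolding F_def using f by simp
  have Fw: "F * w = 1\<^sub>m 1" using fw Fc w unfolding F_def by (intro eq_matI) auto
  define z where "z = (1 - c) \<cdot>\<^sub>m F"
  have z: "z \<in> carrier_mat 1 n" unfolding z_def using Fc by simp
  have zw: "z * w = (1 - c) \<cdot>\<^sub>m 1\<^sub>m 1" unfolding z_def Fw[symmetric] by (rule mult_smult_assoc_mat[OF Fc w])
  define G where "G = ?M + ?x * z"
  have xz: "?x * z \<in> carrier_mat n n" using xc z by auto
  have Gc: "G \<in> carrier_mat n n" unfolding G_def using Mc xz by auto
  have detG: "det G = g"
    unfolding G_def det_add[OF z] zw gc by (simp add: algebra_simps)
  have Gw: "G * w = ?x"
  proof -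
    have "G * w = c \<cdot>\<^sub>m ?x + ?x * (z * w)"
      unfolding G_def using Mc xz w xc z Mw by (simp add: add_mult_distrib_mat[of _ n n] assoc_mult_mat[of _ n 1 _ n _ 1])
    also have "?x * (z * w) = (1 - c) \<cdot>\<^sub>m ?x"
      unfolding zw using xc by (simp add: mult_smult_distrib[of _ n 1 _ 1])
    also have "c \<cdot>\<^sub>m ?x + (1 - c) \<cdot>\<^sub>m ?x = ?x"
    proof -
      have "c * q + (1 - c) * q = q" for q :: "'a poly" by (simp add: algebra_simps)
      then show ?thesis using xc by (intro eq_matI) (auto simp del: index_map_mat(1) mult_pCons_right)
    qed
    finally show ?thesis .
  qed
  \<comment> \<open>\<open>M\<close> is \<open>G\<close> times a polynomial matrix and
    \<open>x = G w\<close>, so the same holds for \<open>B\<close>, and \<open>det G = g\<close>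
    divides \<open>det B\<close> and hence \<open>p\<close>.\<close>
  have MG: "?M = G * (1\<^sub>m n + - (w * z))"
  proof -
    have "G * (w * z) = ?x * z" unfolding Gw[symmetric] using Gc w z by (simp add: assoc_mult_mat[of _ n n _ 1 _ n])
    then have "G * (- (w * z)) = - (?x * z)" using Gc w z by simp
    then have "G * (1\<^sub>m n + - (w * z)) = G + - (?x * z)"
      using Gc w z by (subst mult_add_distrib_mat[of _ n n _ n]) auto
    also have "\<dots> = ?M" unfolding G_def by (rule mat_add_cancel_right(1)[OF Mc xz])
    finally show ?thesis by simp
  qed
  obtain Y z' where Y: "Y \<in> carrier_mat n n" and z': "z' \<in> carrier_mat 1 n" and Beq: "B = ?M * Y + ?x * z'"
    using B unfolding in_col_span_def by auto
  define H where "H = 1\<^sub>m n + - (w * z)"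
  have Hc: "H \<in> carrier_mat n n" unfolding H_def using w z by auto
  have "B = G * H * Y + G * w * z'" unfolding Beq Gw MG[folded H_def, symmetric] ..
  also have "\<dots> = G * (H * Y + w * z')"
    using Gc Hc Y w z' by (simp add: assoc_mult_mat[of _ n n _ n _ n] assoc_mult_mat[of _ n n _ 1 _ n]
        mult_add_distrib_mat[of _ n n _ n])
  finally have "det B = det (G * (H * Y + w * z'))" by simp
  also have "\<dots> = g * det (H * Y + w * z')"
    using Gc Hc Y w z' detG by (subst det_mult[of _ n]) auto
  finally have "g dvd p" using Bp by (metis dvd_mult_left)
  then have "g dvd p - det ?M" unfolding gc by simp
  then obtain h where h: "p - det ?M = g * h" by (rule dvdE)
  \<comment> \<open>Both polynomials are monic of degree \<open>n\<close>. Once the top terms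
    cancel, \<open>ex\<close> realizes the quotient \<open>h\<close> by a constant row.\<close>
  have "Polynomial.degree (p - det ?M) < n"
  proof (cases "p = det ?M")
    case False
    have "Polynomial.degree (p - det ?M) \<le> n" using p monic by (intro degree_diff_le) auto
    moreover have "Polynomial.coeff (p - det ?M) n = 0" using p monic by simp
    ultimately show ?thesis
      using False by (metis le_neq_implies_less leading_coeff_0_iff right_minus_eq)
  qed (use g in auto)
  then obtain v where v: "v \<in> carrier_mat 1 n" "(const_mat v * w) $$ (0, 0) = h"
    using ex[of h] unfolding h by (auto simp: mult.commute)
  have mv: "- v \<in> carrier_mat 1 n" using v by simp
  have xv: "const_mat (x * v) = ?x * const_mat v" by (rule const_mat_mult[OF x v(1)])
  have "- const_mat (x * (- v)) = const_mat (x * v)" using x v(1) by (intro eq_matI) auto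
  then have "char_poly_matrix (T + x * (- v)) = ?M + ?x * const_mat v"
    unfolding xv[symmetric] using char_poly_matrix_add[OF T, of "x * (- v)"] x v by auto
  then have "det (char_poly_matrix (T + x * (- v))) = p"
    using det_add[of "const_mat v"] v h by (simp add: mult.commute algebra_simps)
  then show ?thesis using mv by blast
qed

text \<open>With \<open>M w = c x\<close> and \<open>f w = 1\<close> one has \<open>(M - u f) w = c x - u\<close>, so \<open>u\<close> enters the new span.\<close>

lemma enlarge_col_span:
  fixes T :: "'a::field mat"
  assumes T: "T \<in> carrier_mat n n" and x: "x \<in> carrier_mat n 1" and x0: "x \<noteq> 0\<^sub>m n 1"
    and u: "u \<in> carrier_mat n 1"
  obtains f where "f \<in> carrier_mat 1 n"
    and "in_col_span n (char_poly_matrix (T + u * f)) (const_mat x) 1 (const_mat u)"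
    and "\<And>m b. in_col_span n (char_poly_matrix T) (const_mat x) m b \<Longrightarrow>
      in_col_span n (char_poly_matrix (T + u * f)) (const_mat x) m b"
proof -
  let ?M = "char_poly_matrix T" and ?x = "const_mat x" and ?u = "const_mat u"
  obtain g c w where g: "g \<noteq> 0" "Polynomial.degree g < n"
    and w: "w \<in> carrier_mat n 1" and Mw: "?M * w = c \<cdot>\<^sub>m ?x"
    and ex: "\<And>h. Polynomial.degree (h * g) < n \<Longrightarrow> \<exists>f\<in>carrier_mat 1 n. (const_mat f * w) $$ (0, 0) = h"
    by (rule cyclic_generator[OF T x x0]) (rule that; assumption)
  obtain f where f: "f \<in> carrier_mat 1 n" and fw: "(const_mat f * w) $$ (0, 0) = 1"
    using ex[of 1] g by auto
  define F where "F = const_mat f"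
  have Mc: "?M \<in> carrier_mat n n" and xc: "?x \<in> carrier_mat n 1" and uc: "?u \<in> carrier_mat n 1"
    and Fc: "F \<in> carrier_mat 1 n" unfolding F_def using T x u f by auto
  have Fw: "F * w = 1\<^sub>m 1" using fw Fc w unfolding F_def by (intro eq_matI) auto
  define N where "N = ?M + - (?u * F)"
  have Neq: "char_poly_matrix (T + u * f) = N"
    unfolding N_def F_def using char_poly_matrix_add[OF T, of "u * f"] const_mat_mult[OF u f] u f by auto
  have uF: "?u * F \<in> carrier_mat n n" using uc Fc by auto
  have Nc: "N \<in> carrier_mat n n" unfolding N_def using Mc uF by auto
  have MN: "?M = N + ?u * F" unfolding N_def by (rule mat_add_cancel_right(2)[OF Mc uF, symmetric])
  have "c \<cdot>\<^sub>m ?x = N * w + ?u * (F * w)"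
    unfolding Mw[symmetric] using Nc uF w uc Fc
    by (subst MN) (simp add: add_mult_distrib_mat[of _ n n] assoc_mult_mat[of _ n 1 _ n _ 1])
  then have cx: "c \<cdot>\<^sub>m ?x = N * w + ?u" unfolding Fw using uc by simp
  have Nw: "N * w \<in> carrier_mat n 1" using Nc w by auto
  have "?u = N * (- w) + ?x * (c \<cdot>\<^sub>m 1\<^sub>m 1)"
  proof -
    have "?x * (c \<cdot>\<^sub>m 1\<^sub>m 1) = c \<cdot>\<^sub>m ?x" using xc by (simp add: mult_smult_distrib[of _ n 1 _ 1])
    moreover have "N * (- w) = - (N * w)" using Nc w by simp
    ultimately show ?thesis unfolding cx using Nw uc Nc w
      by (intro eq_matI) (auto simp del: index_mult_mat(1))
  qed
  then have us: "in_col_span n N ?x 1 ?u"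
    using w by (intro in_col_spanI[of "- w" _ _ "c \<cdot>\<^sub>m 1\<^sub>m 1"]) auto
  \<comment> \<open>\<open>M = N + u F\<close>, and \<open>u\<close> has just been placed in the
    span of \<open>N\<close> and \<open>x\<close>, so nothing of the old span is lost.\<close>
  have mono: "in_col_span n N ?x m b" if b: "in_col_span n ?M ?x m b" for m b
  proof -
    obtain Y z where Y: "Y \<in> carrier_mat n m" and z: "z \<in> carrier_mat 1 m" and b: "b = ?M * Y + ?x * z"
      using b unfolding in_col_span_def by auto
    obtain Y' z' where Y': "Y' \<in> carrier_mat n 1" and z': "z' \<in> carrier_mat 1 1" and ueq: "?u = N * Y' + ?x * z'"
      using us unfolding in_col_span_def by auto
    have FY: "F * Y \<in> carrier_mat 1 m" using Fc Y by auto
    have "?M * Y = N * Y + ?u * (F * Y)"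
      using Nc uF Y uc Fc
      by (subst MN) (simp add: add_mult_distrib_mat[of _ n n] assoc_mult_mat[of _ n 1 _ n _ m])
    also have "?u * (F * Y) = N * (Y' * (F * Y)) + ?x * (z' * (F * Y))"
      using Nc Y' xc z' FY
      by (subst ueq) (simp add: add_mult_distrib_mat[of _ n 1] assoc_mult_mat[of _ n n _ 1 _ m] assoc_mult_mat[of _ n 1 _ 1 _ m])
    finally have beq: "b = N * Y + (N * (Y' * (F * Y)) + ?x * (z' * (F * Y))) + ?x * z" unfolding b by simp
    have sp: "in_col_span n N ?x m (N * Y' + ?x * z')" if "Y' \<in> carrier_mat n m" "z' \<in> carrier_mat 1 m" for Y' z'
      using that by (intro in_col_spanI[of Y' _ _ z']) auto
    have "in_col_span n N ?x m (?x * z)"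
      using z xc Nc by (intro in_col_spanI[of "0\<^sub>m n m" _ _ z]) auto
    then show ?thesis unfolding beq
      using Y' z' FY by (intro in_col_span_add[OF Nc xc] in_col_span_mult[OF Nc xc Y] sp) auto
  qed
  show thesis
    by (rule that[OF f]; unfold Neq; (rule us | (rule mono; assumption)))
qed

text \<open>A certificate for rank at most \<open>k\<close> (terms may be zero) that is easily
  carried through multiplication by a constant matrix and scaling by a polynomial.\<close>

inductive outer_sum :: "nat \<Rightarrow> nat \<Rightarrow> 'a::comm_ring_1 mat \<Rightarrow> bool" for n where
  zero: "outer_sum n 0 (0\<^sub>m n n)"
| add: "outer_sum n k K \<Longrightarrow> u \<in> carrier_mat n 1 \<Longrightarrow> v \<in> carrier_mat 1 n \<Longrightarrow> outer_sum n (Suc k) (K + u * v)"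

lemma outer_sum_carrier: "outer_sum n k K \<Longrightarrow> K \<in> carrier_mat n n"
  by (induction rule: outer_sum.induct) auto

text \<open>Division by the monic matrix \<open>X - T\<close>: from \<open>b = X b1 + b0\<close> and
  \<open>X b1 = (X - T) b1 + T b1\<close>, the vector \<open>b\<close> may be replaced by
  \<open>T b1 + b0\<close>, and \<open>T b1\<close> has one coefficient less. The bound
  \<open>d\<close> in the induction counts coefficients, so that \<open>d = 0\<close> means
  \<open>b = 0\<close>.\<close>

lemma division_by_char_poly_matrix:
  fixes T :: "'a::field mat"
  assumes T: "T \<in> carrier_mat n n" and b: "b \<in> carrier_mat n 1"
  shows "\<exists>Y\<in>carrier_mat n 1. \<exists>u\<in>carrier_mat n 1. b = char_poly_matrix T * Y + const_mat u"
proof -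
  let ?M = "char_poly_matrix T"
  have Mc: "?M \<in> carrier_mat n n" using T by simp
  have "\<exists>Y\<in>carrier_mat n 1. \<exists>u\<in>carrier_mat n 1. b = ?M * Y + const_mat u"
    if "b \<in> carrier_mat n 1" "\<And>i k. i < n \<Longrightarrow> d \<le> k \<Longrightarrow> Polynomial.coeff (b $$ (i, 0)) k = 0" for d b
    using that
  proof (induction d arbitrary: b)
    case 0
    have "b $$ (i, 0) = 0" if "i < n" for i using 0(2)[OF that] by (intro poly_eqI) simp
    then have "b = ?M * 0\<^sub>m n 1 + const_mat (0\<^sub>m n 1)" using 0(1) Mc by (intro eq_matI) auto
    then show ?case by (intro bexI[of _ "0\<^sub>m n 1"]) auto
  next
    case (Suc d)
    define b0 where "b0 = mat n 1 (\<lambda>(i, j). Polynomial.coeff (b $$ (i, 0)) 0)"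
    define b1 where "b1 = mat n 1 (\<lambda>(i, j). poly_shift 1 (b $$ (i, 0)))"
    have b0: "b0 \<in> carrier_mat n 1" and b1: "b1 \<in> carrier_mat n 1" unfolding b0_def b1_def by auto
    define t where "t = const_mat T * b1"
    have t: "t \<in> carrier_mat n 1" unfolding t_def using T b1 by auto
    have M1: "?M * b1 = [:0, 1:] \<cdot>\<^sub>m b1 + - t" unfolding t_def by (rule char_poly_matrix_mult[OF T b1])
    have pc: "pCons (Polynomial.coeff q 0) (poly_shift 1 q) = q" for q :: "'a poly"
      by (intro poly_eqI) (simp add: coeff_pCons coeff_poly_shift split: nat.split)
    have beq: "b = ?M * b1 + t + const_mat b0"
    proof (rule eq_matI)
      fix i j assume "i < dim_row (?M * b1 + t + const_mat b0)" "j < dim_col (?M * b1 + t + const_mat b0)"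
      then have ij: "i < n" "j = 0" using b0 by auto
      have "(?M * b1 + t + const_mat b0) $$ (i, 0) = pCons 0 (b1 $$ (i, 0)) + [:b0 $$ (i, 0):]"
        unfolding M1 using ij b1 t b0 by simp
      also have "\<dots> = b $$ (i, 0)" unfolding b1_def b0_def using ij pc by simp
      finally show "b $$ (i, j) = (?M * b1 + t + const_mat b0) $$ (i, j)" using ij by simp
    qed (use Suc.prems b0 in auto)
    have "Polynomial.coeff (t $$ (i, 0)) k = 0" if "i < n" "d \<le> k" for i k
    proof -
      have "t $$ (i, 0) = (\<Sum>l\<in>{0..<n}. [:T $$ (i, l):] * poly_shift 1 (b $$ (l, 0)))"
        unfolding t_def b1_def using T that by (simp add: scalar_prod_def)
      then show ?thesis
        using Suc.prems(2)[of _ "Suc k"] that by (simp add: coeff_sum coeff_poly_shift)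
    qed
    then obtain Y u where Y: "Y \<in> carrier_mat n 1" and u: "u \<in> carrier_mat n 1" and teq: "t = ?M * Y + const_mat u"
      using Suc.IH[OF t] by auto
    define a where "a = ?M * b1"
    define a' where "a' = ?M * Y"
    have a: "a \<in> carrier_mat n 1" "a' \<in> carrier_mat n 1" unfolding a_def a'_def using Mc b1 Y by auto
    have "const_mat (u + b0) = const_mat u + const_mat b0" using u b0 by (intro eq_matI) auto
    moreover have "?M * (b1 + Y) = a + a'" unfolding a_def a'_def by (rule mult_add_distrib_mat[OF Mc b1 Y])
    ultimately have "b = ?M * (b1 + Y) + const_mat (u + b0)"
      unfolding beq teq a_def[symmetric] a'_def[symmetric] using a u b0
      by (intro eq_matI) auto
    then show ?case using b1 Y u b0 by (intro bexI[of _ "b1 + Y"] bexI[of _ "u + b0"]) auto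
  qed
  moreover define d where "d = Suc (\<Sum>i<n. Polynomial.degree (b $$ (i, 0)))"
  have "Polynomial.coeff (b $$ (i, 0)) k = 0" if "i < n" "d \<le> k" for i k
  proof (rule coeff_eq_0)
    have "Polynomial.degree (b $$ (i, 0)) \<le> (\<Sum>i<n. Polynomial.degree (b $$ (i, 0)))"
      using that by (intro member_le_sum) auto
    then show "Polynomial.degree (b $$ (i, 0)) < k" using that unfolding d_def by simp
  qed
  ultimately show ?thesis using b by blast
qed

text \<open>Iterates \<open>enlarge_col_span\<close>, each time for the matrix already changed. The
  last conjunct preserves what earlier steps have put into the span, and later also the columns of
  \<open>B\<close> and the corrections that come from \<open>X - T\<close> itself.\<close>

lemma heymann:
  fixes T :: "'a::field mat" and u :: "nat \<Rightarrow> 'a mat"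
  assumes T: "T \<in> carrier_mat n n" and x: "x \<in> carrier_mat n 1" and x0: "x \<noteq> 0\<^sub>m n 1"
    and u: "\<And>i. u i \<in> carrier_mat n 1"
  shows "\<exists>K. outer_sum n k K \<and>
    (\<forall>i<k. in_col_span n (char_poly_matrix (T + K)) (const_mat x) 1 (const_mat (u i))) \<and>
    (\<forall>m b. in_col_span n (char_poly_matrix T) (const_mat x) m b \<longrightarrow>
      in_col_span n (char_poly_matrix (T + K)) (const_mat x) m b)"
proof (induction k)
  case 0
  have "T + 0\<^sub>m n n = T" using T by simp
  then show ?case by (intro exI[of _ "0\<^sub>m n n"]) (simp add: outer_sum.zero)
next
  case (Suc k)
  obtain K where K: "outer_sum n k K"
    and span: "\<And>i. i < k \<Longrightarrow> in_col_span n (char_poly_matrix (T + K)) (const_mat x) 1 (const_mat (u i))"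
    and mono: "\<And>m b. in_col_span n (char_poly_matrix T) (const_mat x) m b \<Longrightarrow>
      in_col_span n (char_poly_matrix (T + K)) (const_mat x) m b"
    using Suc by (elim exE conjE) (rule that; blast)
  have Kc: "K \<in> carrier_mat n n" by (rule outer_sum_carrier[OF K])
  have TK: "T + K \<in> carrier_mat n n" using T Kc by auto
  obtain f where f: "f \<in> carrier_mat 1 n"
    and us: "in_col_span n (char_poly_matrix (T + K + u k * f)) (const_mat x) 1 (const_mat (u k))"
    and mono': "\<And>m b. in_col_span n (char_poly_matrix (T + K)) (const_mat x) m b \<Longrightarrow>
      in_col_span n (char_poly_matrix (T + K + u k * f)) (const_mat x) m b"
    by (rule enlarge_col_span[OF TK x x0 u[of k]]) (rule that; assumption)
  have eq: "T + K + u k * f = T + (K + u k * f)"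
    using T Kc u[of k] f by (intro assoc_add_mat[of _ n n]) auto
  have "in_col_span n (char_poly_matrix (T + (K + u k * f))) (const_mat x) 1 (const_mat (u i))" if "i < Suc k" for i
    unfolding eq[symmetric] using that us mono'[OF span, of i] by (cases "i = k") auto
  moreover have "in_col_span n (char_poly_matrix (T + (K + u k * f))) (const_mat x) m b"
    if "in_col_span n (char_poly_matrix T) (const_mat x) m b" for m b
    unfolding eq[symmetric] by (rule mono'[OF mono[OF that]])
  moreover have "outer_sum n (Suc k) (K + u k * f)" by (rule outer_sum.add[OF K u f])
  ultimately show ?case by (intro exI[of _ "K + u k * f"] conjI allI impI) 
qed

lemma unimodular_det_dvd_1:
  assumes "unimodular n P"
  shows "det P dvd 1"
proof -
  obtain P' where P: "P \<in> carrier_mat n n" "P' \<in> carrier_mat n n" "P * P' = 1\<^sub>m n"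
    using assms unfolding unimodular_def by blast
  have "det P * det P' = 1" using det_mult[OF P(1,2)] P(3) by simp
  then show ?thesis by (metis dvd_triv_left)
qed

theorem char_poly_low_rank_perturbation:
  fixes T :: "'a::field mat"
  assumes T: "T \<in> carrier_mat n n" and r: "r \<le> n"
    and equiv: "mat_equivalent n (char_poly_matrix T) D"
    and diag: "\<And>i j. i < n \<Longrightarrow> j < n \<Longrightarrow> i \<noteq> j \<Longrightarrow> D $$ (i, j) = 0"
    and p: "Polynomial.degree p = n" "Polynomial.lead_coeff p = 1"
    and dvd: "(\<Prod>i<n - r. D $$ (i, i)) dvd p"
  shows "\<exists>K. outer_sum n r K \<and> det (char_poly_matrix (T + K)) = p"
proof -
  let ?M = "char_poly_matrix T"
  let ?\<delta> = "\<Prod>i<n - r. D $$ (i, i)"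
  obtain P Q Q' where P: "unimodular n P" and Q: "Q \<in> carrier_mat n n" "Q' \<in> carrier_mat n n" "Q * Q' = 1\<^sub>m n"
    and D: "D \<in> carrier_mat n n" and M: "?M = P * D * Q"
    using equiv unfolding mat_equivalent_def unimodular_def[of n "Q :: 'a poly mat" for Q] by blast
  have Pc: "P \<in> carrier_mat n n" using P unfolding unimodular_def by simp
  have Mc: "?M \<in> carrier_mat n n" using T by simp
  have PD: "P * D = ?M * Q'"
  proof -
    have "?M * Q' = P * D * (Q * Q')" unfolding M using Pc D Q(1,2) by (simp add: assoc_mult_mat[of _ n n _ n _ n])
    then show ?thesis using Q(3) Pc D by simp
  qed
  \<comment> \<open>The columns of \<open>P D = M Q'\<close> lie in the module of \<open>M\<close>.
    Replacing the last \<open>r\<close> diagonal entries of \<open>D\<close> by \<open>1\<close>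
    enlarges this module to one of determinant \<open>?\<delta>\<close> up to a unit; the price is
    \<open>r\<close> columns of \<open>P\<close> as new generators.\<close>
  define E where "E = mat n n (\<lambda>(i, j). if i = j then if i < n - r then D $$ (i, i) else 1 else 0)"
  have Ec: "E \<in> carrier_mat n n" unfolding E_def by simp
  have "det E = prod_list (diag_mat E)"
    by (rule det_upper_triangular[OF _ Ec]) (auto simp: E_def upper_triangular_def)
  also have "\<dots> = (\<Prod>i = 0..<n. E $$ (i, i))" using Ec by (simp add: prod_list_diag_prod)
  also have "\<dots> = (\<Prod>i\<in>{0..<n - r} \<union> {n - r..<n}. E $$ (i, i))"
    using ivl_disj_un_two(3)[of 0 "n - r" n] by simp
  also have "\<dots> = (\<Prod>i = 0..<n - r. E $$ (i, i)) * (\<Prod>i = n - r..<n. E $$ (i, i))"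
    by (intro prod.union_disjoint) auto
  also have "(\<Prod>i = n - r..<n. E $$ (i, i)) = 1" by (intro prod.neutral) (auto simp: E_def)
  also have "(\<Prod>i = 0..<n - r. E $$ (i, i)) = ?\<delta>"
    unfolding lessThan_atLeast0 by (intro prod.cong) (auto simp: E_def)
  finally have detE: "det E = ?\<delta>" by simp
  define B where "B = P * E"
  have Bc: "B \<in> carrier_mat n n" unfolding B_def using Pc Ec by simp
  have "det B dvd ?\<delta>"
    unfolding B_def det_mult[OF Pc Ec] detE
    using mult_dvd_mono[OF unimodular_det_dvd_1[OF P] dvd_refl[of ?\<delta>]] by simp
  then have Bp: "det B dvd p" using dvd by (rule dvd_trans)
  define c where "c j = mat n 1 (\<lambda>(i, _). P $$ (i, j))" for j
  have c: "c j \<in> carrier_mat n 1" for j unfolding c_def by simp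
  have entry: "B $$ (i, j) = P $$ (i, j) * E $$ (j, j)" if "i < n" "j < n" for i j
  proof -
    have "B $$ (i, j) = (\<Sum>k = 0..<n. P $$ (i, k) * E $$ (k, j))"
      unfolding B_def using Pc Ec that by (simp add: scalar_prod_def)
    also have "\<dots> = (\<Sum>k = 0..<n. if k = j then P $$ (i, k) * E $$ (j, j) else 0)"
      using that by (intro sum.cong) (auto simp: E_def)
    finally show ?thesis using that by simp
  qed
  have entryD: "(P * D) $$ (i, j) = P $$ (i, j) * D $$ (j, j)" if "i < n" "j < n" for i j
  proof -
    have "(P * D) $$ (i, j) = (\<Sum>k = 0..<n. P $$ (i, k) * D $$ (k, j))"
      using Pc D that by (simp add: scalar_prod_def)
    also have "\<dots> = (\<Sum>k = 0..<n. if k = j then P $$ (i, k) * D $$ (j, j) else 0)"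
      using that diag by (intro sum.cong) auto
    finally show ?thesis using that by simp
  qed
  have colD: "mat n 1 (\<lambda>(i, _). B $$ (i, j)) = ?M * mat n 1 (\<lambda>(i, _). Q' $$ (i, j))" if j: "j < n - r" for j
  proof (rule eq_matI)
    fix i k assume "i < dim_row (?M * mat n 1 (\<lambda>(i, _). Q' $$ (i, j)))"
      "k < dim_col (?M * mat n 1 (\<lambda>(i, _). Q' $$ (i, j)))"
    then have ik: "i < n" "k = 0" using Mc by auto
    have jn: "j < n" using j by simp
    have "B $$ (i, j) = (P * D) $$ (i, j)"
      using entry[OF ik(1) jn] entryD[OF ik(1) jn] j by (simp add: E_def)
    also have "\<dots> = (\<Sum>k = 0..<n. ?M $$ (i, k) * Q' $$ (k, j))"
      unfolding PD using Mc Q(2) ik jn by (simp add: scalar_prod_def)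
    also have "\<dots> = (?M * mat n 1 (\<lambda>(i, _). Q' $$ (i, j))) $$ (i, 0)"
      using Mc ik by (simp add: scalar_prod_def)
    finally show "mat n 1 (\<lambda>(i, _). B $$ (i, j)) $$ (i, k) = (?M * mat n 1 (\<lambda>(i, _). Q' $$ (i, j))) $$ (i, k)"
      using ik by simp
  qed (use Mc in auto)
  have colE: "mat n 1 (\<lambda>(i, _). B $$ (i, j)) = c j" if "n - r \<le> j" "j < n" for j
    unfolding c_def using that entry by (intro eq_matI) (auto simp: E_def)
  show ?thesis
  proof (cases "r = 0")
    \<comment> \<open>No rank one term is available. Here \<open>det M\<close> divides
      \<open>p\<close>, and as both are monic of degree \<open>n\<close> they are equal.\<close>
    case True
    have "B = ?M * Q'"
    proof -
      have "E = D" using D diag True unfolding E_def by (intro eq_matI) auto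
      then show ?thesis using PD unfolding B_def by simp
    qed
    then have "det B = det ?M * det Q'" using det_mult[OF Mc Q(2)] by simp
    then have "det ?M dvd p" using Bp by (metis dvd_mult_left)
    then obtain h where h: "p = det ?M * h" by (rule dvdE)
    have monic: "Polynomial.degree (det ?M) = n" "Polynomial.lead_coeff (det ?M) = 1"
      using degree_monic_char_poly[OF T] unfolding char_poly_def by auto
    have "p \<noteq> 0" using p by auto
    then have "Polynomial.degree h = 0" "det ?M \<noteq> 0" "h \<noteq> 0"
      using h p monic by (auto simp: degree_mult_eq)
    moreover have "Polynomial.lead_coeff p = Polynomial.lead_coeff (det ?M) * Polynomial.lead_coeff h"
      unfolding h by (rule lead_coeff_mult)
    then have "Polynomial.lead_coeff h = 1" unfolding p(2) monic(2) by simp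
    ultimately have "h = 1" by (metis degree_0_id one_pCons)
    then have "det (char_poly_matrix (T + 0\<^sub>m n n)) = p" using h T by simp
    then show ?thesis using True outer_sum.zero by blast
  next
    case False
    have "\<exists>Y u. Y \<in> carrier_mat n 1 \<and> u \<in> carrier_mat n 1 \<and> c (n - r + i) = ?M * Y + const_mat u" for i
      using division_by_char_poly_matrix[OF T c] by blast
    then obtain Y u where Y: "\<And>i. Y i \<in> carrier_mat n 1" and u: "\<And>i. u i \<in> carrier_mat n 1"
      and ceq: "\<And>i. c (n - r + i) = ?M * Y i + const_mat (u i)"
      by metis
    \<comment> \<open>Assignment needs a nonzero vector. If \<open>u 0\<close> vanishes any other
      one will do, since \<open>0\<close> lies in every span.\<close>
    define x where "x = (if u 0 = 0\<^sub>m n 1 then mat n 1 (\<lambda>_. 1) else u 0)"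
    have x: "x \<in> carrier_mat n 1" unfolding x_def using u by simp
    have n0: "0 < n" using False r by simp
    have "(mat n 1 (\<lambda>_. 1) :: 'a mat) $$ (0, 0) \<noteq> (0\<^sub>m n 1) $$ (0, 0)" using n0 by simp
    then have x0: "x \<noteq> 0\<^sub>m n 1" unfolding x_def by metis
    \<comment> \<open>One of the \<open>r\<close> rank one terms is reserved for the assignment with
      \<open>x\<close>; the other \<open>k\<close> bring \<open>u 1, ..., u k\<close> into the
      span.\<close>
    obtain k where k: "r = Suc k" using False by (cases r) auto
    obtain K where K: "outer_sum n k K"
      and span: "\<forall>i<k. in_col_span n (char_poly_matrix (T + K)) (const_mat x) 1 (const_mat (u (Suc i)))"
      and mono: "\<forall>m b. in_col_span n ?M (const_mat x) m b \<longrightarrow>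
        in_col_span n (char_poly_matrix (T + K)) (const_mat x) m b"
      using heymann[OF T x x0, of "\<lambda>i. u (Suc i)" k] u by blast
    let ?N = "char_poly_matrix (T + K)"
    have TK: "T + K \<in> carrier_mat n n" using T outer_sum_carrier[OF K] by auto
    have Nc: "?N \<in> carrier_mat n n" using TK by simp
    have xc: "const_mat x \<in> carrier_mat n 1" using x by simp
    have us: "in_col_span n ?N (const_mat x) 1 (const_mat (u i))" if "i < r" for i
    proof (cases i)
      case 0
      show ?thesis
      proof (cases "u 0 = 0\<^sub>m n 1")
        case True
        have "const_mat (0\<^sub>m n 1) = ?N * 0\<^sub>m n 1" using Nc by (intro eq_matI) auto
        then show ?thesis unfolding 0 True using in_col_span_mult[OF Nc xc, of "0\<^sub>m n 1" 1] by simp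
      next
        case False
        then show ?thesis unfolding 0 using in_col_span_generator[OF Nc xc] unfolding x_def by simp
      qed
    next
      case (Suc i')
      then show ?thesis using span that k by simp
    qed
    have "in_col_span n ?N (const_mat x) n B"
    proof (rule in_col_span_columns[OF Nc xc Bc])
      fix j assume j: "j < n"
      show "in_col_span n ?N (const_mat x) 1 (mat n 1 (\<lambda>(i, _). B $$ (i, j)))"
      proof (cases "j < n - r")
        case True
        show ?thesis unfolding colD[OF True]
          using in_col_span_mult[OF Mc xc, of "mat n 1 (\<lambda>(i, _). Q' $$ (i, j))" 1] mono by simp
      next
        case False
        then have j': "n - r \<le> j" "j = n - r + (j - (n - r))" "j - (n - r) < r" using j by auto
        show ?thesis unfolding colE[OF j'(1) j]
          by (subst j'(2), subst ceq)
            (intro in_col_span_add[OF Nc xc] us[OF j'(3)] mono[rule_format] in_col_span_mult[OF Mc xc Y])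
      qed
    qed
    then obtain v where v: "v \<in> carrier_mat 1 n" and det: "det (char_poly_matrix (T + K + x * v)) = p"
      using char_poly_assignment[OF TK x x0 _ p Bp] by blast
    have "T + K + x * v = T + (K + x * v)"
      using T outer_sum_carrier[OF K] x v by (intro assoc_add_mat[of _ n n]) auto
    then show ?thesis using outer_sum.add[OF K x v] det k by metis
  qed
qed

section \<open>Homogeneous bivariate polynomials\<close>

lemma homogeneousD:
  "homogeneous d p \<Longrightarrow> i + j \<noteq> d \<Longrightarrow> Polynomial.coeff (Polynomial.coeff p i) j = 0"
  unfolding homogeneous_def by blast

lemma homogeneous_0: "homogeneous d 0"
  unfolding homogeneous_def by simp

lemma homogeneous_add:
  fixes p q :: "'a::comm_ring_1 poly poly"
  assumes "homogeneous d p" "homogeneous d q"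
  shows "homogeneous d (p + q)"
  unfolding homogeneous_def
proof (intro allI impI)
  fix i j assume "Polynomial.coeff (Polynomial.coeff (p + q) i) j \<noteq> 0"
  then have "Polynomial.coeff (Polynomial.coeff p i) j \<noteq> 0 \<or> Polynomial.coeff (Polynomial.coeff q i) j \<noteq> 0" by auto
  then show "i + j = d" using assms unfolding homogeneous_def by blast
qed

lemma homogeneous_mult:
  fixes p q :: "'a::comm_ring_1 poly poly"
  assumes "homogeneous d p" "homogeneous e q"
  shows "homogeneous (d + e) (p * q)"
  unfolding homogeneous_def
proof (intro allI impI)
  fix i j assume "Polynomial.coeff (Polynomial.coeff (p * q) i) j \<noteq> 0"
  then have "(\<Sum>k\<le>i. \<Sum>l\<le>j. Polynomial.coeff (Polynomial.coeff p k) l *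
      Polynomial.coeff (Polynomial.coeff q (i - k)) (j - l)) \<noteq> 0"
    by (simp add: coeff_mult coeff_sum)
  then obtain k where k: "k \<le> i" "(\<Sum>l\<le>j. Polynomial.coeff (Polynomial.coeff p k) l *
      Polynomial.coeff (Polynomial.coeff q (i - k)) (j - l)) \<noteq> 0"
    by (meson atMost_iff sum.not_neutral_contains_not_neutral)
  then obtain l where l: "l \<le> j" "Polynomial.coeff (Polynomial.coeff p k) l *
      Polynomial.coeff (Polynomial.coeff q (i - k)) (j - l) \<noteq> 0"
    by (meson atMost_iff sum.not_neutral_contains_not_neutral)
  have nz: "Polynomial.coeff (Polynomial.coeff p k) l \<noteq> 0"
    "Polynomial.coeff (Polynomial.coeff q (i - k)) (j - l) \<noteq> 0"
    using l(2) by auto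
  have "k + l = d" "i - k + (j - l) = e"
    using assms(1)[unfolded homogeneous_def, rule_format, OF nz(1)]
      assms(2)[unfolded homogeneous_def, rule_format, OF nz(2)] by simp_all
  then show "i + j = d + e" using k(1) l(1) by linarith
qed

lemma homogeneous_const: "homogeneous 0 [:[:c:]:]"
  unfolding homogeneous_def by (simp add: coeff_pCons split: nat.splits)

lemma homogeneous_1: "homogeneous 0 (1 :: 'a::comm_ring_1 poly poly)"
  unfolding one_pCons by (rule homogeneous_const)

lemma homogeneous_power:
  fixes p :: "'a::comm_ring_1 poly poly"
  shows "homogeneous d p \<Longrightarrow> homogeneous (k * d) (p ^ k)"
  by (induction k) (auto intro: homogeneous_1 homogeneous_mult)

lemma homogeneous_sum:
  fixes f :: "'b \<Rightarrow> 'a::comm_ring_1 poly poly"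
  shows "(\<And>x. x \<in> A \<Longrightarrow> homogeneous d (f x)) \<Longrightarrow> homogeneous d (sum f A)"
  by (induction A rule: infinite_finite_induct) (auto intro: homogeneous_0 homogeneous_add)

lemma homogeneous_const_mult:
  fixes p :: "'a::comm_ring_1 poly poly"
  shows "homogeneous d p \<Longrightarrow> homogeneous d ([:[:c:]:] * p)"
  using homogeneous_mult[OF homogeneous_const, of d p c] by simp

lemma homogeneous_det:
  fixes A :: "'a::comm_ring_1 poly poly mat"
  assumes A: "A \<in> carrier_mat k k" and ent: "\<And>i j. i < k \<Longrightarrow> j < k \<Longrightarrow> homogeneous 1 (A $$ (i, j))"
  shows "homogeneous k (det A)"
  using assms
proof (induction k arbitrary: A)
  case 0
  then show ?case by (simp add: homogeneous_1)
next
  case (Suc k)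
  have "homogeneous (1 + k) (A $$ (0, j) * cofactor A 0 j)" if j: "j < Suc k" for j
  proof (rule homogeneous_mult)
    show "homogeneous 1 (A $$ (0, j))" using Suc.prems(2) j by simp
    have "homogeneous k (det (mat_delete A 0 j))"
      by (rule Suc.IH) (use Suc.prems j in \<open>auto simp: mat_delete_def\<close>)
    then have "homogeneous k ([:[:(- 1) ^ (0 + j):]:] * det (mat_delete A 0 j))"
      by (rule homogeneous_const_mult)
    moreover have "([:[:(- 1) ^ (0 + j):]:] :: 'a poly poly) = (- 1) ^ (0 + j)"
    proof -
      have "[:[:- 1 :: 'a:]:] + 1 = 0"
        unfolding one_pCons by (simp only: add_pCons add_0 left_minus pCons_0_0)
      then have "([:[:- 1:]:] :: 'a poly poly) = - 1" by (rule eq_neg_iff_add_eq_0[THEN iffD2])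
      then show ?thesis by (cases "even j") simp_all
    qed
    ultimately show "homogeneous k (cofactor A 0 j)" unfolding cofactor_def by (simp only:)
  qed
  then show ?case
    unfolding laplace_expansion_row[OF Suc.prems(1), of 0, OF zero_less_Suc]
    by (intro homogeneous_sum) auto
qed

lemma homogeneous_eq_sum:
  fixes p :: "'a::comm_ring_1 poly poly"
  assumes "homogeneous d p"
  shows "p = (\<Sum>i\<le>d. Polynomial.monom (Polynomial.monom (Polynomial.coeff (Polynomial.coeff p i) (d - i)) (d - i)) i)"
proof (rule poly_eqI, rule poly_eqI)
  fix a b
  show "Polynomial.coeff (Polynomial.coeff p a) b = Polynomial.coeff (Polynomial.coeff (\<Sum>i\<le>d. Polynomial.monom
      (Polynomial.monom (Polynomial.coeff (Polynomial.coeff p i) (d - i)) (d - i)) i) a) b"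
  proof (cases "a + b = d")
    case True
    have "Polynomial.coeff (Polynomial.coeff (\<Sum>i\<le>d. Polynomial.monom
      (Polynomial.monom (Polynomial.coeff (Polynomial.coeff p i) (d - i)) (d - i)) i) a) b =
      (\<Sum>i\<le>d. if i = a then Polynomial.coeff (Polynomial.coeff p a) b else 0)"
      unfolding coeff_sum using True by (intro sum.cong) auto
    then show ?thesis using True by simp
  next
    case False
    have "(\<Sum>i\<le>d. Polynomial.coeff (Polynomial.coeff (Polynomial.monom
      (Polynomial.monom (Polynomial.coeff (Polynomial.coeff p i) (d - i)) (d - i)) i) a) b) = 0"
      using False by (intro sum.neutral) auto
    then show ?thesis using homogeneousD[OF assms False] by (simp add: coeff_sum)
  qed
qed

text \<open>Degree and order at \<open>0\<close> are both additive and agree on the product. As the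
  order never exceeds the degree, they agree on each factor.\<close>

lemma factor_of_monom:
  fixes p q :: "'a::idom poly"
  assumes "p * q = Polynomial.monom c k" and "c \<noteq> 0"
  shows "\<exists>u m. p = Polynomial.monom u m"
proof -
  have nz: "p * q \<noteq> 0" using assms by (simp add: monom_eq_0_iff)
  then have pq: "p \<noteq> 0" "q \<noteq> 0" by auto
  have "Polynomial.degree p + Polynomial.degree q = k"
    using assms pq by (metis degree_monom_eq degree_mult_eq)
  moreover have "order 0 p + order 0 q = k"
    using order_mult[OF nz, of 0] assms by (simp add: order_0_monom)
  moreover have "order 0 p \<le> Polynomial.degree p" "order 0 q \<le> Polynomial.degree q"
    using pq by (simp_all add: order_degree)
  ultimately have "order 0 p = Polynomial.degree p" by linarith
  then have "Polynomial.monom 1 (Polynomial.degree p) dvd p"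
    using pq by (simp add: monom_1_dvd_iff)
  then obtain s where s: "p = Polynomial.monom 1 (Polynomial.degree p) * s" by (rule dvdE)
  have "s \<noteq> 0" using s pq by auto
  then have "Polynomial.degree s = 0"
    using s by (metis add_cancel_right_right degree_monom_eq degree_mult_eq mult_zero_left pq(1) zero_neq_one)
  then obtain u where "s = [:u:]" by (rule degree_eq_zeroE)
  then have "p = Polynomial.monom u (Polynomial.degree p)" using s by (simp add: mult.commute smult_monom)
  then show ?thesis by blast
qed

text \<open>\<open>p(s, t)\<close> becomes \<open>p(s z, t z)\<close>: the power of \<open>z\<close> records the total degree.\<close>

definition grade_inner :: "'a::comm_ring_1 poly \<Rightarrow> 'a poly poly poly" where
  "grade_inner q = poly (map_poly (\<lambda>c. [:[:[:c:]:]:]) q) (Polynomial.monom [:[:0, 1:]:] 1)"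

definition grade :: "'a::comm_ring_1 poly poly \<Rightarrow> 'a poly poly poly" where
  "grade p = poly (map_poly grade_inner p) (Polynomial.monom [:0, 1:] 1)"

interpretation const3_hom: comm_ring_hom "\<lambda>c::'a::comm_ring_1. [:[:[:c:]:]:]"
  by unfold_locales simp_all

interpretation grade_inner_hom: comm_ring_hom "grade_inner :: 'a::comm_ring_1 poly \<Rightarrow> _"
proof -
  interpret m: map_poly_comm_ring_hom "\<lambda>c::'a. [:[:[:c:]:]:]" ..
  show "comm_ring_hom (grade_inner :: 'a poly \<Rightarrow> _)"
    by unfold_locales (simp_all add: grade_inner_def m.hom_add m.hom_mult)
qed

interpretation grade_hom: comm_ring_hom "grade :: 'a::comm_ring_1 poly poly \<Rightarrow> _"
proof -
  interpret m: map_poly_comm_ring_hom "grade_inner :: 'a poly \<Rightarrow> _" ..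
  show "comm_ring_hom (grade :: 'a poly poly \<Rightarrow> _)"
    by unfold_locales (simp_all add: grade_def m.hom_add m.hom_mult)
qed

lemma monom_power: "Polynomial.monom (a::'a::comm_semiring_1) i ^ k = Polynomial.monom (a ^ k) (i * k)"
  by (induction k) (auto simp: mult_monom)

lemma const_power: "[:a::'a::comm_semiring_1:] ^ k = [:a ^ k:]"
  by (induction k) (auto simp: one_pCons mult.commute)

lemma var_power: "(pCons 0 1 :: 'a::comm_semiring_1 poly) ^ k = Polynomial.monom 1 k"
  by (simp only: monom_altdef smult_1_left one_pCons)

lemma grade_monom:
  fixes c :: "'a::comm_ring_1"
  shows "grade (Polynomial.monom (Polynomial.monom c j) i) =
    Polynomial.monom (Polynomial.monom (Polynomial.monom c j) i) (i + j)"
proof -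
  have "grade_inner (Polynomial.monom c j) = [:[:[:c:]:]:] * Polynomial.monom [:[:0, 1:]:] 1 ^ j"
    unfolding grade_inner_def by (simp add: map_poly_monom poly_monom)
  also have "\<dots> = Polynomial.monom [:Polynomial.monom c j:] j"
    unfolding monom_power by (simp add: smult_monom const_power var_power)
  finally have gi: "grade_inner (Polynomial.monom c j) = Polynomial.monom [:Polynomial.monom c j:] j" .
  have "grade (Polynomial.monom (Polynomial.monom c j) i) =
      grade_inner (Polynomial.monom c j) * Polynomial.monom [:0, 1:] 1 ^ i"
    unfolding grade_def by (simp add: map_poly_monom poly_monom)
  also have "\<dots> = Polynomial.monom (Polynomial.monom (Polynomial.monom c j) i) (i + j)"
    unfolding gi monom_power by (simp add: mult_monom smult_monom add.commute var_power)
  finally show ?thesis .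
qed

lemma poly_poly_eq_sum:
  fixes p :: "'a::comm_ring_1 poly poly"
  assumes "Polynomial.degree p \<le> N" and "\<And>i. Polynomial.degree (Polynomial.coeff p i) \<le> N"
  shows "p = (\<Sum>i\<le>N. \<Sum>j\<le>N. Polynomial.monom (Polynomial.monom (Polynomial.coeff (Polynomial.coeff p i) j) j) i)"
proof -
  have "(\<Sum>j\<le>N. Polynomial.monom (Polynomial.monom (Polynomial.coeff (Polynomial.coeff p i) j) j) i) =
    Polynomial.monom (Polynomial.coeff p i) i" for i
    unfolding monom_sum[symmetric] poly_as_sum_of_monoms'[OF assms(2)] ..
  then show ?thesis using poly_as_sum_of_monoms'[OF assms(1)] by simp
qed

text \<open>So the coefficient of \<open>z^k\<close> is the component of degree \<open>k\<close>,
  and \<open>p\<close> is homogeneous exactly when \<open>grade p\<close> is a monomial in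
  \<open>z\<close>.\<close>

lemma coeff_grade:
  fixes p :: "'a::comm_ring_1 poly poly"
  shows "Polynomial.coeff (Polynomial.coeff (Polynomial.coeff (grade p) k) i) j =
    (if i + j = k then Polynomial.coeff (Polynomial.coeff p i) j else 0)"
proof -
  \<comment> \<open>A common bound for the degrees in both variables, enlarged by
    \<open>i + j\<close> so that the queried exponents occur in the sums.\<close>
  define N where "N = Polynomial.degree p + (\<Sum>i\<le>Polynomial.degree p. Polynomial.degree (Polynomial.coeff p i)) + i + j"
  have "Polynomial.degree (Polynomial.coeff p i) \<le> N" for i
  proof (cases "i \<le> Polynomial.degree p")
    case True
    then have "Polynomial.degree (Polynomial.coeff p i) \<le> (\<Sum>i\<le>Polynomial.degree p. Polynomial.degree (Polynomial.coeff p i))"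
      by (intro member_le_sum) auto
    then show ?thesis unfolding N_def by simp
  qed (simp add: coeff_eq_0)
  then have p: "p = (\<Sum>i\<le>N. \<Sum>j\<le>N. Polynomial.monom (Polynomial.monom (Polynomial.coeff (Polynomial.coeff p i) j) j) i)"
    by (intro poly_poly_eq_sum) (simp add: N_def)
  have "grade p = (\<Sum>i\<le>N. \<Sum>j\<le>N. Polynomial.monom (Polynomial.monom (Polynomial.monom
      (Polynomial.coeff (Polynomial.coeff p i) j) j) i) (i + j))"
    by (subst p) (simp only: grade_hom.hom_sum grade_monom)
  then have "Polynomial.coeff (Polynomial.coeff (Polynomial.coeff (grade p) k) i) j =
    (\<Sum>a\<le>N. \<Sum>b\<le>N. if a = i then (if b = j then if i + j = k then Polynomial.coeff (Polynomial.coeff p i) j else 0 else 0) else 0)"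
    unfolding coeff_sum by (auto intro!: sum.cong simp: coeff_sum)
  also have "\<dots> = (if i + j = k then Polynomial.coeff (Polynomial.coeff p i) j else 0)"
  proof -
    have "i \<le> N" "j \<le> N" unfolding N_def by auto
    then show ?thesis by (simp add: if_distrib[where f = "sum _"] sum.If_cases)
  qed
  finally show ?thesis .
qed

text \<open>\<open>grade\<close> is multiplicative and sends \<open>p\<close> to the monomial
  \<open>p z^d\<close>, whose factors are monomials in \<open>z\<close>.\<close>

lemma homogeneous_dvd:
  fixes p :: "'a::idom poly poly"
  assumes p: "homogeneous d p" "p \<noteq> 0" and "q dvd p"
  shows "\<exists>e. homogeneous e q"
proof -
  obtain q' where q': "p = q * q'" using assms(3) by (rule dvdE)
  have "grade p = Polynomial.monom p d"
    by (intro poly_eqI) (auto simp: coeff_grade homogeneousD[OF p(1)])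
  then have "grade q * grade q' = Polynomial.monom p d" unfolding q' by (simp add: grade_hom.hom_mult)
  then obtain u m where um: "grade q = Polynomial.monom u m" using factor_of_monom p(2) by blast
  have "homogeneous m q"
    unfolding homogeneous_def
  proof (intro allI impI)
    fix i j assume nz: "Polynomial.coeff (Polynomial.coeff q i) j \<noteq> 0"
    then have "Polynomial.coeff (Polynomial.coeff (Polynomial.coeff (grade q) (i + j)) i) j \<noteq> 0"
      by (simp add: coeff_grade)
    then show "i + j = m" unfolding um by (auto split: if_splits)
  qed
  then show ?thesis by blast
qed

section \<open>Dehomogenization\<close>

text \<open>\<open>\<eta>\<close> substitutes linear polynomials for \<open>s\<close> and \<open>t\<close>, sending a point of the projective line to
  infinity; \<open>L\<close> is the linear form that vanishes at this point.\<close>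

locale dehomogenization = comm_ring_hom \<eta> for \<eta> :: "'a::field poly poly \<Rightarrow> 'a poly" +
  fixes S L :: "'a poly poly"
  assumes eta_const: "\<eta> [:[:c:]:] = [:c:]"
    and hom_S: "homogeneous 1 S" and eta_S: "\<eta> S = [:0, 1:]"
    and hom_L: "homogeneous 1 L" and eta_L: "\<eta> L = 1"
    and eta_inj: "homogeneous e p \<Longrightarrow> \<eta> p = 0 \<Longrightarrow> p = 0"
    and degree_eta: "homogeneous e p \<Longrightarrow> Polynomial.degree (\<eta> p) \<le> e"
begin

text \<open>Inverts \<eta> in degree \<open>e\<close>: since \<open>L\<close> has image
  \<open>1\<close>, its powers pad those of \<open>S\<close> to the right degree.\<close>

lemma homogenize:
  assumes "Polynomial.degree k \<le> e"
  obtains p where "homogeneous e p" and "\<eta> p = k"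
proof -
  define p where "p = (\<Sum>i\<le>e. [:[:Polynomial.coeff k i:]:] * (S ^ i * L ^ (e - i)))"
  have "homogeneous e (S ^ i * L ^ (e - i))" if "i \<le> e" for i
    using homogeneous_mult[OF homogeneous_power[OF hom_S, of i] homogeneous_power[OF hom_L, of "e - i"]] that by simp
  then have "homogeneous e p"
    unfolding p_def by (intro homogeneous_sum homogeneous_const_mult) auto
  moreover have "\<eta> p = (\<Sum>i\<le>e. Polynomial.monom (Polynomial.coeff k i) i)"
    unfolding p_def hom_sum hom_mult hom_power eta_const eta_S eta_L
    by (intro sum.cong) (simp_all add: monom_altdef)
  then have "\<eta> p = k" using poly_as_sum_of_monoms'[OF assms] by simp
  ultimately show thesis by (rule that)
qed

lemma eta_eq_imp_eq:
  assumes "homogeneous e p" "homogeneous e q" "\<eta> p = \<eta> q"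
  shows "p = q"
proof -
  have "homogeneous e (p + [:[:- 1:]:] * q)"
    by (intro homogeneous_add homogeneous_const_mult assms)
  moreover have "\<eta> (p + [:[:- 1:]:] * q) = 0"
    unfolding hom_add hom_mult eta_const assms(3) by simp
  ultimately have "p + [:[:- 1:]:] * q = 0" by (rule eta_inj)
  moreover have "[:[:- 1 :: 'a:]:] + 1 = 0"
    unfolding one_pCons by (simp only: add_pCons add_0 left_minus pCons_0_0)
  then have "[:[:- 1 :: 'a:]:] = - 1" by (rule eq_neg_iff_add_eq_0[THEN iffD2])
  ultimately show ?thesis by (simp only: mult_minus1 add_uminus_conv_diff right_minus_eq)
qed

text \<open>\<eta> forgets factors \<open>L\<close>, so divisibility comes back only for an
  \<open>a\<close> without such a factor, and this is what full degree of its image means. The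
  quotient is homogenized in degree \<open>m - e\<close>.\<close>

lemma eta_dvd_imp_dvd:
  assumes a: "homogeneous e a" and deg: "Polynomial.degree (\<eta> a) = e" and b: "homogeneous m b"
    and dvd: "\<eta> a dvd \<eta> b"
  shows "a dvd b"
proof (cases "b = 0")
  case False
  then have nz: "\<eta> b \<noteq> 0" using eta_inj[OF b] by blast
  obtain k where k: "\<eta> b = \<eta> a * k" using dvd by (rule dvdE)
  have k0: "k \<noteq> 0" "\<eta> a \<noteq> 0" using k nz by auto
  then have "e + Polynomial.degree k \<le> m"
    using degree_eta[OF b] unfolding k deg[symmetric] by (simp add: degree_mult_eq)
  then have m: "e \<le> m" "Polynomial.degree k \<le> m - e" by auto
  obtain q where q: "homogeneous (m - e) q" "\<eta> q = k" using homogenize[OF m(2)] .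
  have "homogeneous m (a * q)" using homogeneous_mult[OF a q(1)] m(1) by simp
  then have "b = a * q" using b k q(2) by (intro eta_eq_imp_eq[of m]) (simp_all add: hom_mult)
  then show ?thesis by simp
qed simp

text \<open>The gcd is found in \<open>F[x]\<close> and homogenized. To compare it with an arbitrary
  common divisor \<open>c\<close>, the image of \<open>c\<close> must have full degree;
  \<open>D\<close>, with an image of full degree, forces this on all its divisors.\<close>

lemma homogeneous_gcd:
  assumes hom: "\<And>x. x \<in> A \<Longrightarrow> \<exists>m. homogeneous m x"
    and D: "homogeneous n D" "Polynomial.coeff (\<eta> D) n \<noteq> 0"
    and dvd_D: "\<And>c. \<forall>x\<in>A. c dvd x \<Longrightarrow> c dvd D"
  shows "\<exists>!d. is_gcd_of d A \<and> (\<exists>m. homogeneous m d) \<and> monic_wrt_s d"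
proof -
  have D0: "D \<noteq> 0" using D(2) by auto
  have degD: "Polynomial.degree (\<eta> D) = n"
    using D(2) degree_eta[OF D(1)] le_degree by (intro antisym)
  have ex0: "\<exists>x\<in>A. x \<noteq> 0"
  proof (rule ccontr)
    assume "\<not> (\<exists>x\<in>A. x \<noteq> 0)"
    then have "0 dvd D" by (intro dvd_D) auto
    then show False using D0 by simp
  qed
  \<comment> \<open>The ideal generated by the images. As an intersection it gives \<open>IJ\<close>
    at once, because the multiples of \<open>c\<close> form one of the intersected ideals.\<close>
  define I where "I = \<Inter>{U. \<eta> ` A \<subseteq> U \<and> (\<forall>p\<in>U. \<forall>q\<in>U. p + q \<in> U) \<and> (\<forall>p\<in>U. \<forall>q. q * p \<in> U)}"
  have AI: "\<eta> x \<in> I" if "x \<in> A" for x unfolding I_def using that by auto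
  have Iadd: "p + q \<in> I" if "p \<in> I" "q \<in> I" for p q using that unfolding I_def by blast
  have Imult: "q * p \<in> I" if "p \<in> I" for p q using that unfolding I_def by blast
  have IJ: "c dvd p" if c: "\<forall>x\<in>A. c dvd \<eta> x" and p: "p \<in> I" for c p
  proof -
    have "p \<in> {p. c dvd p}"
      using p unfolding I_def by (rule InterD) (use c in auto)
    then show ?thesis by simp
  qed
  obtain x0 where x0: "x0 \<in> A" "x0 \<noteq> 0" using ex0 by blast
  have \<eta>x0: "\<eta> x0 \<noteq> 0" using hom[OF x0(1)] eta_inj x0(2) by blast
  obtain \<gamma> where \<gamma>: "\<gamma> \<in> I" "\<gamma> \<noteq> 0" "\<And>p. p \<in> I \<Longrightarrow> \<gamma> dvd p"
    by (rule poly_ideal_principal[OF Iadd Imult AI[OF x0(1)] \<eta>x0]; (assumption | (rule that; assumption)))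
  obtain \<delta> where \<delta>: "homogeneous (Polynomial.degree \<gamma>) \<delta>" "\<eta> \<delta> = \<gamma>" using homogenize[OF order_refl] .
  have \<delta>0: "\<delta> \<noteq> 0" using \<delta>(2) \<gamma>(2) by auto
  have \<delta>dvd: "\<delta> dvd x" if x: "x \<in> A" for x
  proof -
    obtain m where "homogeneous m x" using hom[OF x] by blast
    moreover have "\<eta> \<delta> dvd \<eta> x" unfolding \<delta>(2) using \<gamma>(3)[OF AI[OF x]] .
    ultimately show ?thesis using \<delta> by (intro eta_dvd_imp_dvd[of "Polynomial.degree \<gamma>" \<delta> m]) simp_all
  qed
  have dvd\<delta>: "c dvd \<delta>" if c: "\<forall>x\<in>A. c dvd x" for c
  proof -
    have cD: "c dvd D" by (rule dvd_D[OF c])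
    then obtain e where e: "homogeneous e c" using homogeneous_dvd[OF D(1) D0] by blast
    obtain q where q: "D = c * q" using cD by (rule dvdE)
    have "q dvd D" unfolding q by simp
    then obtain e' where e': "homogeneous e' q" using homogeneous_dvd[OF D(1) D0] by blast
    have nz: "\<eta> c \<noteq> 0" "\<eta> q \<noteq> 0"
      using D(2) unfolding q hom_mult by auto
    have cq: "c \<noteq> 0" "q \<noteq> 0" using D0 q by auto
    \<comment> \<open>The degrees of \<open>c\<close> and its cofactor \<open>q\<close> add up to
      \<open>n\<close>, and so do those of their images. Since no image exceeds the degree of its
      source, both have full degree.\<close>
    have "homogeneous (e + e') D" unfolding q by (rule homogeneous_mult[OF e e'])
    moreover obtain i j where "Polynomial.coeff (Polynomial.coeff D i) j \<noteq> 0"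
      using D0 by (metis leading_coeff_0_iff)
    ultimately have "e + e' = n" using D(1) unfolding homogeneous_def by metis
    moreover have "Polynomial.degree (\<eta> c) + Polynomial.degree (\<eta> q) = n"
      using degD nz unfolding q hom_mult by (simp add: degree_mult_eq)
    ultimately have dege: "Polynomial.degree (\<eta> c) = e"
      using degree_eta[OF e] degree_eta[OF e'] by linarith
    have "\<eta> c dvd \<eta> x" if "x \<in> A" for x
    proof -
      have "c dvd x" using c that by blast
      then obtain y where "x = c * y" by (rule dvdE)
      then show ?thesis by (simp add: hom_mult)
    qed
    then have "\<eta> c dvd \<eta> \<delta>" unfolding \<delta>(2) using IJ \<gamma>(1) by blast
    then show ?thesis by (rule eta_dvd_imp_dvd[OF e dege \<delta>(1)])
  qed
  define l where "l = Polynomial.lead_coeff (Polynomial.lead_coeff \<delta>)"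
  have l0: "l \<noteq> 0" unfolding l_def using \<delta>0 by simp
  define d where "d = [:[:inverse l:]:] * \<delta>"
  have d\<delta>: "\<delta> = [:[:l:]:] * d" unfolding d_def using l0 by simp
  have "is_gcd_of d A"
    unfolding is_gcd_of_def
  proof (intro conjI ballI allI impI)
    fix x assume "x \<in> A"
    then have "d * [:[:l:]:] dvd x" using \<delta>dvd d\<delta> by (simp only: mult.commute)
    then show "d dvd x" by (rule dvd_mult_left)
  next
    fix c assume "\<forall>x\<in>A. c dvd x"
    then show "c dvd d" unfolding d_def by (intro dvd_mult dvd\<delta>)
  qed
  moreover have "homogeneous (Polynomial.degree \<gamma>) d" unfolding d_def by (rule homogeneous_const_mult[OF \<delta>(1)])
  moreover have "monic_wrt_s d"
    unfolding monic_wrt_s_def d_def using l0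
    by (simp only: lead_coeff_mult) (simp add: l_def[symmetric])
  ultimately have ex: "is_gcd_of d A \<and> (\<exists>m. homogeneous m d) \<and> monic_wrt_s d" by blast
  show ?thesis
  proof (rule ex1I[of _ d], rule ex)
    fix d' assume d': "is_gcd_of d' A \<and> (\<exists>m. homogeneous m d') \<and> monic_wrt_s d'"
    \<comment> \<open>The two gcds differ by a unit of \<open>F[s,t]\<close>, a nonzero scalar,
      which monicity fixes to \<open>1\<close>.\<close>
    have "d dvd d'" "d' dvd d" using ex d' unfolding is_gcd_of_def by auto
    then obtain u v where u: "d' = d * u" and v: "d = d' * v" unfolding dvd_def by blast
    have d0: "d \<noteq> 0" unfolding d_def using \<delta>0 l0 by simp
    have "d * (u * v) = d * 1" using u v by (simp add: mult.assoc[symmetric])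
    then have uv: "u * v = 1" using d0 by (simp only: mult_cancel_left) simp
    then have "u \<noteq> 0" "v \<noteq> 0" by auto
    then have "Polynomial.degree u = 0" using uv by (metis add_is_0 degree_1 degree_mult_eq)
    then obtain a where a: "u = [:a:]" by (rule degree_eq_zeroE)
    have "Polynomial.degree v = 0" using \<open>u \<noteq> 0\<close> \<open>v \<noteq> 0\<close> uv by (metis add_is_0 degree_1 degree_mult_eq)
    then obtain b where b: "v = [:b:]" by (rule degree_eq_zeroE)
    have ab: "a * b = 1" using arg_cong[OF uv, of "\<lambda>w. Polynomial.coeff w 0"] unfolding a b by (simp add: mult.commute)
    then have "a \<noteq> 0" "b \<noteq> 0" by auto
    then have "Polynomial.degree a = 0" using ab by (metis add_is_0 degree_1 degree_mult_eq)
    then obtain c where c: "a = [:c:]" by (rule degree_eq_zeroE)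
    have "Polynomial.lead_coeff (Polynomial.lead_coeff d') =
      Polynomial.lead_coeff (Polynomial.lead_coeff d) * Polynomial.lead_coeff (Polynomial.lead_coeff u)"
      unfolding u lead_coeff_mult ..
    then have "c = 1" using ex d' unfolding monic_wrt_s_def a c by simp
    then show "d' = d" unfolding u a c by simp
  qed
qed

end

section \<open>Substitutions that send a given point to infinity\<close>

lemma homogeneous_linear: "homogeneous 1 [:[:0, a:], [:b:]:]"
  unfolding homogeneous_def by (simp add: coeff_pCons split: nat.splits)

text \<open>The homomorphism from \<open>F[s,t]\<close> to \<open>F[x]\<close> that sends
  \<open>s\<close> to \<alpha> and \<open>t\<close> to \<beta>. It is used with
  \<open>(x, 1)\<close> for the point at infinity and \<open>(1 + l x, x)\<close> for the point
  \<open>l\<close>.\<close>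

definition ev2h :: "'a::comm_ring_1 poly \<Rightarrow> 'a poly \<Rightarrow> 'a poly poly \<Rightarrow> 'a poly" where
  "ev2h \<alpha> \<beta> p = poly (map_poly (\<lambda>q. pcompose q \<beta>) p) \<alpha>"

lemma ev2h_comm_ring_hom: "comm_ring_hom (ev2h \<alpha> \<beta> :: 'a::comm_ring_1 poly poly \<Rightarrow> _)"
proof -
  have "comm_ring_hom (\<lambda>q. pcompose q \<beta> :: 'a poly)"
    by unfold_locales (simp_all add: pcompose_add pcompose_mult)
  then interpret m: map_poly_comm_ring_hom "\<lambda>q. pcompose q \<beta> :: 'a poly"
    by (simp add: map_poly_comm_ring_hom_def)
  show ?thesis by unfold_locales (simp_all add: ev2h_def m.hom_add m.hom_mult)
qed

lemma ev2h_monom: "ev2h \<alpha> \<beta> (Polynomial.monom (Polynomial.monom c j) i) = Polynomial.smult c (\<beta> ^ j * \<alpha> ^ i)"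
proof -
  have "pcompose (Polynomial.monom c j) \<beta> = Polynomial.smult c (\<beta> ^ j)"
    by (simp add: monom_altdef pcompose_smult pcompose_hom.hom_power pcompose_pCons)
  then show ?thesis unfolding ev2h_def by (simp add: map_poly_monom poly_monom)
qed

lemma ev2h_homogeneous:
  assumes "homogeneous e p"
  shows "ev2h \<alpha> \<beta> p = (\<Sum>i\<le>e. Polynomial.smult (Polynomial.coeff (Polynomial.coeff p i) (e - i)) (\<beta> ^ (e - i) * \<alpha> ^ i))"
proof -
  interpret comm_ring_hom "ev2h \<alpha> \<beta>" by (rule ev2h_comm_ring_hom)
  show ?thesis by (subst homogeneous_eq_sum[OF assms]) (simp only: hom_sum ev2h_monom)
qed

lemma degree_linear_power: "Polynomial.degree q \<le> 1 \<Longrightarrow> Polynomial.degree (q ^ k) \<le> k"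
  using degree_power_le[of q k] by (metis mult.commute mult_le_mono1 mult_1 order_trans)

lemma ev2h_degree:
  assumes "homogeneous e p" "Polynomial.degree \<alpha> \<le> 1" "Polynomial.degree \<beta> \<le> 1"
  shows "Polynomial.degree (ev2h \<alpha> \<beta> p) \<le> e"
  unfolding ev2h_homogeneous[OF assms(1)]
proof (intro degree_sum_le)
  fix i assume "i \<in> {..e}"
  then have "Polynomial.degree (\<beta> ^ (e - i) * \<alpha> ^ i) \<le> (e - i) + i"
    using degree_mult_le[of "\<beta> ^ (e - i)" "\<alpha> ^ i"] degree_linear_power[OF assms(2), of i]
      degree_linear_power[OF assms(3), of "e - i"] by linarith
  then show "Polynomial.degree (Polynomial.smult (Polynomial.coeff (Polynomial.coeff p i) (e - i)) (\<beta> ^ (e - i) * \<alpha> ^ i)) \<le> e"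
    using \<open>i \<in> {..e}\<close> by (intro order_trans[OF degree_smult_le]) simp
qed simp

lemma homogeneous_zeroI:
  fixes p :: "'a::comm_ring_1 poly poly"
  assumes "homogeneous e p" "\<And>i. i \<le> e \<Longrightarrow> Polynomial.coeff (Polynomial.coeff p i) (e - i) = 0"
  shows "p = 0"
  by (subst homogeneous_eq_sum[OF assms(1)]) (simp add: assms(2))

lemma ev2h_const: "ev2h \<alpha> \<beta> [:[:c:]:] = [:c:]"
  using ev2h_monom[of \<alpha> \<beta> c 0 0] by (simp add: monom_0)

text \<open>Ordinary dehomogenization \<open>t = 1\<close>; the form \<open>t\<close> vanishes at
  the point \<open>(1 : 0)\<close>.\<close>

interpretation dehom_inf: dehomogenization "ev2h [:0, 1:] 1" "[:0, 1:]" "[:[:0, 1:]:]"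
proof -
  interpret comm_ring_hom "ev2h [:0, 1:] 1" by (rule ev2h_comm_ring_hom)
  show "dehomogenization (ev2h [:0, 1:] 1) [:0, 1:] [:[:0, 1::'a:]:]"
  proof unfold_locales
    show "homogeneous 1 [:0, 1 :: 'a poly:]" "homogeneous 1 [:[:0, 1 :: 'a:]:]"
      using homogeneous_linear[of 0 "1 :: 'a"] homogeneous_linear[of "1 :: 'a" 0] by simp_all
    show "ev2h [:0, 1:] 1 [:0, 1:] = [:0, 1 :: 'a:]" "ev2h [:0, 1:] 1 [:[:0, 1:]:] = (1 :: 'a poly)"
      unfolding ev2h_def by (simp_all add: map_poly_pCons pcompose_pCons)
    fix e and p :: "'a poly poly"
    assume p: "homogeneous e p"
    show "Polynomial.degree (ev2h [:0, 1:] 1 p) \<le> e" by (rule ev2h_degree[OF p]) auto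
    assume z: "ev2h [:0, 1:] 1 p = 0"
    have "ev2h [:0, 1:] 1 p = (\<Sum>i\<le>e. Polynomial.monom (Polynomial.coeff (Polynomial.coeff p i) (e - i)) i)"
      unfolding ev2h_homogeneous[OF p] by (simp add: monom_altdef)
    then have c: "Polynomial.coeff (\<Sum>i\<le>e. Polynomial.monom (Polynomial.coeff (Polynomial.coeff p i) (e - i)) i) k = 0" for k
      using z by simp
    show "p = 0"
    proof (rule homogeneous_zeroI[OF p])
      fix i assume "i \<le> e"
      then show "Polynomial.coeff (Polynomial.coeff p i) (e - i) = 0" using c[of i] by (simp add: coeff_sum)
    qed
  qed (rule ev2h_const)
qed

text \<open>The point \<open>(1 + l x : x)\<close> is \<open>(l : 1)\<close> for \<open>x\<close>
  infinite, and the form \<open>s - l t\<close> vanishing there becomes \<open>1\<close>. The role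
  of \<open>S\<close> is taken by \<open>t\<close>.\<close>

lemma dehom_fin: "dehomogenization (ev2h [:1, l:] [:0, 1:]) [:[:0, 1:]:] [:[:0, - l:], 1:]" for l :: "'a::field"
proof -
  interpret comm_ring_hom "ev2h [:1, l:] [:0, 1:]" by (rule ev2h_comm_ring_hom)
  show ?thesis
  proof unfold_locales
    show "homogeneous 1 [:[:0, - l:], 1:]" "homogeneous 1 [:[:0, 1 :: 'a:]:]"
      using homogeneous_linear[of "- l" 1] homogeneous_linear[of "1 :: 'a" 0] by simp_all
    show "ev2h [:1, l:] [:0, 1:] [:[:0, 1:]:] = [:0, 1 :: 'a:]" "ev2h [:1, l:] [:0, 1:] [:[:0, - l:], 1:] = (1 :: 'a poly)"
      unfolding ev2h_def by (simp_all add: map_poly_pCons pcompose_pCons)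
    fix e and p :: "'a poly poly"
    assume p: "homogeneous e p"
    show "Polynomial.degree (ev2h [:1, l:] [:0, 1:] p) \<le> e" by (rule ev2h_degree[OF p]) auto
    assume z: "ev2h [:1, l:] [:0, 1:] p = 0"
    \<comment> \<open>For injectivity let \<open>m\<close> be the largest index with
      \<open>c m\<close> nonzero: then \<open>x^(e - m)\<close> splits off, and the remaining sum
      has the value \<open>c m\<close> at \<open>0\<close>.\<close>
    define c where "c i = Polynomial.coeff (Polynomial.coeff p i) (e - i)" for i
    show "p = 0"
    proof (rule ccontr)
      assume "p \<noteq> 0"
      then have "\<exists>i\<le>e. c i \<noteq> 0" using homogeneous_zeroI[OF p] unfolding c_def by blast
      then have ne: "{i. i \<le> e \<and> c i \<noteq> 0} \<noteq> {}" by auto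
      have fin: "finite {i. i \<le> e \<and> c i \<noteq> 0}" by auto
      note m = Max_in[OF fin ne] and ge = Max_ge[OF fin]
      define m where "m = Max {i. i \<le> e \<and> c i \<noteq> 0}"
      have me: "m \<le> e" "c m \<noteq> 0" using m[folded m_def] by simp_all
      have above: "c i = 0" if "m < i" "i \<le> e" for i using ge[of i, folded m_def] that by force
      let ?f = "\<lambda>k i. Polynomial.smult (c i) ([:0, 1:] ^ (k - i) * [:1, l:] ^ i)"
      have "0 = (\<Sum>i\<le>e. ?f e i)" using z unfolding ev2h_homogeneous[OF p] c_def by simp
      also have "\<dots> = (\<Sum>i\<le>m. ?f e i)"
        using me(1) above by (intro sum.mono_neutral_right) auto
      also have "\<dots> = (\<Sum>i\<le>m. [:0, 1:] ^ (e - m) * ?f m i)"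
        using me(1) by (intro sum.cong) (auto simp: power_add[symmetric] mult.assoc[symmetric])
      also have "\<dots> = [:0, 1:] ^ (e - m) * (\<Sum>i\<le>m. ?f m i)" by (simp only: sum_distrib_left)
      finally have "(\<Sum>i\<le>m. ?f m i) = 0" by simp
      then have "poly (\<Sum>i\<le>m. ?f m i) 0 = 0" by simp
      then have "(\<Sum>i\<le>m. c i * 0 ^ (m - i)) = 0" by (simp add: poly_sum)
      moreover have "(\<Sum>i\<le>m. c i * 0 ^ (m - i)) = (\<Sum>i\<le>m. if i = m then c m else 0)"
        by (intro sum.cong) auto
      ultimately show False using me(2) by simp
    qed
  qed (rule ev2h_const)
qed

section \<open>Perturbations of prescribed rank\<close>

interpretation to_fract_hom: comm_ring_hom "to_fract :: 'a::idom \<Rightarrow> _"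
  by unfold_locales auto

lemma normal_rank_eq: "G \<in> carrier_mat n m \<Longrightarrow> normal_rank G = vec_space.rank n (map_mat to_fract G)"
  unfolding normal_rank_def by auto

lemma normal_rank_add:
  assumes "G \<in> carrier_mat n m" "H \<in> carrier_mat n m"
  shows "normal_rank (G + H) \<le> normal_rank G + normal_rank H"
proof -
  have "map_mat to_fract (G + H) = map_mat to_fract G + map_mat to_fract H"
    using assms by (intro eq_matI) auto
  moreover have "G + H \<in> carrier_mat n m" using assms by auto
  ultimately show ?thesis
    using vec_space.rank_subadditive[of "map_mat to_fract G" n m "map_mat to_fract H"] assms
    by (simp add: normal_rank_eq[of _ n m])
qed

lemma normal_rank_le_1:
  assumes G: "G \<in> carrier_mat n m" and "\<And>a b. a < n \<Longrightarrow> b < m \<Longrightarrow> G $$ (a, b) = f a * g b"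
  shows "normal_rank G \<le> 1"
  unfolding normal_rank_eq[OF G]
  by (rule vec_space.rank_le_1_product_entries[of _ n m "\<lambda>a. to_fract (f a)" "\<lambda>b. to_fract (g b)"])
    (use assms in auto)

lemma det_nonzero_iff_normal_rank:
  assumes G: "G \<in> carrier_mat n n"
  shows "det G \<noteq> 0 \<longleftrightarrow> normal_rank G = n"
proof -
  have "det (map_mat to_fract G) = to_fract (det G)" by (rule to_fract_hom.hom_det)
  then show ?thesis
    using vec_space.det_rank_iff[of "map_mat to_fract G" n] G by (simp add: normal_rank_eq)
qed

lemma submatrix_map_mat: "submatrix (map_mat h G) I J = map_mat h (submatrix G I J)"
proof (rule eq_matI)
  fix i j assume "i < dim_row (map_mat h (submatrix G I J))" "j < dim_col (map_mat h (submatrix G I J))"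
  then have ij: "i < card {i. i < dim_row G \<and> i \<in> I}" "j < card {j. j < dim_col G \<and> j \<in> J}"
    by (auto simp: dim_submatrix)
  then have "pick I i < dim_row G" "pick J j < dim_col G" using pick_le by auto
  then show "submatrix (map_mat h G) I J $$ (i, j) = map_mat h (submatrix G I J) $$ (i, j)"
    using ij by (simp add: submatrix_index dim_submatrix)
qed (auto simp: dim_submatrix)

lemma minors_above_normal_rank:
  fixes G :: "'a::field poly mat"
  assumes G: "G \<in> carrier_mat n m" and x: "x \<in> minors (Suc (normal_rank G)) G"
  shows "x = 0"
proof (rule ccontr)
  assume nz: "x \<noteq> 0"
  obtain I J where IJ: "I \<subseteq> {..<n}" "J \<subseteq> {..<m}" "card J = Suc (normal_rank G)"
    and xeq: "x = det (submatrix G I J)"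
    using x G unfolding minors_def by auto
  have J: "{j. j < m \<and> j \<in> J} = J" using IJ by auto
  have "det (submatrix (map_mat to_fract G) I J) = to_fract x"
    unfolding xeq submatrix_map_mat by (rule to_fract_hom.hom_det)
  then have "card {j. j < m \<and> j \<in> J} \<le> normal_rank G"
    unfolding normal_rank_eq[OF G] using nz G by (intro vec_space.rank_gt_minor[of _ _ _ I]) auto
  then show False unfolding J IJ(3) by simp
qed

lemma normal_rank_outer_sum:
  assumes "outer_sum n k K"
  shows "normal_rank (map_mat (\<lambda>c. Polynomial.smult c q) K) \<le> k"
  using assms
proof (induction rule: outer_sum.induct)
  case zero
  have "map_mat to_fract (map_mat (\<lambda>c. Polynomial.smult c q) (0\<^sub>m n n)) = 0\<^sub>m n n" by (rule eq_matI) auto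
  then show ?case unfolding normal_rank_def using vec_space.rank_0I[of n n] by simp
next
  case (add k K u v)
  let ?s = "map_mat (\<lambda>c. Polynomial.smult c q)"
  have K: "K \<in> carrier_mat n n" by (rule outer_sum_carrier[OF add.hyps(1)])
  have uv: "u * v \<in> carrier_mat n n" using add.hyps by auto
  have "?s (K + W) = ?s K + ?s W" if "W \<in> carrier_mat n n" for W
    using K that by (intro eq_matI) (auto simp: smult_add_left)
  from this[OF uv] have "?s (K + u * v) = ?s K + ?s (u * v)" .
  moreover have "normal_rank (?s (u * v)) \<le> 1"
  proof (rule normal_rank_le_1[of _ n n "\<lambda>a. Polynomial.smult (u $$ (a, 0)) q" "\<lambda>b. [:v $$ (0, b):]"])
    fix a b assume "a < n" "b < n"
    then show "?s (u * v) $$ (a, b) = Polynomial.smult (u $$ (a, 0)) q * [:v $$ (0, b):]"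
      using add.hyps by (simp add: scalar_prod_def mult.commute)
  qed (use uv in simp)
  ultimately show ?case
    using normal_rank_add[of "?s K" n n "?s (u * v)"] K uv add.IH by simp
qed

text \<open>A discrete intermediate value principle. Falls may be of any size; a rise by at most one
  cannot jump over \<open>r\<close>.\<close>

lemma nat_seq_hits:
  fixes \<rho> :: "nat \<Rightarrow> nat"
  assumes "\<rho> 0 \<le> r" "\<And>j. j < N \<Longrightarrow> \<rho> (Suc j) \<le> Suc (\<rho> j)" "r \<le> \<rho> N"
  shows "\<exists>j\<le>N. \<rho> j = r"
  using assms
proof (induction N)
  case (Suc N)
  show ?case
  proof (cases "r \<le> \<rho> N")
    case True
    then have "\<exists>j\<le>N. \<rho> j = r" using Suc.prems by (intro Suc.IH) auto
    then show ?thesis using le_SucI by blast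
  next
    case False
    then have "\<rho> (Suc N) = r" using Suc.prems(2)[of N] Suc.prems(3) by simp
    then show ?thesis by blast
  qed
qed simp

text \<open>The witness runs from \<open>1\<close> to \<open>(1 + N) (1 + e\<^sub>0 e\<^sub>n\<^sub>-\<^sub>1\<^sup>T)\<close> with \<open>N\<close> the lower shift; subtracting \<open>1\<close> from its
  end point leaves the product of a cyclic permutation matrix and \<open>1 + e\<^sub>0 e\<^sub>n\<^sub>-\<^sub>1\<^sup>T\<close>. This works over
  every field, including the one with two elements.\<close>

lemma rank_one_path:
  assumes n: "2 \<le> n"
  shows "\<exists>R :: nat \<Rightarrow> 'a::idom mat. (\<forall>j. R j \<in> carrier_mat n n \<and> det (R j) = 1) \<and> R 0 = 1\<^sub>m n \<and>
    (\<forall>j<n. \<exists>f g. \<forall>a<n. \<forall>b<n. (R (Suc j) + - R j) $$ (a, b) = f a * g b) \<and> det (R n + - 1\<^sub>m n) \<noteq> 0"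
proof -
  \<comment> \<open>The first \<open>j\<close> subdiagonal entries are switched on, so two
    consecutive members differ in a single entry and \<open>lo (n - 1)\<close> is the full
    \<open>1 + N\<close>.\<close>
  define lo where "lo j = (mat n n (\<lambda>(a, b). if a = b then 1 else if a = Suc b \<and> b < j then 1 else 0) :: 'a mat)" for j
  define U where "U = (mat n n (\<lambda>(a, b). if a = b then 1 else if a = 0 \<and> b = n - 1 then 1 else 0) :: 'a mat)"
  define R where "R j = (if j < n then lo j else lo (n - 1) * U)" for j
  define \<sigma> where "\<sigma> b = (if b = n - 1 then 0 else Suc b)" for b
  define C where "C = (mat n n (\<lambda>(a, b). if a = \<sigma> b then 1 else 0) :: 'a mat)"
  have loc: "lo j \<in> carrier_mat n n" for j unfolding lo_def by simp
  have Uc: "U \<in> carrier_mat n n" unfolding U_def by simp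
  have Cc: "C \<in> carrier_mat n n" unfolding C_def by simp
  have det_lo: "det (lo j) = 1" for j
  proof -
    have "det (lo j) = prod_list (diag_mat (lo j))"
      by (rule det_lower_triangular[OF _ loc]) (auto simp: lo_def)
    also have "\<dots> = (\<Prod>i = 0..<n. lo j $$ (i, i))" using loc[of j] by (simp add: prod_list_diag_prod)
    also have "\<dots> = 1" by (intro prod.neutral) (auto simp: lo_def)
    finally show ?thesis .
  qed
  have "det U = prod_list (diag_mat U)"
    by (rule det_upper_triangular[OF _ Uc]) (use n in \<open>auto simp: U_def upper_triangular_def\<close>)
  also have "\<dots> = (\<Prod>i = 0..<n. U $$ (i, i))" using Uc by (simp add: prod_list_diag_prod)
  also have "\<dots> = 1" by (intro prod.neutral) (auto simp: U_def)
  finally have det_U: "det U = 1" .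
  \<comment> \<open>Right multiplication by \<open>U\<close> adds column \<open>0\<close> to the
    last column, so the last step of the path changes one column only.\<close>
  have XU: "(M * U) $$ (a, b) = M $$ (a, b) + (if b = n - 1 then M $$ (a, 0) else 0)"
    if M: "M \<in> carrier_mat n n" and ab: "a < n" "b < n" for M a b
  proof -
    have "(M * U) $$ (a, b) = (\<Sum>k = 0..<n. M $$ (a, k) * U $$ (k, b))"
      using M Uc ab by (simp add: scalar_prod_def)
    also have "\<dots> = (\<Sum>k = 0..<n. (if k = b then M $$ (a, b) else 0) +
        (if k = 0 then if b = n - 1 then M $$ (a, 0) else 0 else 0))"
      using ab n by (intro sum.cong) (auto simp: U_def)
    also have "\<dots> = M $$ (a, b) + (if b = n - 1 then M $$ (a, 0) else 0)"
      using ab by (simp add: sum.distrib)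
    finally show ?thesis .
  qed
  have "transpose_mat C * C = 1\<^sub>m n"
  proof (rule eq_matI)
    fix a b assume "a < dim_row (1\<^sub>m n :: 'a mat)" "b < dim_col (1\<^sub>m n :: 'a mat)"
    then have ab: "a < n" "b < n" by auto
    have \<sigma>: "\<sigma> a < n" "\<sigma> a = \<sigma> b \<longleftrightarrow> a = b" using ab unfolding \<sigma>_def by auto
    have "(transpose_mat C * C) $$ (a, b) = (\<Sum>k = 0..<n. C $$ (k, a) * C $$ (k, b))"
      using Cc ab by (simp add: scalar_prod_def)
    also have "\<dots> = (\<Sum>k = 0..<n. if k = \<sigma> a then (if a = b then 1 else 0) else 0)"
      using ab \<sigma>(2) by (intro sum.cong) (auto simp: C_def)
    also have "\<dots> = (1\<^sub>m n :: 'a mat) $$ (a, b)" using \<sigma>(1) ab by simp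
    finally show "(transpose_mat C * C) $$ (a, b) = (1\<^sub>m n :: 'a mat) $$ (a, b)" .
  qed (use Cc in auto)
  then have "det (transpose_mat C) * det C = 1"
    using det_mult[of "transpose_mat C" n C] Cc by simp
  then have detC: "det C \<noteq> 0" by auto
  have Rc: "R j \<in> carrier_mat n n" for j unfolding R_def using loc mult_carrier_mat[OF loc Uc] by simp
  have detR: "det (R j) = 1" for j
    unfolding R_def using det_lo det_U det_mult[OF loc Uc] by simp
  have R0: "R 0 = 1\<^sub>m n" unfolding R_def using n by (auto simp: lo_def intro!: eq_matI)
  have step: "\<exists>f g. \<forall>a<n. \<forall>b<n. (R (Suc j) + - R j) $$ (a, b) = f a * g b" if j: "j < n" for j
  proof (cases "Suc j < n")
    case True
    have "(R (Suc j) + - R j) $$ (a, b) = (if a = Suc j then 1 else 0) * (if b = j then 1 else 0)"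
      if ab: "a < n" "b < n" for a b
    proof -
      have "(R (Suc j) + - R j) $$ (a, b) = lo (Suc j) $$ (a, b) - lo j $$ (a, b)"
        unfolding R_def using True loc[of j] loc[of "Suc j"] ab by simp
      also have "\<dots> = (if a = Suc j then 1 else 0) * (if b = j then 1 else 0)"
        using ab unfolding lo_def by (auto simp: less_Suc_eq)
      finally show ?thesis .
    qed
    then show ?thesis
      by (intro exI[of _ "\<lambda>a. if a = Suc j then 1 else 0"] exI[of _ "\<lambda>b. if b = j then 1 else 0"]) simp
  next
    case False
    then have jn: "j = n - 1" using j by simp
    have "(R (Suc j) + - R j) $$ (a, b) = lo (n - 1) $$ (a, 0) * (if b = n - 1 then 1 else 0)"
      if ab: "a < n" "b < n" for a b
    proof -
      have "(R (Suc j) + - R j) $$ (a, b) = (lo (n - 1) * U) $$ (a, b) - lo (n - 1) $$ (a, b)"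
        unfolding R_def using False j jn loc[of "n - 1"] Uc ab by (simp del: index_mult_mat(1))
      then show ?thesis unfolding XU[OF loc ab] by simp
    qed
    then show ?thesis by (intro exI[of _ "\<lambda>a. lo (n - 1) $$ (a, 0)"] exI[of _ "\<lambda>b. if b = n - 1 then 1 else 0"]) simp
  qed
  \<comment> \<open>With \<open>E = e_0 e_(n-1)^T\<close> one has \<open>C = N + E\<close>, and
    \<open>E E = 0\<close> because \<open>n\<close> is at least \<open>2\<close>; hence
    \<open>(1 + N) (1 + E) - 1 = (N + E) (1 + E)\<close>.\<close>
  have "R n + - 1\<^sub>m n = C * U"
  proof (rule eq_matI)
    fix a b assume "a < dim_row (C * U)" "b < dim_col (C * U)"
    then have ab: "a < n" "b < n" using Cc Uc by auto
    have "(R n + - 1\<^sub>m n) $$ (a, b) = (lo (n - 1) * U) $$ (a, b) - (if a = b then 1 else 0)"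
      unfolding R_def using ab loc[of "n - 1"] Uc by (simp del: index_mult_mat(1))
    also have "\<dots> = (C * U) $$ (a, b)"
      unfolding XU[OF loc ab] XU[OF Cc ab] using ab n unfolding lo_def C_def \<sigma>_def by auto
    finally show "(R n + - 1\<^sub>m n) $$ (a, b) = (C * U) $$ (a, b)" .
  qed (use Cc Uc in auto)
  then have last: "det (R n + - 1\<^sub>m n) \<noteq> 0" using det_mult[OF Cc Uc] detC det_U by simp
  show ?thesis by (intro exI[of _ R] conjI allI impI Rc detR R0 step last)
qed

text \<open>The hypothesis \<open>nz\<close> isolates what has to be known about the pencils,
  nonsingularity at the end of the path. It is verified in
  \<open>low_rank_det_assignment_iff\<close> at the point sent to infinity.\<close>

lemma exact_normal_rank:
  fixes A B :: "'a::field poly mat"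
  assumes n: "2 \<le> n" and A: "A \<in> carrier_mat n n" and B: "B \<in> carrier_mat n n"
    and le: "normal_rank (B + - A) \<le> r" and r: "r \<le> n"
    and nz: "\<And>R. R \<in> carrier_mat n n \<Longrightarrow> det (R + - 1\<^sub>m n) \<noteq> 0 \<Longrightarrow> det (const_mat R * B + - A) \<noteq> 0"
  shows "\<exists>R\<in>carrier_mat n n. det R = 1 \<and> normal_rank (const_mat R * B + - A) = r"
proof -
  obtain R :: "nat \<Rightarrow> 'a mat" where R: "\<And>j. R j \<in> carrier_mat n n" "\<And>j. det (R j) = 1" and R0: "R 0 = 1\<^sub>m n"
    and step: "\<And>j. j < n \<Longrightarrow> \<exists>f g. \<forall>a<n. \<forall>b<n. (R (Suc j) + - R j) $$ (a, b) = f a * g b"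
    and last: "det (R n + - 1\<^sub>m n) \<noteq> 0"
    using rank_one_path[OF n, where 'a = 'a] by (elim exE conjE) (rule that; simp)
  define P where "P j = const_mat (R j) * B + - A" for j
  have cR: "const_mat (R j) \<in> carrier_mat n n" for j using R by simp
  have Pc: "P j \<in> carrier_mat n n" for j unfolding P_def using R B A by auto
  have "const_mat (1\<^sub>m n :: 'a mat) = 1\<^sub>m n" by (rule const_poly_hom.mat_hom_one)
  then have 0: "normal_rank (P 0) \<le> r" unfolding P_def R0 using le B by simp
  have "normal_rank (P (Suc j)) \<le> Suc (normal_rank (P j))" if j: "j < n" for j
  proof -
    \<comment> \<open>The step from \<open>P j\<close> to \<open>P (Suc j)\<close> adds
      \<open>F B\<close>, a constant column times a polynomial row.\<close>
    define F where "F = R (Suc j) + - R j"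
    have Fc: "F \<in> carrier_mat n n" unfolding F_def using R by simp
    obtain f g where fg: "\<And>a b. a < n \<Longrightarrow> b < n \<Longrightarrow> F $$ (a, b) = f a * g b"
      using step[OF j] unfolding F_def by blast
    define E where "E = const_mat F"
    have Ec: "E \<in> carrier_mat n n" unfolding E_def using Fc by simp
    have Rs: "const_mat (R (Suc j)) = E + const_mat (R j)"
      unfolding E_def F_def using R(1)[of j] R(1)[of "Suc j"] by (intro eq_matI) auto
    have EB: "E * B \<in> carrier_mat n n" using Ec B by simp
    have "P (Suc j) = E * B + P j"
      unfolding P_def Rs using add_mult_distrib_mat[OF Ec cR B, of j] EB cR[of j] B A
      by (simp add: assoc_add_mat[of _ n n])
    moreover have "normal_rank (E * B) \<le> 1"
    proof (rule normal_rank_le_1[OF EB])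
      fix a b assume ab: "a < n" "b < n"
      have "(E * B) $$ (a, b) = (\<Sum>k = 0..<n. E $$ (a, k) * B $$ (k, b))"
        using Ec B ab by (simp add: scalar_prod_def)
      also have "\<dots> = (\<Sum>k = 0..<n. [:f a:] * ([:g k:] * B $$ (k, b)))"
        using fg[OF ab(1)] Fc ab unfolding E_def by (intro sum.cong) (auto simp: mult.commute)
      also have "\<dots> = [:f a:] * (\<Sum>k = 0..<n. [:g k:] * B $$ (k, b))" by (simp only: sum_distrib_left)
      finally show "(E * B) $$ (a, b) = [:f a:] * (\<Sum>k = 0..<n. [:g k:] * B $$ (k, b))" .
    qed
    ultimately show ?thesis using normal_rank_add[OF EB Pc, of j] by simp
  qed
  moreover have "normal_rank (P n) = n"
    using nz[OF R(1) last] det_nonzero_iff_normal_rank[OF Pc] unfolding P_def by simp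
  ultimately obtain j where "normal_rank (P j) = r"
    using nat_seq_hits[of "\<lambda>j. normal_rank (P j)" r n] 0 r by auto
  then show ?thesis using R unfolding P_def by blast
qed

section \<open>Homogeneous pencils\<close>

text \<open>The entry map of \<open>hom_pencil\<close>, separated because it is linear over
  \<open>F\<close>. The form \<open>L\<close> of a dehomogenization is also written
  \<open>hom_linear q\<close>, so \<open>q\<close> times a constant matrix is a pencil that \<eta>
  sends back to the constant matrix.\<close>

definition hom_linear :: "'a::comm_ring_1 poly \<Rightarrow> 'a poly poly" where
  "hom_linear p = [: [:0, Polynomial.coeff p 0:], [:Polynomial.coeff p 1:] :]"

lemma hom_pencil_eq: "hom_pencil G = map_mat hom_linear G"
  unfolding hom_pencil_def hom_linear_def ..

lemma hom_linear_0: "hom_linear 0 = 0"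
  unfolding hom_linear_def by simp

lemma hom_linear_add: "hom_linear (p + q) = hom_linear p + hom_linear q"
  unfolding hom_linear_def by simp

lemma hom_linear_sum: "hom_linear (sum f A) = (\<Sum>x\<in>A. hom_linear (f x))"
  by (induction A rule: infinite_finite_induct) (auto simp: hom_linear_0 hom_linear_add)

lemma hom_linear_smult: "hom_linear (Polynomial.smult c p) = [:[:c:]:] * hom_linear p"
  unfolding hom_linear_def by simp

lemma homogeneous_hom_linear: "homogeneous 1 (hom_linear p)"
  unfolding hom_linear_def by (rule homogeneous_linear)

lemma ev2h_hom_linear:
  "ev2h \<alpha> \<beta> (hom_linear p) = Polynomial.smult (Polynomial.coeff p 0) \<beta> + Polynomial.smult (Polynomial.coeff p 1) \<alpha>"
proof -
  interpret comm_ring_hom "ev2h \<alpha> \<beta>" by (rule ev2h_comm_ring_hom)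
  have "hom_linear p = Polynomial.monom (Polynomial.monom (Polynomial.coeff p 0) 1) 0 +
    Polynomial.monom (Polynomial.monom (Polynomial.coeff p 1) 0) 1"
    unfolding hom_linear_def by (simp add: monom_0 monom_Suc)
  then show ?thesis by (simp only: hom_add ev2h_monom) simp
qed

lemma linear_poly_eq:
  assumes "Polynomial.degree p \<le> 1"
  shows "[:Polynomial.coeff p 0, Polynomial.coeff p 1:] = p"
proof (rule poly_eqI)
  fix k :: nat
  consider "k = 0" | "k = 1" | "1 < k" by linarith
  then show "Polynomial.coeff [:Polynomial.coeff p 0, Polynomial.coeff p 1:] k = Polynomial.coeff p k"
    by cases (use assms in \<open>auto simp: coeff_pCons coeff_eq_0 split: nat.splits\<close>)
qed

lemma ev2h_inf_hom_linear:
  assumes "Polynomial.degree p \<le> 1"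
  shows "ev2h [:0, 1:] 1 (hom_linear p) = p"
proof -
  have "ev2h [:0, 1:] 1 (hom_linear p) = [:Polynomial.coeff p 0, Polynomial.coeff p 1:]"
    unfolding ev2h_hom_linear by simp
  then show ?thesis using linear_poly_eq[OF assms] by simp
qed

lemma is_pencil_carrier: "is_pencil m n G \<Longrightarrow> G \<in> carrier_mat m n"
  unfolding is_pencil_def by simp

lemma hom_pencil_carrier: "G \<in> carrier_mat m n \<Longrightarrow> hom_pencil G \<in> carrier_mat m n"
  unfolding hom_pencil_eq by simp

lemma homogeneous_det_hom_pencil:
  "G \<in> carrier_mat n n \<Longrightarrow> homogeneous n (det (hom_pencil G))"
  unfolding hom_pencil_eq by (intro homogeneous_det) (auto intro: homogeneous_hom_linear[unfolded One_nat_def])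

lemma homogeneous_minors:
  assumes "x \<in> minors k (hom_pencil G)"
  shows "homogeneous k x"
proof -
  obtain I J where IJ: "I \<subseteq> {..<dim_row G}" "J \<subseteq> {..<dim_col G}" "card I = k" "card J = k"
    and x: "x = det (submatrix (map_mat hom_linear G) I J)"
    using assms unfolding minors_def hom_pencil_eq by auto
  have "{i. i < dim_row G \<and> i \<in> I} = I" "{j. j < dim_col G \<and> j \<in> J} = J" using IJ by auto
  then have "submatrix G I J \<in> carrier_mat k k" using IJ by (intro carrier_matI) (simp_all add: dim_submatrix)
  then show ?thesis unfolding x submatrix_map_mat
    by (intro homogeneous_det) (auto intro: homogeneous_hom_linear[unfolded One_nat_def])
qed

lemma (in comm_ring_hom) minors_map_mat: "minors k (map_mat hom G) = hom ` minors k G"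
proof -
  have "det (submatrix (map_mat hom G) I J) = hom (det (submatrix G I J))" for I J
    unfolding submatrix_map_mat by (rule hom_det)
  then show ?thesis unfolding minors_def by auto
qed

lemma map_hom_pencil_inf:
  assumes "is_pencil m n G"
  shows "map_mat (ev2h [:0, 1:] 1) (hom_pencil G) = G"
  using assms unfolding hom_pencil_eq is_pencil_def by (intro eq_matI) (auto simp: ev2h_inf_hom_linear[simplified])

lemma det_hom_pencil_eq_0_iff:
  fixes G :: "'a::field poly mat"
  assumes "is_pencil n n G"
  shows "det (hom_pencil G) = 0 \<longleftrightarrow> det G = 0"
proof -
  have "det G = ev2h [:0, 1:] 1 (det (hom_pencil G))"
    using dehom_inf.hom_det[of "hom_pencil G"] unfolding map_hom_pencil_inf[OF assms] by simp
  then show ?thesis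
    using dehom_inf.eta_inj[OF homogeneous_det_hom_pencil[OF is_pencil_carrier[OF assms]]]
      dehom_inf.hom_zero by auto
qed

text \<open>Setting \<open>t = 1\<close> sends minors of \<open>hom_pencil P\<close> to minors of
  \<open>P\<close>, and it is injective on polynomials homogeneous of a fixed degree.\<close>

lemma minors_hom_pencil_above_rank:
  fixes P :: "'a::field poly mat"
  assumes P: "is_pencil m n P" and x: "x \<in> minors (Suc (normal_rank P)) (hom_pencil P)"
  shows "x = 0"
proof -
  have "ev2h [:0, 1:] 1 x \<in> minors (Suc (normal_rank P)) (map_mat (ev2h [:0, 1:] 1) (hom_pencil P))"
    unfolding dehom_inf.minors_map_mat using x by blast
  then have "ev2h [:0, 1:] 1 x = 0"
    unfolding map_hom_pencil_inf[OF P] by (rule minors_above_normal_rank[OF is_pencil_carrier[OF P]])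
  then show ?thesis by (rule dehom_inf.eta_inj[OF homogeneous_minors[OF x]])
qed

lemma hom_pencil_add:
  "G \<in> carrier_mat m n \<Longrightarrow> H \<in> carrier_mat m n \<Longrightarrow> hom_pencil (G + H) = hom_pencil G + hom_pencil H"
  unfolding hom_pencil_eq by (intro eq_matI) (auto simp: hom_linear_add)

lemma hom_pencil_const_mult:
  assumes R: "R \<in> carrier_mat n n" and B: "B \<in> carrier_mat n n"
  shows "hom_pencil (const_mat R * B) = map_mat (\<lambda>c. [:[:c:]:]) R * hom_pencil B"
proof (rule eq_matI)
  fix i j assume "i < dim_row (map_mat (\<lambda>c. [:[:c:]:]) R * hom_pencil B)"
    "j < dim_col (map_mat (\<lambda>c. [:[:c:]:]) R * hom_pencil B)"
  then have ij: "i < n" "j < n" using R B by (auto simp: hom_pencil_eq)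
  have "(const_mat R * B) $$ (i, j) = (\<Sum>k = 0..<n. Polynomial.smult (R $$ (i, k)) (B $$ (k, j)))"
    using R B ij by (simp add: scalar_prod_def)
  then have "hom_pencil (const_mat R * B) $$ (i, j) = (\<Sum>k = 0..<n. [:[:R $$ (i, k):]:] * hom_linear (B $$ (k, j)))"
    unfolding hom_pencil_eq using R B ij by (simp add: hom_linear_sum hom_linear_smult)
  also have "\<dots> = (map_mat (\<lambda>c. [:[:c:]:]) R * hom_pencil B) $$ (i, j)"
    unfolding hom_pencil_eq using R B ij by (simp add: scalar_prod_def)
  finally show "hom_pencil (const_mat R * B) $$ (i, j) = (map_mat (\<lambda>c. [:[:c:]:]) R * hom_pencil B) $$ (i, j)" .
qed (use R B in \<open>auto simp: hom_pencil_eq\<close>)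

interpretation const2_hom: comm_ring_hom "\<lambda>c::'a::comm_ring_1. [:[:c:]:]"
  by unfold_locales simp_all

text \<open>\<open>N X + N0 = N (X - T)\<close> with \<open>T = - N^(-1) N0\<close>, the inverse
  being written through the adjugate.\<close>

lemma pencil_decomposition:
  fixes G :: "'a::field poly mat"
  assumes G: "is_pencil n n G" and nz: "det (map_mat (\<lambda>p. Polynomial.coeff p 1) G) \<noteq> 0"
  obtains T where "T \<in> carrier_mat n n"
    and "G = const_mat (map_mat (\<lambda>p. Polynomial.coeff p 1) G) * char_poly_matrix T"
proof -
  let ?N = "map_mat (\<lambda>p. Polynomial.coeff p 1) G"
  define N0 where "N0 = map_mat (\<lambda>p. Polynomial.coeff p 0) G"
  have Gc: "G \<in> carrier_mat n n" using G by (rule is_pencil_carrier)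
  have N: "?N \<in> carrier_mat n n" and N0: "N0 \<in> carrier_mat n n" unfolding N0_def using Gc by auto
  define B where "B = inverse (det ?N) \<cdot>\<^sub>m adj_mat ?N"
  note adj = adj_mat[OF N]
  have Bc: "B \<in> carrier_mat n n" unfolding B_def using adj(1) by simp
  have NB: "?N * B = 1\<^sub>m n"
    unfolding B_def mult_smult_distrib[OF N adj(1)] adj(2) using nz by (intro eq_matI) auto
  define T where "T = - (B * N0)"
  have BN0: "B * N0 \<in> carrier_mat n n" using Bc N0 by simp
  have T: "T \<in> carrier_mat n n" unfolding T_def using BN0 by simp
  have cN: "const_mat ?N \<in> carrier_mat n n" using N by simp
  have "char_poly_matrix T = [:0, 1:] \<cdot>\<^sub>m 1\<^sub>m n + const_mat (B * N0)"
    unfolding T_def char_poly_matrix_def using BN0 by (intro eq_matI) (auto simp del: index_mult_mat(1))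
  then have "const_mat ?N * char_poly_matrix T =
      const_mat ?N * ([:0, 1:] \<cdot>\<^sub>m 1\<^sub>m n) + const_mat ?N * const_mat (B * N0)"
    using cN BN0 by (simp add: mult_add_distrib_mat[of _ n n _ n])
  also have "const_mat ?N * ([:0, 1:] \<cdot>\<^sub>m 1\<^sub>m n) = [:0, 1:] \<cdot>\<^sub>m const_mat ?N"
    using cN by (simp add: mult_smult_distrib[of _ n n _ n])
  also have "const_mat ?N * const_mat (B * N0) = const_mat (?N * (B * N0))"
    by (rule const_mat_mult[symmetric, OF N BN0])
  also have "?N * (B * N0) = N0"
    using assoc_mult_mat[OF N Bc N0] N0 unfolding NB by simp
  also have "[:0, 1:] \<cdot>\<^sub>m const_mat ?N + const_mat N0 = G"
  proof (rule eq_matI)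
    fix i j assume ij: "i < dim_row G" "j < dim_col G"
    have "Polynomial.degree (G $$ (i, j)) \<le> 1" using G ij Gc unfolding is_pencil_def by simp
    from linear_poly_eq[OF this]
    show "([:0, 1:] \<cdot>\<^sub>m const_mat ?N + const_mat N0) $$ (i, j) = G $$ (i, j)"
      unfolding N0_def using ij by simp
  qed (use Gc N0 in auto)
  finally show thesis using that T by simp
qed

lemma det_pencil_top_coeff:
  fixes G :: "'a::field poly mat"
  assumes G: "is_pencil n n G" and nz: "det (map_mat (\<lambda>p. Polynomial.coeff p 1) G) \<noteq> 0"
  shows "Polynomial.coeff (det G) n = det (map_mat (\<lambda>p. Polynomial.coeff p 1) G)"
proof -
  let ?N = "map_mat (\<lambda>p. Polynomial.coeff p 1) G"
  obtain T where T: "T \<in> carrier_mat n n" and eq: "G = const_mat ?N * char_poly_matrix T"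
    using pencil_decomposition[OF assms] .
  have N: "?N \<in> carrier_mat n n" using is_pencil_carrier[OF G] by simp
  have "det G = det (const_mat ?N) * char_poly T"
    unfolding char_poly_def using T N by (subst eq, intro det_mult[of _ n]) auto
  also have "det (const_mat ?N) = [:det ?N:]" by (rule const_poly_hom.hom_det)
  finally show ?thesis using degree_monic_char_poly[OF T] by simp
qed

lemma outer_sum_mult:
  assumes "outer_sum n k K" and B: "B \<in> carrier_mat n n"
  shows "outer_sum n k (B * K)"
  using assms(1)
proof (induction rule: outer_sum.induct)
  case zero
  have "B * 0\<^sub>m n n = 0\<^sub>m n n" using B by simp
  then show ?case using outer_sum.zero by metis
next
  case (add k K u v)
  have K: "K \<in> carrier_mat n n" by (rule outer_sum_carrier[OF add.hyps(1)])
  have "B * (K + u * v) = B * K + (B * u) * v"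
    using B K add.hyps by (simp add: mult_add_distrib_mat[of _ n n _ n] assoc_mult_mat[of _ n n _ 1 _ n])
  moreover have "B * u \<in> carrier_mat n 1" using B add.hyps by simp
  ultimately show ?case using outer_sum.add[OF add.IH _ add.hyps(3)] by simp
qed

section \<open>Determinantal divisors and realization of the determinant\<close>

context dehomogenization
begin

text \<open>Shows that the definite description in \<open>det_divisor\<close> denotes:
  \<open>homogeneous_gcd\<close> applies with the full determinant as \<open>D\<close>, whose image
  has degree \<open>n\<close> by \<open>nz\<close>. For \<open>k = 0\<close> the only minor is the
  empty one, \<open>1\<close>.\<close>

lemma det_divisor_gcd:
  assumes A: "is_pencil n n A" and nz: "Polynomial.coeff (\<eta> (det (hom_pencil A))) n \<noteq> 0" and k: "k \<le> n"
  shows "is_gcd_of (det_divisor A k) (minors k (hom_pencil A))"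
proof (cases "k = 0")
  case True
  have "det (1\<^sub>m 0) \<in> minors 0 (hom_pencil A)"
    by (rule strict_mono_minor_in_minors[of _ id _ id]) (auto simp: strict_mono_on_def)
  then have "1 \<in> minors 0 (hom_pencil A)" by simp
  then show ?thesis unfolding det_divisor_def is_gcd_of_def using True by auto
next
  case False
  have Ac: "hom_pencil A \<in> carrier_mat n n" using hom_pencil_carrier[OF is_pencil_carrier[OF A]] .
  have "\<exists>!d. is_gcd_of d (minors k (hom_pencil A)) \<and> (\<exists>m. homogeneous m d) \<and> monic_wrt_s d"
  proof (rule homogeneous_gcd[OF _ homogeneous_det_hom_pencil[OF is_pencil_carrier[OF A]] nz])
    fix x assume "x \<in> minors k (hom_pencil A)"
    then show "\<exists>m. homogeneous m x" using homogeneous_minors by blast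
  next
    fix c assume "\<forall>x\<in>minors k (hom_pencil A). c dvd x"
    then show "c dvd det (hom_pencil A)"
      using minors_dvd_minors[of k "hom_pencil A" c n "det (hom_pencil A)"] k minors_full[OF Ac] by simp
  qed
  from theI'[OF this] show ?thesis unfolding det_divisor_def using False by simp
qed

text \<open>Telescoping; every division is exact because larger minors are divisible by the gcd of
  smaller ones.\<close>

lemma prod_hom_inv_factor:
  assumes A: "is_pencil n n A" and nz: "Polynomial.coeff (\<eta> (det (hom_pencil A))) n \<noteq> 0" and m: "m \<le> n"
  shows "(\<Prod>i=1..m. hom_inv_factor A i) = det_divisor A m"
  using m
proof (induction m)
  case 0
  show ?case by (simp add: det_divisor_def)
next
  case (Suc m)
  have g: "is_gcd_of (det_divisor A m) (minors m (hom_pencil A))"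
    "is_gcd_of (det_divisor A (Suc m)) (minors (Suc m) (hom_pencil A))"
    using det_divisor_gcd[OF A nz] Suc.prems by auto
  have "det_divisor A m dvd x" if "x \<in> minors (Suc m) (hom_pencil A)" for x
    using minors_dvd_minors[of m "hom_pencil A" "det_divisor A m" "Suc m" x] g(1) that
    unfolding is_gcd_of_def by simp
  then have "det_divisor A m dvd det_divisor A (Suc m)" using g(2) unfolding is_gcd_of_def by blast
  then have "det_divisor A m * (det_divisor A (Suc m) div det_divisor A m) = det_divisor A (Suc m)"
    by (rule dvd_mult_div_cancel)
  then show ?case using Suc by (simp add: hom_inv_factor_def)
qed

lemma is_pencil_map_eta:
  assumes "G \<in> carrier_mat n n"
  shows "is_pencil n n (map_mat \<eta> (hom_pencil G))"
  using assms degree_eta[OF homogeneous_hom_linear, unfolded One_nat_def] unfolding is_pencil_def hom_pencil_eq by auto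

text \<open>Under \<eta> the pencil \<open>A\<close> becomes \<open>N (X - T)\<close> and
  \<open>q W\<close> becomes the constant \<open>W\<close>. Choosing \<open>W = - N K\<close> turns
  the sum into \<open>N (X - (T + K))\<close>, so the rank one terms found for \<open>K\<close>
  carry over.\<close>

lemma det_realization:
  assumes A: "is_pencil n n A" and q: "L = hom_linear q"
    and A1: "det (map_mat (\<lambda>p. Polynomial.coeff p 1) (map_mat \<eta> (hom_pencil A))) \<noteq> 0"
    and \<Psi>: "homogeneous n \<Psi>" "Polynomial.coeff (\<eta> \<Psi>) n \<noteq> 0" and r: "r \<le> n"
    and gcd: "\<And>c. (\<forall>x\<in>minors (n - r) (hom_pencil A). c dvd x) \<Longrightarrow> c dvd \<Psi>"
  obtains K k where "outer_sum n r K" and "k \<noteq> 0"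
    and "det (hom_pencil (A + map_mat (\<lambda>c. Polynomial.smult c q) K)) = Polynomial.smult [:k:] \<Psi>"
proof -
  let ?A = "map_mat \<eta> (hom_pencil A)"
  let ?N = "map_mat (\<lambda>p. Polynomial.coeff p 1) ?A"
  have Ac: "A \<in> carrier_mat n n" using A by (rule is_pencil_carrier)
  have pA: "is_pencil n n ?A" by (rule is_pencil_map_eta[OF Ac])
  have N: "?N \<in> carrier_mat n n" using is_pencil_carrier[OF pA] by simp
  have cN: "const_mat ?N \<in> carrier_mat n n" using N by simp
  obtain T where T: "T \<in> carrier_mat n n" and Aeq: "?A = const_mat ?N * char_poly_matrix T"
    using pencil_decomposition[OF pA A1] .
  have Mc: "char_poly_matrix T \<in> carrier_mat n n" using T by simp
  obtain D where D: "mat_equivalent n (char_poly_matrix T) D"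
    and diag: "\<forall>i<n. \<forall>j<n. i \<noteq> j \<longrightarrow> D $$ (i, j) = 0"
    and chain: "\<forall>i j. i \<le> j \<longrightarrow> j < n \<longrightarrow> D $$ (i, i) dvd D $$ (j, j)"
    using smith_normal_form[OF Mc] by (elim exE conjE) (rule that; assumption)
  define \<delta> where "\<delta> = (\<Prod>i<n - r. D $$ (i, i))"
  obtain P Q where P: "P \<in> carrier_mat n n" and Q: "Q \<in> carrier_mat n n" and Dc: "D \<in> carrier_mat n n"
    and Meq: "char_poly_matrix T = P * D * Q"
    using D unfolding mat_equivalent_def unimodular_def by blast
  \<comment> \<open>Divisibility of minors passes from the Smith form to \<open>?A\<close> through
    the factors \<open>P\<close>, \<open>Q\<close> and \<open>N\<close>.\<close>
  have "dvd_fminors \<delta> (n - r) D"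
    unfolding \<delta>_def by (rule dvd_fminors_diagonal[OF Dc]) (use diag chain in simp_all)
  then have "dvd_fminors \<delta> (n - r) (P * D)" by (rule dvd_fminors_mult_left[OF Dc P])
  then have "dvd_fminors \<delta> (n - r) (P * D * Q)" by (rule dvd_fminors_mult_right[OF mult_carrier_mat[OF P Dc] Q])
  then have "dvd_fminors \<delta> (n - r) (const_mat ?N * char_poly_matrix T)"
    unfolding Meq[symmetric] by (rule dvd_fminors_mult_left[OF Mc cN])
  then have fm: "dvd_fminors \<delta> (n - r) ?A" unfolding Aeq[symmetric] .
  \<comment> \<open>Homogenized in its own degree, \<delta> has an image of full degree, so its
    divisibility can be pulled back to \<open>F[s,t]\<close>, where the hypothesis
    \<open>gcd\<close> applies.\<close>
  obtain \<delta>' where \<delta>': "homogeneous (Polynomial.degree \<delta>) \<delta>'" "\<eta> \<delta>' = \<delta>" using homogenize[OF order_refl] .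
  have "\<delta>' dvd \<Psi>"
  proof (rule gcd, rule ballI)
    fix x assume x: "x \<in> minors (n - r) (hom_pencil A)"
    have "\<eta> x \<in> minors (n - r) ?A" unfolding minors_map_mat using x by blast
    then have "\<eta> \<delta>' dvd \<eta> x" unfolding \<delta>'(2) by (rule dvd_fminors_imp_dvd_minors[OF fm])
    then show "\<delta>' dvd x" using \<delta>' by (intro eta_dvd_imp_dvd[OF \<delta>'(1) _ homogeneous_minors[OF x]]) simp_all
  qed
  then obtain y where "\<Psi> = \<delta>' * y" by (rule dvdE)
  then have \<delta>\<Psi>: "\<delta> dvd \<eta> \<Psi>" using \<delta>'(2) by (simp add: hom_mult)
  define c where "c = Polynomial.coeff (\<eta> \<Psi>) n"
  have c0: "c \<noteq> 0" unfolding c_def by (rule \<Psi>(2))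
  have deg\<Psi>: "Polynomial.degree (\<eta> \<Psi>) = n"
    using degree_eta[OF \<Psi>(1)] le_degree[OF \<Psi>(2)] by simp
  \<comment> \<open>Characteristic polynomials are monic; the scalar \<open>c\<close> divided out
    here and the factor \<open>det N\<close> reappear as \<open>k = det N / c\<close>.\<close>
  define p where "p = Polynomial.smult (inverse c) (\<eta> \<Psi>)"
  have p: "Polynomial.degree p = n" "Polynomial.lead_coeff p = 1"
    unfolding p_def using deg\<Psi> c0 c_def by simp_all
  have "\<delta> dvd p" unfolding p_def using \<delta>\<Psi> by (rule dvd_smult)
  then obtain K where K: "outer_sum n r K" and det: "det (char_poly_matrix (T + K)) = p"
    using char_poly_low_rank_perturbation[OF T r D _ p] diag unfolding \<delta>_def by blast
  have Kc: "K \<in> carrier_mat n n" by (rule outer_sum_carrier[OF K])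
  define W where "W = - ?N * K"
  have W: "outer_sum n r W" unfolding W_def by (rule outer_sum_mult[OF K]) (use N in simp)
  have Wc: "W \<in> carrier_mat n n" by (rule outer_sum_carrier[OF W])
  let ?C = "A + map_mat (\<lambda>c. Polynomial.smult c q) W"
  have Cc: "?C \<in> carrier_mat n n" using Ac Wc by simp
  have "map_mat \<eta> (hom_pencil ?C) = ?A + const_mat W"
    unfolding hom_pencil_eq using Ac Wc
    by (intro eq_matI) (auto simp: hom_linear_add hom_linear_smult hom_add hom_mult eta_const q[symmetric] eta_L
        simp del: mult_pCons_left)
  also have "\<dots> = const_mat ?N * char_poly_matrix (T + K)"
  proof -
    have NK: "?N * K \<in> carrier_mat n n" using N Kc by simp
    have "const_mat W = - const_mat (?N * K)"
      unfolding W_def uminus_mult_left_mat[OF _] using NK N Kc by (intro eq_matI) (auto simp del: index_mult_mat(1))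
    also have "const_mat (?N * K) = const_mat ?N * const_mat K" by (rule const_mat_mult[OF N Kc])
    finally have "const_mat W = const_mat ?N * (- const_mat K)" using cN Kc by simp
    then show ?thesis
      unfolding char_poly_matrix_add[OF T Kc] using cN Mc Kc
      by (subst Aeq) (simp add: mult_add_distrib_mat[of _ n n _ n])
  qed
  finally have "\<eta> (det (hom_pencil ?C)) = det (const_mat ?N * char_poly_matrix (T + K))"
    using hom_det[of "hom_pencil ?C"] by simp
  also have "\<dots> = det (const_mat ?N) * p"
    unfolding det[symmetric] using cN T Kc by (intro det_mult[of _ n]) auto
  also have "det (const_mat ?N) = [:det ?N:]" by (rule const_poly_hom.hom_det)
  also have "[:det ?N:] * p = \<eta> ([:[:det ?N * inverse c:]:] * \<Psi>)"
    unfolding hom_mult eta_const p_def by (simp add: mult.commute)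
  finally have "det (hom_pencil ?C) = [:[:det ?N * inverse c:]:] * \<Psi>"
    by (intro eta_eq_imp_eq[OF homogeneous_det_hom_pencil[OF Cc] homogeneous_const_mult[OF \<Psi>(1)]])
  then have "det (hom_pencil ?C) = Polynomial.smult [:det ?N * inverse c:] \<Psi>" by simp
  moreover have "det ?N * inverse c \<noteq> 0" using A1 c0 by simp
  ultimately show thesis using that[OF W] by blast
qed

theorem low_rank_det_assignment_iff:
  assumes n: "2 \<le> n" and A: "is_pencil n n A" and q: "L = hom_linear q" "Polynomial.degree q \<le> 1"
    and A1: "det (map_mat (\<lambda>p. Polynomial.coeff p 1) (map_mat \<eta> (hom_pencil A))) \<noteq> 0"
    and \<Psi>: "homogeneous n \<Psi>" "Polynomial.coeff (\<eta> \<Psi>) n \<noteq> 0" and r: "r \<le> n"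
  shows "(\<exists>P. is_pencil n n P \<and> normal_rank P = r \<and>
            (\<exists>k. k \<noteq> 0 \<and> det (hom_pencil (A + P)) = Polynomial.smult [:k:] \<Psi>))
         \<longleftrightarrow> (\<Prod>i=1..n - r. hom_inv_factor A i) dvd \<Psi>"
proof -
  let ?\<Delta> = "det_divisor A (n - r)"
  have Ac: "A \<in> carrier_mat n n" using A by (rule is_pencil_carrier)
  have hA: "hom_pencil A \<in> carrier_mat n n" by (rule hom_pencil_carrier[OF Ac])
  have nz: "Polynomial.coeff (\<eta> (det (hom_pencil A))) n \<noteq> 0"
    using det_pencil_top_coeff[OF is_pencil_map_eta[OF Ac] A1] A1 by (simp add: hom_det)
  have gcd: "is_gcd_of ?\<Delta> (minors (n - r) (hom_pencil A))"
    by (rule det_divisor_gcd[OF A nz]) simp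
  have prod: "(\<Prod>i=1..n - r. hom_inv_factor A i) = ?\<Delta>" by (rule prod_hom_inv_factor[OF A nz]) simp
  have nec: "?\<Delta> dvd \<Psi>"
    if P: "is_pencil n n P" "normal_rank P = r" and k: "k \<noteq> 0"
      and det: "det (hom_pencil (A + P)) = Polynomial.smult [:k:] \<Psi>" for P k
  proof -
    have Pc: "P \<in> carrier_mat n n" using P(1) by (rule is_pencil_carrier)
    have "?\<Delta> dvd det (hom_pencil A + hom_pencil P)"
    proof (rule det_add_dvd[OF hA hom_pencil_carrier[OF Pc] _ _ r])
      show "?\<Delta> dvd x" if "x \<in> minors (n - r) (hom_pencil A)" for x
        using gcd that unfolding is_gcd_of_def by blast
      show "x = 0" if "x \<in> minors (Suc r) (hom_pencil P)" for x
        using minors_hom_pencil_above_rank[OF P(1)] that unfolding P(2) by blast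
    qed
    then have "?\<Delta> dvd Polynomial.smult [:k:] \<Psi>" unfolding hom_pencil_add[OF Ac Pc, symmetric] det .
    then have "?\<Delta> dvd Polynomial.smult [:inverse k:] (Polynomial.smult [:k:] \<Psi>)" by (rule dvd_smult)
    then show ?thesis using k by simp
  qed
  have suf: "\<exists>P. is_pencil n n P \<and> normal_rank P = r \<and>
            (\<exists>k. k \<noteq> 0 \<and> det (hom_pencil (A + P)) = Polynomial.smult [:k:] \<Psi>)" if dvd: "?\<Delta> dvd \<Psi>"
  proof -
    have "c dvd \<Psi>" if "\<forall>x\<in>minors (n - r) (hom_pencil A). c dvd x" for c
      using gcd that dvd unfolding is_gcd_of_def by (meson dvd_trans)
    then obtain K k where K: "outer_sum n r K" and k: "k \<noteq> 0"
      and det: "det (hom_pencil (A + map_mat (\<lambda>c. Polynomial.smult c q) K)) = Polynomial.smult [:k:] \<Psi>"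
      using det_realization[OF A q(1) A1 \<Psi> r] by metis
    let ?K = "map_mat (\<lambda>c. Polynomial.smult c q) K"
    have Kc: "K \<in> carrier_mat n n" by (rule outer_sum_carrier[OF K])
    have qK: "?K \<in> carrier_mat n n" using Kc by simp
    define B where "B = A + ?K"
    have Bc: "B \<in> carrier_mat n n" unfolding B_def using Ac qK by simp
    have pB: "is_pencil n n B"
      using A Kc q(2) unfolding B_def is_pencil_def
      by (auto intro!: degree_add_le intro: order_trans[OF degree_smult_le])
    have cRB: "const_mat R * B \<in> carrier_mat n n" if "R \<in> carrier_mat n n" for R using that Bc by simp
    have pRB: "is_pencil n n (const_mat R * B)" if R: "R \<in> carrier_mat n n" for R
      unfolding is_pencil_def
    proof (intro conjI allI impI cRB[OF R])
      fix i j assume ij: "i < n" "j < n"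
      have "(const_mat R * B) $$ (i, j) = (\<Sum>k = 0..<n. Polynomial.smult (R $$ (i, k)) (B $$ (k, j)))"
        using R Bc ij by (simp add: scalar_prod_def)
      then show "Polynomial.degree ((const_mat R * B) $$ (i, j)) \<le> 1"
        using pB ij unfolding is_pencil_def
        by (auto intro!: degree_sum_le intro: order_trans[OF degree_smult_le] simp del: index_mult_mat(1))
    qed
    have pP: "is_pencil n n (const_mat R * B + - A)" if R: "R \<in> carrier_mat n n" for R
      using pRB[OF R] A unfolding is_pencil_def
      by (auto intro!: degree_diff_le simp del: index_mult_mat(1))
    have "B + - A = ?K"
      unfolding B_def using Ac Kc by (intro eq_matI) auto
    then have le: "normal_rank (B + - A) \<le> r" using normal_rank_outer_sum[OF K] by simp
    \<comment> \<open>Since \<open>\<eta>\<close> adds only the constant \<open>K\<close> to the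
      image of \<open>A\<close>, the coefficient of \<open>X\<close> in the image of
      \<open>R B - A\<close> is \<open>(R - 1) N\<close>, where \<open>N\<close> is that of
      \<open>A\<close>. It is nonsingular if \<open>R - 1\<close> is, and then so is the
      pencil.\<close>
    have "det (const_mat R * B + - A) \<noteq> 0"
      if R: "R \<in> carrier_mat n n" and dR: "det (R + - 1\<^sub>m n) \<noteq> 0" for R
    proof -
      let ?G = "const_mat R * B + - A"
      let ?A = "map_mat \<eta> (hom_pencil A)"
      let ?c = "map_mat (\<lambda>p. Polynomial.coeff p 1)"
      let ?N = "?c ?A"
      have N: "?N \<in> carrier_mat n n" using hA by simp
      have hG: "hom_pencil ?G \<in> carrier_mat n n" by (rule hom_pencil_carrier[OF is_pencil_carrier[OF pP[OF R]]])
      have hB: "map_mat \<eta> (hom_pencil B) = ?A + const_mat K"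
        unfolding B_def hom_pencil_eq using Ac Kc
        by (intro eq_matI) (auto simp: hom_linear_add hom_linear_smult hom_add hom_mult eta_const q(1)[symmetric] eta_L
            simp del: mult_pCons_left)
      have "?c (map_mat \<eta> (hom_pencil ?G)) = (R + - 1\<^sub>m n) * ?N"
      proof (rule eq_matI)
        fix i j assume "i < dim_row ((R + - 1\<^sub>m n) * ?N)" "j < dim_col ((R + - 1\<^sub>m n) * ?N)"
        then have ij: "i < n" "j < n" using R hA by auto
        have "hom_pencil (const_mat R * B + - A) $$ (i, j) =
          hom_pencil (const_mat R * B) $$ (i, j) - hom_pencil A $$ (i, j)"
          unfolding hom_pencil_eq using ij cRB[OF R] R Ac Bc
          by (simp add: hom_linear_def del: index_mult_mat(1))
        also have "hom_pencil (const_mat R * B) $$ (i, j) = (\<Sum>k = 0..<n. [:[:R $$ (i, k):]:] * hom_pencil B $$ (k, j))"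
          unfolding hom_pencil_const_mult[OF R Bc] using ij R Bc by (simp add: scalar_prod_def hom_pencil_eq)
        finally have "\<eta> (hom_pencil ?G $$ (i, j)) =
          (\<Sum>k = 0..<n. [:R $$ (i, k):] * \<eta> (hom_pencil B $$ (k, j))) - \<eta> (hom_pencil A $$ (i, j))"
          by (simp only: hom_minus hom_sum hom_mult eta_const)
        also have "(\<Sum>k = 0..<n. [:R $$ (i, k):] * \<eta> (hom_pencil B $$ (k, j))) =
          (\<Sum>k = 0..<n. [:R $$ (i, k):] * (\<eta> (hom_pencil A $$ (k, j)) + [:K $$ (k, j):]))"
        proof (intro sum.cong refl)
          fix k assume "k \<in> {0..<n}"
          then have "\<eta> (hom_pencil B $$ (k, j)) = map_mat \<eta> (hom_pencil B) $$ (k, j)"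
            using ij hom_pencil_carrier[OF Bc] by simp
          also have "\<dots> = \<eta> (hom_pencil A $$ (k, j)) + [:K $$ (k, j):]"
            unfolding hB using ij \<open>k \<in> {0..<n}\<close> hA Kc by simp
          finally show "[:R $$ (i, k):] * \<eta> (hom_pencil B $$ (k, j)) =
            [:R $$ (i, k):] * (\<eta> (hom_pencil A $$ (k, j)) + [:K $$ (k, j):])" by simp
        qed
        finally have "Polynomial.coeff (\<eta> (hom_pencil ?G $$ (i, j))) 1 =
          (\<Sum>k = 0..<n. R $$ (i, k) * Polynomial.coeff (\<eta> (hom_pencil A $$ (k, j))) 1) -
          Polynomial.coeff (\<eta> (hom_pencil A $$ (i, j))) 1"
          by (simp add: coeff_sum)
        also have "\<dots> = (R * ?N) $$ (i, j) - ?N $$ (i, j)"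
          using ij R hA by (simp add: scalar_prod_def)
        also have "\<dots> = ((R + - 1\<^sub>m n) * ?N) $$ (i, j)"
          using ij R N by (subst add_mult_distrib_mat[of _ n n]) (simp_all del: index_mult_mat(1))
        finally show "?c (map_mat \<eta> (hom_pencil ?G)) $$ (i, j) = ((R + - 1\<^sub>m n) * ?N) $$ (i, j)"
          using ij hG by simp
      qed (use R hA hG in auto)
      then have "det (?c (map_mat \<eta> (hom_pencil ?G))) = det (R + - 1\<^sub>m n) * det ?N"
        using R N by (simp add: det_mult[of _ n])
      then have ne: "det (?c (map_mat \<eta> (hom_pencil ?G))) \<noteq> 0" using dR A1 by simp
      from det_pencil_top_coeff[OF is_pencil_map_eta[OF is_pencil_carrier[OF pP[OF R]]] ne] ne
      have "det (map_mat \<eta> (hom_pencil ?G)) \<noteq> 0" by auto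
      then have "det (hom_pencil ?G) \<noteq> 0" unfolding hom_det by auto
      then show ?thesis unfolding det_hom_pencil_eq_0_iff[OF pP[OF R]] .
    qed
    then obtain R where R: "R \<in> carrier_mat n n" "det R = 1" and rank: "normal_rank (const_mat R * B + - A) = r"
      using exact_normal_rank[OF n Ac Bc le r] by blast
    \<comment> \<open>The perturbation is \<open>P = R B - A\<close>: then
      \<open>A + P = R B\<close>, and \<open>det R = 1\<close> preserves the homogeneous determinant
      of \<open>B\<close>.\<close>
    have "A + (const_mat R * B + - A) = const_mat R * B"
      using Ac cRB[OF R(1)] R(1) Bc by (intro eq_matI) (auto simp del: index_mult_mat(1))
    moreover have "det (hom_pencil (const_mat R * B)) = det (hom_pencil B)"
      unfolding hom_pencil_const_mult[OF R(1) Bc]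
      using R hom_pencil_carrier[OF Bc] const2_hom.hom_det[of R] by (subst det_mult[of _ n]) auto
    ultimately have "det (hom_pencil (A + (const_mat R * B + - A))) = Polynomial.smult [:k:] \<Psi>"
      using det unfolding B_def by simp
    then show ?thesis using pP[OF R(1)] rank k by blast
  qed
  show ?thesis unfolding prod using nec suf by blast
qed

end

section \<open>Values at base points and the two cases of the theorem\<close>

interpretation to_ac_hom: comm_ring_hom "to_ac :: 'a::field \<Rightarrow> _"
  by unfold_locales auto

lemma eval2_homogeneous:
  fixes p :: "'a::field poly poly"
  assumes "homogeneous e p"
  shows "eval2 p x y = (\<Sum>i\<le>e. to_ac (Polynomial.coeff (Polynomial.coeff p i) (e - i)) * y ^ (e - i) * x ^ i)"
proof -
  interpret m: map_poly_comm_ring_hom "to_ac :: 'a \<Rightarrow> _" ..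
  have "comm_ring_hom (\<lambda>q. poly (map_poly to_ac q) y :: 'a alg_closure)"
    by unfold_locales (simp_all add: m.hom_add m.hom_mult)
  then interpret k: map_poly_comm_ring_hom "\<lambda>q. poly (map_poly to_ac q) y :: 'a alg_closure"
    by (simp add: map_poly_comm_ring_hom_def)
  interpret e: comm_ring_hom "\<lambda>p :: 'a poly poly. eval2 p x y"
    by unfold_locales (simp_all add: eval2_def k.hom_add k.hom_mult)
  have "eval2 (Polynomial.monom (Polynomial.monom c j) i) x y = to_ac c * y ^ j * x ^ i" for c :: 'a and i j
    unfolding eval2_def by (simp add: map_poly_monom poly_monom)
  then show ?thesis by (subst homogeneous_eq_sum[OF assms]) (simp only: e.hom_sum)
qed

lemma coeff_linear_power_top: "Polynomial.coeff ([:1, l:] ^ i) i = (l::'a::comm_ring_1) ^ i"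
proof (induction i)
  case (Suc i)
  have "Polynomial.degree ([:1, l:] ^ i) \<le> i" by (rule degree_linear_power) simp
  then have "Polynomial.coeff ([:1, l:] ^ i) (Suc i) = 0" by (intro coeff_eq_0) simp
  then show ?case using Suc by simp
qed simp

text \<open>The sum is \<open>p(l, 1)\<close>: the top coefficient of the image is the value at the
  point sent to infinity. Avoiding the spectrum of \<Psi> thus becomes full degree of its
  image.\<close>

lemma coeff_ev2h_fin:
  assumes "homogeneous e p"
  shows "Polynomial.coeff (ev2h [:1, l:] [:0, 1:] p) e = (\<Sum>i\<le>e. Polynomial.coeff (Polynomial.coeff p i) (e - i) * l ^ i)"
proof -
  have "Polynomial.coeff ([:0, 1:] ^ (e - i) * [:1, l:] ^ i) e = l ^ i" if "i \<le> e" for i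
  proof -
    have "[:0, 1:] ^ (e - i) = Polynomial.monom (1::'a) (e - i)" by (simp add: monom_altdef)
    then show ?thesis using that coeff_linear_power_top[of l i] by (simp add: coeff_monom_mult)
  qed
  then show ?thesis unfolding ev2h_homogeneous[OF assms] by (simp add: coeff_sum)
qed

lemma coeff_ev2h_inf:
  assumes "homogeneous e p"
  shows "Polynomial.coeff (ev2h [:0, 1:] 1 p) e = Polynomial.coeff (Polynomial.coeff p e) 0"
proof -
  have "ev2h [:0, 1:] 1 p = (\<Sum>i\<le>e. Polynomial.monom (Polynomial.coeff (Polynomial.coeff p i) (e - i)) i)"
    unfolding ev2h_homogeneous[OF assms] by (simp add: monom_altdef)
  then show ?thesis by (simp add: coeff_sum)
qed

text \<open>Ranks in the spectrum are taken over the algebraic closure, but at a base point the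
  pencil takes its value \<open>N\<close> over \<open>F\<close>, and a nonzero determinant descends
  along \<open>to_ac\<close>.\<close>

lemma det_nonzero_outside_spectrum:
  assumes A: "regular_pencil n A" and c: "c \<notin> pencil_spectrum A"
    and P: "pencil_at A c = map_mat to_ac N" "N \<in> carrier_mat n n"
  shows "det N \<noteq> 0"
proof -
  have Ac: "A \<in> carrier_mat n n" and d: "det A \<noteq> 0"
    using A unfolding regular_pencil_def is_pencil_def by auto
  have "normal_rank A = n" using det_nonzero_iff_normal_rank[OF Ac] d by simp
  then have le: "n \<le> vec_space.rank n (map_mat to_ac N)"
    using c Ac unfolding pencil_spectrum_def P(1)[symmetric] by auto
  have Nc: "map_mat to_ac N \<in> carrier_mat n n" using P(2) by simp
  have "vec_space.rank n (map_mat to_ac N) \<le> n" using vec_space.rank_le_nc[OF Nc] .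
  then have "det (map_mat to_ac N) \<noteq> 0" using vec_space.det_rank_iff[OF Nc] le by simp
  then show ?thesis using to_ac_hom.hom_det[of N] by auto
qed

theorem theorem4p1:
  fixes A :: "'a::field poly mat" and \<Psi> :: "'a poly poly" and n r :: nat
  assumes "n \<ge> 2"
    and "regular_pencil n A"
    and "\<Psi> \<noteq> 0" and "homogeneous n \<Psi>" and "monic_wrt_s \<Psi>"
    and "\<not> base_points \<subseteq> pencil_spectrum A \<union> hom_poly_spectrum \<Psi>"
    and "r \<le> n"
  shows "(\<exists>P. is_pencil n n P \<and> normal_rank P = r \<and>
            (\<exists>k::'a. k \<noteq> 0 \<and> det (hom_pencil (A + P)) = Polynomial.smult [:k:] \<Psi>))
         \<longleftrightarrow> (\<Prod>i=1..n - r. hom_inv_factor A i) dvd \<Psi>"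
proof -
  have A: "is_pencil n n A" using assms(2) unfolding regular_pencil_def by simp
  have Ac: "A \<in> carrier_mat n n" using A by (rule is_pencil_carrier)
  obtain c where c: "c \<in> base_points" "c \<notin> pencil_spectrum A" "c \<notin> hom_poly_spectrum \<Psi>"
    using assms(6) by blast
  have \<Psi>c: "hom_poly_at \<Psi> c \<noteq> 0" using c(3) unfolding hom_poly_spectrum_def by simp
  consider "c = Infty" | l where "c = Fin (to_ac l)" using c(1) unfolding base_points_def by auto
  then show ?thesis
  proof cases
    case 1
    have "pencil_at A c = map_mat to_ac (map_mat (\<lambda>p. Polynomial.coeff p 1) A)"
      unfolding 1 by (intro eq_matI) auto
    then have "det (map_mat (\<lambda>p. Polynomial.coeff p 1) A) \<noteq> 0"
      by (rule det_nonzero_outside_spectrum[OF assms(2) c(2)]) (use Ac in simp)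
    then have N: "det (map_mat (\<lambda>p. Polynomial.coeff p 1) (map_mat (ev2h [:0, 1:] 1) (hom_pencil A))) \<noteq> 0"
      unfolding map_hom_pencil_inf[OF A] .
    have "eval2 \<Psi> 1 0 = (\<Sum>i\<le>n. if i = n then to_ac (Polynomial.coeff (Polynomial.coeff \<Psi> n) 0) else 0)"
      unfolding eval2_homogeneous[OF assms(4)] by (intro sum.cong) (auto simp: power_0_left)
    then have "to_ac (Polynomial.coeff (Polynomial.coeff \<Psi> n) 0) \<noteq> 0" using \<Psi>c unfolding 1 by simp
    then have top: "Polynomial.coeff (ev2h [:0, 1:] 1 \<Psi>) n \<noteq> 0" unfolding coeff_ev2h_inf[OF assms(4)] by auto
    \<comment> \<open>\<open>t\<close> is the homogenization of the constant \<open>1\<close>, so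
      the low rank term \<open>q K\<close> is a constant matrix in this case.\<close>
    have q: "[:[:0, 1:]:] = hom_linear (1 :: 'a poly)" "Polynomial.degree (1 :: 'a poly) \<le> 1"
      unfolding hom_linear_def by simp_all
    show ?thesis by (rule dehom_inf.low_rank_det_assignment_iff[OF assms(1) A q N assms(4) top assms(7)])
  next
    case (2 l)
    interpret dehom: dehomogenization "ev2h [:1, l:] [:0, 1:]" "[:[:0, 1:]:]" "[:[:0, - l:], 1:]" by (rule dehom_fin)
    let ?N = "map_mat (\<lambda>p. poly p l) A"
    have "pencil_at A c = map_mat to_ac ?N"
      unfolding 2 by (intro eq_matI) auto
    then have "det ?N \<noteq> 0"
      by (rule det_nonzero_outside_spectrum[OF assms(2) c(2)]) (use Ac in simp)
    \<comment> \<open>An entry \<open>a0 + s a1\<close> is sent to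
      \<open>a0 x + a1 (1 + l x)\<close>, whose coefficient at \<open>x\<close> is the value of the
      entry at \<open>l\<close>.\<close>
    moreover have "map_mat (\<lambda>p. Polynomial.coeff p 1) (map_mat (ev2h [:1, l:] [:0, 1:]) (hom_pencil A)) = ?N"
    proof (rule eq_matI)
      fix i j assume "i < dim_row ?N" "j < dim_col ?N"
      then have ij: "i < n" "j < n" using Ac by auto
      have "Polynomial.degree (A $$ (i, j)) \<le> 1" using A ij unfolding is_pencil_def by blast
      then have "poly (A $$ (i, j)) l = Polynomial.coeff (A $$ (i, j)) 0 + l * Polynomial.coeff (A $$ (i, j)) 1"
        using linear_poly_eq[of "A $$ (i, j)"] by (metis add.right_neutral mult_zero_right poly_0 poly_pCons)
      then show "map_mat (\<lambda>p. Polynomial.coeff p 1) (map_mat (ev2h [:1, l:] [:0, 1:]) (hom_pencil A)) $$ (i, j) = ?N $$ (i, j)"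
        using ij Ac unfolding hom_pencil_eq by (simp add: ev2h_hom_linear mult.commute)
    qed (simp_all add: hom_pencil_eq)
    ultimately have N: "det (map_mat (\<lambda>p. Polynomial.coeff p 1) (map_mat (ev2h [:1, l:] [:0, 1:]) (hom_pencil A))) \<noteq> 0"
      by simp
    have "eval2 \<Psi> (to_ac l) 1 = to_ac (\<Sum>i\<le>n. Polynomial.coeff (Polynomial.coeff \<Psi> i) (n - i) * l ^ i)"
      unfolding eval2_homogeneous[OF assms(4)] by (simp add: to_ac_sum)
    then have top: "Polynomial.coeff (ev2h [:1, l:] [:0, 1:] \<Psi>) n \<noteq> 0"
      using \<Psi>c unfolding 2 coeff_ev2h_fin[OF assms(4)] by auto
    \<comment> \<open>\<open>s - l t\<close> is the homogenization of \<open>s - l\<close>, so the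
      low rank term \<open>q K\<close> vanishes at \<open>l\<close>.\<close>
    have q: "[:[:0, - l:], 1:] = hom_linear [:- l, 1:]" "Polynomial.degree [:- l, 1:] \<le> 1"
      unfolding hom_linear_def by simp_all
    show ?thesis by (rule dehom.low_rank_det_assignment_iff[OF assms(1) A q N assms(4) top assms(7)])
  qed
qed

end
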